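(* For $n>2$, the alternating group $A_n$ has a generalized involution model with respect to an inner automorphism if and only if $n\in\{5,6\}$, and has a generalized involution model with respect to an outer (i.e. non-inner) automorphism if and only if $n\in\{3,4,7\}$.
   Context: A model for a finite group $G$ is a set $\{\lambda_i:H_i\to\mathbb{C}\}$ of linear (degree-one) characters of subgroups $H_i\subset G$ such that $\sum_i\mathrm{Ind}_{H_i}^G(\lambda_i)$ is the multiplicity-free sum of all irreducible complex characters of $G$. For $\tau\in\mathrm{Aut}(G)$ with $\tau^2=1$ write ${}^\tau g=\tau(g)$, ${}^\tau g^{-1}=\tau(g)^{-1}$ and $\mathcal{I}_{G,\tau}=\{\omega\in G:\omega\cdot{}^\tau\omega=1\}$. The group $G$ acts on $\mathcal{I}_{G,\tau}$ by twisted conjugation $g:\omega\mapsto g\cdot\omega\cdot{}^\tau g^{-1}$, and $C_{G,\tau}(\omega)$ is the stabilizer of $\omega$. A generalized involution model for $G$ with respect to $\tau$ (where $\tau^2=1$) is a model $\mathcal{M}$ for which there is an injective map $\iota:\mathcal{M}\to\mathcal{I}_{G,\tau}$ such that (a) each $\lambda\in\mathcal{M}$ is a linear character of $C_{G,\tau}(\iota(\lambda))$, and (b) the image of $\iota$ contains exactly one element of each orbit in $\mathcal{I}_{G,\tau}$. The identity automorphism counts as inner. *)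

theory Defs
  imports
    Complex_Main
    "HOL-Algebra.Sym_Groups"
    "HOL-Algebra.Group_Action"
    "Jordan_Normal_Form.VS_Connect"
begin

section \<open>Complex characters of groups\<close>

definition GL :: "nat \<Rightarrow> complex mat monoid"
  where "GL d = units_of (ring_mat TYPE(complex) d ())"

definition representation :: "('a, 'b) monoid_scheme \<Rightarrow> nat \<Rightarrow> ('a \<Rightarrow> complex mat) \<Rightarrow> bool"
  where "representation G d \<rho> \<longleftrightarrow> \<rho> \<in> hom G (GL d)"

definition irreducible_representation ::
    "('a, 'b) monoid_scheme \<Rightarrow> nat \<Rightarrow> ('a \<Rightarrow> complex mat) \<Rightarrow> bool"
  where "irreducible_representation G d \<rho> \<longleftrightarrow>
    representation G d \<rho> \<and> d > 0 \<and>
    (\<forall>W. VectorSpace.subspace class_ring W (module_vec TYPE(complex) d) \<longrightarrow>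
         (\<forall>g\<in>carrier G. \<forall>w\<in>W. \<rho> g *\<^sub>v w \<in> W) \<longrightarrow>
         W = {0\<^sub>v d} \<or> W = carrier_vec d)"

definition mat_trace :: "complex mat \<Rightarrow> complex"
  where "mat_trace A = (\<Sum>i<dim_row A. A $$ (i, i))"

text \<open>Characters, linear characters and automorphisms are extensional functions: they take the
  value \<open>undefined\<close> off the carrier. Hence two of them are equal iff they agree on the group, and
  sums over sets of characters count every character once.\<close>

definition rep_character :: "('a, 'b) monoid_scheme \<Rightarrow> ('a \<Rightarrow> complex mat) \<Rightarrow> 'a \<Rightarrow> complex"
  where "rep_character G \<rho> = (\<lambda>g\<in>carrier G. mat_trace (\<rho> g))"

definition Irr :: "('a, 'b) monoid_scheme \<Rightarrow> ('a \<Rightarrow> complex) set"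
  where "Irr G = {rep_character G \<rho> | d \<rho>. irreducible_representation G d \<rho>}"

definition linear_characters :: "('a, 'b) monoid_scheme \<Rightarrow> ('a \<Rightarrow> complex) set"
  where "linear_characters G = {rep_character G \<rho> | \<rho>. representation G 1 \<rho>}"

definition induced_character ::
    "('a, 'b) monoid_scheme \<Rightarrow> 'a set \<Rightarrow> ('a \<Rightarrow> complex) \<Rightarrow> 'a \<Rightarrow> complex"
  where "induced_character G H \<psi> = (\<lambda>g\<in>carrier G.
    (\<Sum>x | x \<in> carrier G \<and> inv\<^bsub>G\<^esub> x \<otimes>\<^bsub>G\<^esub> g \<otimes>\<^bsub>G\<^esub> x \<in> H.
        \<psi> (inv\<^bsub>G\<^esub> x \<otimes>\<^bsub>G\<^esub> g \<otimes>\<^bsub>G\<^esub> x)) / of_nat (card H))"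


section \<open>Generalized involution models\<close>

text \<open>A character \<open>\<psi> : H \<rightarrow> \<complex>\<close> is recorded as the pair \<open>(H, \<psi>)\<close>, so that its domain is
  part of the data.\<close>

definition model :: "('a, 'b) monoid_scheme \<Rightarrow> ('a set \<times> ('a \<Rightarrow> complex)) set \<Rightarrow> bool"
  where "model G M \<longleftrightarrow>
    finite M \<and>
    (\<forall>(H, \<psi>)\<in>M. subgroup H G \<and> \<psi> \<in> linear_characters (G\<lparr>carrier := H\<rparr>)) \<and>
    (\<forall>g\<in>carrier G. (\<Sum>(H, \<psi>)\<in>M. induced_character G H \<psi> g) = (\<Sum>\<chi>\<in>Irr G. \<chi> g))"

definition inner_auto :: "('a, 'b) monoid_scheme \<Rightarrow> ('a \<Rightarrow> 'a) set"
  where "inner_auto G = {\<lambda>g\<in>carrier G. x \<otimes>\<^bsub>G\<^esub> g \<otimes>\<^bsub>G\<^esub> inv\<^bsub>G\<^esub> x | x. x \<in> carrier G}"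

definition twisted_involutions :: "('a, 'b) monoid_scheme \<Rightarrow> ('a \<Rightarrow> 'a) \<Rightarrow> 'a set"
  where "twisted_involutions G \<tau> = {\<omega>\<in>carrier G. \<omega> \<otimes>\<^bsub>G\<^esub> \<tau> \<omega> = \<one>\<^bsub>G\<^esub>}"

definition twisted_conj :: "('a, 'b) monoid_scheme \<Rightarrow> ('a \<Rightarrow> 'a) \<Rightarrow> 'a \<Rightarrow> 'a \<Rightarrow> 'a"
  where "twisted_conj G \<tau> g =
    (\<lambda>\<omega>\<in>twisted_involutions G \<tau>. g \<otimes>\<^bsub>G\<^esub> \<omega> \<otimes>\<^bsub>G\<^esub> inv\<^bsub>G\<^esub> (\<tau> g))"

definition twisted_centralizer :: "('a, 'b) monoid_scheme \<Rightarrow> ('a \<Rightarrow> 'a) \<Rightarrow> 'a \<Rightarrow> 'a set"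
  where "twisted_centralizer G \<tau> \<omega> = stabilizer G (twisted_conj G \<tau>) \<omega>"

definition generalized_involution_model ::
    "('a, 'b) monoid_scheme \<Rightarrow> ('a \<Rightarrow> 'a) \<Rightarrow> ('a set \<times> ('a \<Rightarrow> complex)) set \<Rightarrow> bool"
  where "generalized_involution_model G \<tau> M \<longleftrightarrow>
    \<tau> \<in> auto G \<and> (\<forall>g\<in>carrier G. \<tau> (\<tau> g) = g) \<and> model G M \<and>
    (\<exists>\<iota>. inj_on \<iota> M \<and> \<iota> ` M \<subseteq> twisted_involutions G \<tau> \<and>
         (\<forall>(H, \<psi>)\<in>M. H = twisted_centralizer G \<tau> (\<iota> (H, \<psi>))) \<and>
         (\<forall>orb \<in> orbits G (twisted_involutions G \<tau>) (twisted_conj G \<tau>).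
            \<exists>!\<omega>. \<omega> \<in> \<iota> ` M \<and> \<omega> \<in> orb))"

end

theory Submission
  imports Defs "Jordan_Normal_Form.Spectral_Radius"
begin

text \<open>Let \<open>\<tau>\<close> be an automorphism of a finite group \<open>G\<close> with \<open>\<tau>\<^sup>2 = 1\<close>. A twisted version of the
  Frobenius-Schur theorem attaches to every irreducible character \<open>\<chi>\<close> an indicator \<open>\<epsilon>(\<chi>)\<close> in
  \<open>{-1, 0, 1}\<close> with \<open>#{x. x \<cdot> \<tau> x = g} = \<Sum>\<^sub>\<chi> \<epsilon>(\<chi>) \<chi>(g)\<close>, and \<open>\<epsilon>(\<chi>) \<noteq> 0\<close> iff \<open>\<chi>(\<tau> g) = \<chi>(g\<^sup>-\<^sup>1)\<close>
  for all \<open>g\<close>. The degree of the character induced in a generalized involution model is the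
  number of twisted involutions, which is \<open>\<Sum>\<^sub>\<chi> \<epsilon>(\<chi>) \<chi>(1)\<close>. Since it also is \<open>\<Sum>\<^sub>\<chi> \<chi>(1)\<close>, all
  indicators are 1. Hence \<open>\<tau> g\<close> is conjugate to \<open>g\<^sup>-\<^sup>1\<close> for all \<open>g\<close>, and a model amounts to
  linear characters \<open>F \<omega>\<close> of the stabilizers of all twisted involutions \<open>\<omega>\<close>, compatible with
  conjugation, with \<open>\<Sum> F \<omega> g = #{x. x \<cdot> \<tau> x = g}\<close>, where the sum runs over the \<open>\<omega>\<close> that \<open>g\<close>
  stabilizes (\<open>generalized_involution_model_imp\<close>, \<open>generalized_involution_model_exI\<close>).

  For alternating groups and \<open>n \<ge> 4\<close> such an automorphism maps 3-cycles to 3-cycles, so that it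
  is conjugation by some \<open>s\<close> in \<open>S\<^sub>n\<close> with \<open>s\<^sup>2 = 1\<close>; it is inner iff \<open>s\<close> is even. The map
  \<open>\<omega> \<mapsto> \<omega>s\<close> turns twisted involutions into the involutions of \<open>S\<^sub>n\<close> with the parity of \<open>s\<close> (the
  identity counted among them), stabilizers into centralizers in \<open>A\<^sub>n\<close>, and the \<open>x\<close> with
  \<open>x \<cdot> \<tau> x = g\<close> into the square roots of \<open>g\<close> in \<open>S\<^sub>n\<close> with the parity of \<open>s\<close>. The remaining
  question is for which \<open>n\<close> and which parity there is a family of linear characters as above
  (\<open>involution_characters\<close>).

  Necessity. Let the cycle lengths of \<open>g\<close> be odd and distinct, \<open>k\<close> in number. Then the
  centralizer of \<open>g\<close> in \<open>S\<^sub>n\<close> is even, so all permutations that invert \<open>g\<close> have the same sign,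
  namely the sign \<open>(-1) ^ ((n - k) div 2)\<close> of the reflection of every cycle. If every even
  permutation is inverted by a permutation of the parity of \<open>s\<close>, that sign must not depend on
  the choice of the cycle lengths, which leaves only \<open>n = 5, 6, 10, 14\<close> for even \<open>s\<close> and
  \<open>n = 3, 4, 7, 8, 12\<close> for odd \<open>s\<close>. The degrees 8, 12 and 14 are excluded by an element with
  more square roots than commuting involutions: a sum of values of linear characters cannot
  exceed the number of its terms. In degree 10 the equations for three elements without even
  square roots, together with conjugacy, contradict each other.

  Sufficiency. Take \<open>s = 1\<close> for \<open>n = 5, 6\<close> and a transposition for \<open>n = 3, 4, 7\<close>, and let
  \<open>F z g\<close> be the sign of the permutation that \<open>g\<close> induces on the set of 2-cycles of \<open>z\<close>. The
  equations for this family are checked by evaluation on representatives of the conjugacy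
  classes.\<close>

section \<open>Subspaces and matrices\<close>

definition vec_subspace :: "nat \<Rightarrow> complex vec set \<Rightarrow> bool"
  where "vec_subspace d W \<longleftrightarrow> W \<subseteq> carrier_vec d \<and> 0\<^sub>v d \<in> W \<and>
    (\<forall>u\<in>W. \<forall>v\<in>W. u + v \<in> W) \<and> (\<forall>c. \<forall>v\<in>W. c \<cdot>\<^sub>v v \<in> W)"

lemma subspace_iff_vec_subspace:
  "VectorSpace.subspace class_ring W (module_vec TYPE(complex) d) \<longleftrightarrow> vec_subspace d W"
proof -
  interpret vec_space "TYPE(complex)" d .
  have neg: "- v \<in> W" if "v \<in> W" "W \<subseteq> carrier_vec d" "\<forall>c. \<forall>v\<in>W. c \<cdot>\<^sub>v v \<in> W" for v
  proof -
    have "(-1) \<cdot>\<^sub>v v = - v" using that by (intro eq_vecI) auto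
    then show ?thesis using that by metis
  qed
  show ?thesis
    unfolding vec_subspace_def VectorSpace.subspace_def submodule_def
    using neg vectorspace_axioms module_axioms
    by (auto simp: module_vec_simps)
qed

definition mat_inj :: "complex mat \<Rightarrow> bool"
  where "mat_inj A \<longleftrightarrow>
    (\<forall>v\<in>carrier_vec (dim_col A). A *\<^sub>v v = 0\<^sub>v (dim_row A) \<longrightarrow> v = 0\<^sub>v (dim_col A))"

lemma mat_injD:
  assumes "mat_inj A" "A \<in> carrier_mat d l" "v \<in> carrier_vec l" "A *\<^sub>v v = 0\<^sub>v d"
  shows "v = 0\<^sub>v l"
  using assms unfolding mat_inj_def by auto

text \<open>Padding a matrix that has more columns than rows with zero rows yields a singular square
  matrix with the same kernel.\<close>

lemma mat_inj_le:
  assumes "mat_inj A" "A \<in> carrier_mat d l"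
  shows "l \<le> d"
proof (rule ccontr)
  assume "\<not> l \<le> d"
  then have dl: "d < l" by simp
  define A' where "A' = mat l l (\<lambda>(i,j). if i < d then A $$ (i,j) else 0)"
  have A': "A' \<in> carrier_mat l l" unfolding A'_def by simp
  have "A'\<^sup>T *\<^sub>v unit_vec l d = 0\<^sub>v l"
    by (rule eq_vecI) (use dl in \<open>auto simp: A'_def scalar_prod_right_unit\<close>)
  moreover have "unit_vec l d \<noteq> (0\<^sub>v l :: complex vec)" using dl by simp
  ultimately have "det A'\<^sup>T = 0"
    using det_0_iff_vec_prod_zero[of "A'\<^sup>T" l] A' by (meson transpose_carrier_mat unit_vec_carrier)
  then have "det A' = 0" using det_transpose[OF A'] by simp
  then obtain v where v: "v \<in> carrier_vec l" "v \<noteq> 0\<^sub>v l" "A' *\<^sub>v v = 0\<^sub>v l"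
    using det_0_iff_vec_prod_zero[OF A'] by blast
  have "A *\<^sub>v v = 0\<^sub>v d"
  proof (rule eq_vecI)
    fix i assume "i < dim_vec (0\<^sub>v d :: complex vec)"
    then have i: "i < d" by simp
    have "row A i = row A' i"
      by (rule eq_vecI) (use i dl assms(2) in \<open>auto simp: A'_def\<close>)
    then have "(A *\<^sub>v v) $ i = (A' *\<^sub>v v) $ i" using i dl assms(2) A' by auto
    then show "(A *\<^sub>v v) $ i = 0\<^sub>v d $ i" using v(3) i dl by simp
  qed (use assms(2) in auto)
  then show False using mat_injD[OF assms v(1)] v(2) by simp
qed

lemma mat_inj_inverse:
  assumes "mat_inj A" "A \<in> carrier_mat d l" "d \<le> l"
  obtains B where "l = d" "B \<in> carrier_mat d d" "A * B = 1\<^sub>m d" "B * A = 1\<^sub>m d"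
proof -
  have ld: "l = d" using mat_inj_le[OF assms(1,2)] assms(3) by simp
  then have A: "A \<in> carrier_mat d d" using assms(2) by simp
  have "det A \<noteq> 0"
    using det_0_iff_vec_prod_zero[OF A] mat_injD[OF assms(1) A] by blast
  then obtain B where "B \<in> carrier_mat d d" "B * A = 1\<^sub>m d" "A * B = 1\<^sub>m d"
    using det_non_zero_imp_unit[OF A, of "()"] unfolding Units_def by (auto simp: ring_mat_simps)
  then show ?thesis using that[of B] ld by auto
qed

text \<open>Every subspace is the range of an injective matrix: among the injective matrices with
  range inside \<open>W\<close>, one with the most columns will do, for a vector of \<open>W\<close> outside its range
  could be appended as a further column. Subspaces are handled through such matrices throughout.\<close>

lemma vec_subspace_basis:
  assumes W: "vec_subspace d W"
  obtains l F where "F \<in> carrier_mat d l" "mat_inj F" "W = {F *\<^sub>v v | v. v \<in> carrier_vec l}"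
proof -
  define P where "P l \<longleftrightarrow> (\<exists>F\<in>carrier_mat d l. mat_inj F \<and> (\<forall>v\<in>carrier_vec l. F *\<^sub>v v \<in> W))" for l
  have sub: "W \<subseteq> carrier_vec d" and zero: "0\<^sub>v d \<in> W" and add: "\<And>u v. u \<in> W \<Longrightarrow> v \<in> W \<Longrightarrow> u + v \<in> W"
    and sm: "\<And>c v. v \<in> W \<Longrightarrow> c \<cdot>\<^sub>v v \<in> W" using W unfolding vec_subspace_def by auto
  have P0: "P 0"
  proof -
    have "mat d 0 (\<lambda>_. 0) *\<^sub>v v = 0\<^sub>v d" if "v \<in> carrier_vec 0" for v :: "complex vec"
      using that by (intro eq_vecI) (auto simp: scalar_prod_def)
    then show ?thesis unfolding P_def mat_inj_def
      by (intro bexI[of _ "mat d 0 (\<lambda>_. 0)"]) (auto simp: zero)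
  qed
  have Ple: "l \<le> d" if "P l" for l using that mat_inj_le unfolding P_def by blast
  define l where "l = (GREATEST l. P l)"
  have Pl: "P l" unfolding l_def by (rule GreatestI_nat[of P 0 d]) (use P0 Ple in auto)
  have notP: "\<not> P (Suc l)"
    using Greatest_le_nat[of P "Suc l" d] Ple unfolding l_def[symmetric] by force
  from Pl obtain F where F: "F \<in> carrier_mat d l" "mat_inj F" "\<And>v. v \<in> carrier_vec l \<Longrightarrow> F *\<^sub>v v \<in> W"
    unfolding P_def by blast
  have "u \<in> {F *\<^sub>v v | v. v \<in> carrier_vec l}" if u: "u \<in> W" for u
  proof (rule ccontr)
    assume nu: "\<not> ?thesis"
    have ud: "u \<in> carrier_vec d" using u sub by auto
    define F' where "F' = mat d (Suc l) (\<lambda>(i,j). if j < l then F $$ (i,j) else u $ i)"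
    have F': "F' \<in> carrier_mat d (Suc l)" unfolding F'_def by simp
    have eq: "F' *\<^sub>v w = F *\<^sub>v (vec l (\<lambda>i. w $ i)) + w $ l \<cdot>\<^sub>v u" if "w \<in> carrier_vec (Suc l)" for w
      by (rule eq_vecI) (use that F(1) ud in \<open>auto simp: F'_def scalar_prod_def\<close>)
    have "mat_inj F'"
      unfolding mat_inj_def
    proof (intro ballI impI)
      fix w assume "w \<in> carrier_vec (dim_col F')" "F' *\<^sub>v w = 0\<^sub>v (dim_row F')"
      then have w: "w \<in> carrier_vec (Suc l)" and w0: "F' *\<^sub>v w = 0\<^sub>v d" using F' by auto
      define v where "v = vec l (\<lambda>i. w $ i)"
      have v: "v \<in> carrier_vec l" unfolding v_def by simp
      have s: "F *\<^sub>v v + w $ l \<cdot>\<^sub>v u = 0\<^sub>v d" using eq[OF w] w0 v_def by simp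
      have Fv: "F *\<^sub>v v \<in> carrier_vec d" using F(1) v by auto
      have "w $ l = 0"
      proof (rule ccontr)
        assume c: "w $ l \<noteq> 0"
        have "F *\<^sub>v ((- 1 / w $ l) \<cdot>\<^sub>v v) = (- 1 / w $ l) \<cdot>\<^sub>v (F *\<^sub>v v)"
          using F(1) v by (simp add: mult_mat_vec)
        also have "\<dots> = u"
        proof (rule eq_vecI)
          fix i assume i: "i < dim_vec u"
          have "(F *\<^sub>v v + w $ l \<cdot>\<^sub>v u) $ i = 0" using s i ud by simp
          then have "(F *\<^sub>v v) $ i + w $ l * u $ i = 0" using i ud Fv by simp
          then show "((- 1 / w $ l) \<cdot>\<^sub>v (F *\<^sub>v v)) $ i = u $ i" using c i ud Fv F(1)
            by (simp add: field_simps add_eq_0_iff)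
        qed (use ud F(1) in auto)
        finally show False using nu v by (metis (mono_tags, lifting) mem_Collect_eq smult_carrier_vec)
      qed
      moreover from this have "F *\<^sub>v v = 0\<^sub>v d" using s Fv ud F(1)
      by (intro eq_vecI) (auto dest!: vec_eq_iff[THEN iffD1])
      then have "v = 0\<^sub>v l" using mat_injD[OF F(2,1) v] by simp
      ultimately show "w = 0\<^sub>v (dim_col F')"
        using w F' unfolding v_def
        by (intro eq_vecI) (auto simp: less_Suc_eq dest!: vec_eq_iff[THEN iffD1])
    qed
    moreover have "F' *\<^sub>v w \<in> W" if "w \<in> carrier_vec (Suc l)" for w
      unfolding eq[OF that] by (intro add sm u F(3)) auto
    ultimately show False using notP F' unfolding P_def by blast
  qed
  then have "W = {F *\<^sub>v v | v. v \<in> carrier_vec l}" using F(3) by blast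
  then show ?thesis using that F(1,2) by blast
qed

lemma mat_unit_vec_col:
  fixes A :: "complex mat"
  assumes "A \<in> carrier_mat d l" "j < l"
  shows "A *\<^sub>v unit_vec l j = col A j"
  by (rule eq_vecI) (use assms in \<open>auto simp: scalar_prod_right_unit\<close>)

lemma mat_eq_by_vec:
  fixes A B :: "complex mat"
  assumes "A \<in> carrier_mat d l" "B \<in> carrier_mat d l"
    and "\<And>v. v \<in> carrier_vec l \<Longrightarrow> A *\<^sub>v v = B *\<^sub>v v"
  shows "A = B"
proof (rule mat_col_eqI)
  fix i assume "i < dim_col B"
  then have i: "i < l" using assms by simp
  have "col A i = A *\<^sub>v unit_vec l i" "col B i = B *\<^sub>v unit_vec l i"
    using mat_unit_vec_col[OF assms(1) i] mat_unit_vec_col[OF assms(2) i] by auto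
  then show "col A i = col B i" using assms(3)[of "unit_vec l i"] by simp
qed (use assms in auto)

lemma mat_from_columns:
  fixes E :: "complex mat"
  assumes "E \<in> carrier_mat d k" "A \<in> carrier_mat d l"
    and "\<And>v. v \<in> carrier_vec l \<Longrightarrow> \<exists>w\<in>carrier_vec k. A *\<^sub>v v = E *\<^sub>v w"
  obtains X where "X \<in> carrier_mat k l" "A = E * X"
proof -
  have "\<forall>j<l. \<exists>w\<in>carrier_vec k. col A j = E *\<^sub>v w"
  proof (intro allI impI)
    fix j assume j: "j < l"
    have "col A j = A *\<^sub>v unit_vec l j" using mat_unit_vec_col[OF assms(2) j] by simp
    then show "\<exists>w\<in>carrier_vec k. col A j = E *\<^sub>v w" using assms(3)[of "unit_vec l j"] by simp
  qed
  then obtain w where w: "\<And>j. j < l \<Longrightarrow> w j \<in> carrier_vec k \<and> col A j = E *\<^sub>v w j"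
    by metis
  define X where "X = mat k l (\<lambda>(i,j). w j $ i)"
  have X: "X \<in> carrier_mat k l" unfolding X_def by simp
  have "A = E * X"
  proof (rule mat_col_eqI)
    fix j assume "j < dim_col (E * X)"
    then have j: "j < l" using X by simp
    have "col X j = w j" using w[OF j] j unfolding X_def by (intro eq_vecI) auto
    then show "col A j = col (E * X) j" using w[OF j] j assms(1) X col_mult2 by metis
  qed (use assms X in auto)
  then show ?thesis using that X by blast
qed

lemma mat_inj_cancel:
  assumes "mat_inj E" "E \<in> carrier_mat d k" "X \<in> carrier_mat k l" "Y \<in> carrier_mat k l" "E * X = E * Y"
  shows "X = Y"
proof (rule mat_eq_by_vec[OF assms(3,4)])
  fix v :: "complex vec" assume v: "v \<in> carrier_vec l"
  have Xv: "X *\<^sub>v v \<in> carrier_vec k" "Y *\<^sub>v v \<in> carrier_vec k" using assms v by auto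
  have "E *\<^sub>v (X *\<^sub>v v) = E *\<^sub>v (Y *\<^sub>v v)"
    using assoc_mult_mat_vec[OF assms(2,3) v] assoc_mult_mat_vec[OF assms(2,4) v] assms(5) by simp
  then have "E *\<^sub>v (X *\<^sub>v v - Y *\<^sub>v v) = 0\<^sub>v d"
    using mult_minus_distrib_mat_vec[OF assms(2) Xv] assms(2) Xv by auto
  then have "X *\<^sub>v v - Y *\<^sub>v v = 0\<^sub>v k" using mat_injD[OF assms(1,2)] Xv by auto
  then show "X *\<^sub>v v = Y *\<^sub>v v" using Xv
    by (intro eq_vecI) (metis carrier_vecD eq_iff_diff_eq_0 index_minus_vec(1) index_zero_vec(1), use assms in simp)
qed

lemma mat_trace_comm:
  assumes "A \<in> carrier_mat d e" "B \<in> carrier_mat e d"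
  shows "mat_trace (A * B) = mat_trace (B * A)"
proof -
  have "mat_trace (A * B) = (\<Sum>i<d. \<Sum>j<e. A $$ (i,j) * B $$ (j,i))"
    using assms by (simp add: mat_trace_def scalar_prod_def lessThan_atLeast0)
  also have "\<dots> = (\<Sum>j<e. \<Sum>i<d. B $$ (j,i) * A $$ (i,j))"
    by (subst sum.swap) (simp add: mult.commute)
  also have "\<dots> = mat_trace (B * A)"
    using assms by (simp add: mat_trace_def scalar_prod_def lessThan_atLeast0)
  finally show ?thesis .
qed

lemma mat_trace_one: "mat_trace (1\<^sub>m d) = of_nat d"
  by (simp add: mat_trace_def)

lemma mat_trace_smult: "A \<in> carrier_mat d d \<Longrightarrow> mat_trace (c \<cdot>\<^sub>m A) = c * mat_trace A"
  by (simp add: mat_trace_def sum_distrib_left)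

lemma vec_subspace_range:
  fixes A :: "complex mat"
  assumes "A \<in> carrier_mat d e"
  shows "vec_subspace d {A *\<^sub>v v | v. v \<in> carrier_vec e}"
  unfolding vec_subspace_def
proof (intro conjI ballI allI)
  show "0\<^sub>v d \<in> {A *\<^sub>v v |v. v \<in> carrier_vec e}"
    using assms by (intro CollectI exI[of _ "0\<^sub>v e"]) auto
next
  fix u v assume "u \<in> {A *\<^sub>v v |v. v \<in> carrier_vec e}" "v \<in> {A *\<^sub>v v |v. v \<in> carrier_vec e}"
  then obtain a b where "a \<in> carrier_vec e" "b \<in> carrier_vec e" "u = A *\<^sub>v a" "v = A *\<^sub>v b" by auto
  then show "u + v \<in> {A *\<^sub>v v |v. v \<in> carrier_vec e}"
    using assms by (intro CollectI exI[of _ "a + b"]) (auto simp: mult_add_distrib_mat_vec)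
next
  fix c v assume "v \<in> {A *\<^sub>v v |v. v \<in> carrier_vec e}"
  then obtain a where "a \<in> carrier_vec e" "v = A *\<^sub>v a" by auto
  then show "c \<cdot>\<^sub>v v \<in> {A *\<^sub>v v |v. v \<in> carrier_vec e}"
    using assms by (intro CollectI exI[of _ "c \<cdot>\<^sub>v a"]) (auto simp: mult_mat_vec)
qed (use assms in auto)

text \<open>The trace of a projection is its rank: if the columns of \<open>F\<close> form a basis of the range of
  \<open>P\<close>, then \<open>P = F * Q\<close> with \<open>Q * F = 1\<close>.\<close>

lemma mat_trace_idempotent:
  assumes P: "P \<in> carrier_mat d d" and PP: "P * P = P"
  obtains r where "mat_trace P = of_nat r"
proof -
  define W where "W = {P *\<^sub>v v | v. v \<in> carrier_vec d}"
  have "vec_subspace d W" unfolding W_def by (rule vec_subspace_range[OF P])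
  then obtain l F where F: "F \<in> carrier_mat d l" "mat_inj F" and WF: "W = {F *\<^sub>v v | v. v \<in> carrier_vec l}"
    by (rule vec_subspace_basis)
  have "\<exists>w\<in>carrier_vec l. P *\<^sub>v v = F *\<^sub>v w" if "v \<in> carrier_vec d" for v
    using that WF unfolding W_def by blast
  then obtain Q where Q: "Q \<in> carrier_mat l d" "P = F * Q" using mat_from_columns[OF F(1) P] by metis
  have "P * F = F"
  proof (rule mat_eq_by_vec)
    fix v :: "complex vec" assume v: "v \<in> carrier_vec l"
    then have "F *\<^sub>v v \<in> W" using WF by auto
    then obtain u where u: "u \<in> carrier_vec d" "F *\<^sub>v v = P *\<^sub>v u" unfolding W_def by auto
    have "P * F *\<^sub>v v = P *\<^sub>v (P *\<^sub>v u)" using assoc_mult_mat_vec[OF P F(1) v] u by simp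
    also have "\<dots> = P *\<^sub>v u" using assoc_mult_mat_vec[OF P P u(1)] PP by simp
    finally show "P * F *\<^sub>v v = F *\<^sub>v v" using u by simp
  qed (use P F in auto)
  then have "F * (Q * F) = F * 1\<^sub>m l" using assoc_mult_mat[OF F(1) Q(1) F(1)] Q(2) F(1) by simp
  then have QF: "Q * F = 1\<^sub>m l"
    by (rule mat_inj_cancel[OF F(2,1) mult_carrier_mat[OF Q(1) F(1)] one_carrier_mat])
  have "mat_trace P = mat_trace (Q * F)" unfolding Q(2) by (rule mat_trace_comm[OF F(1) Q(1)])
  then show ?thesis using that[of l] QF by (simp add: mat_trace_one)
qed

section \<open>Representations by matrices\<close>

lemma GL_group: "group (GL d)"
proof -
  interpret ring "ring_mat TYPE(complex) d ()" by (rule ring_mat)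
  show ?thesis unfolding GL_def by (rule units_group)
qed

lemma GL_carrier: "A \<in> carrier (GL d) \<Longrightarrow> A \<in> carrier_mat d d"
  unfolding GL_def units_of_def Units_def by (auto simp: ring_mat_simps)

lemma GL_mult: "A \<otimes>\<^bsub>GL d\<^esub> B = A * B"
  unfolding GL_def units_of_def by (auto simp: ring_mat_simps)

lemma GL_one: "\<one>\<^bsub>GL d\<^esub> = 1\<^sub>m d"
  unfolding GL_def units_of_def by (auto simp: ring_mat_simps)

lemma representation_carrier:
  "representation G d \<rho> \<Longrightarrow> g \<in> carrier G \<Longrightarrow> \<rho> g \<in> carrier_mat d d"
  unfolding representation_def by (intro GL_carrier) (auto simp: hom_def)

lemma representation_mult:
  "representation G d \<rho> \<Longrightarrow> g \<in> carrier G \<Longrightarrow> h \<in> carrier G \<Longrightarrow> \<rho> (g \<otimes>\<^bsub>G\<^esub> h) = \<rho> g * \<rho> h"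
  unfolding representation_def by (auto simp: hom_def GL_mult)

lemma representation_one:
  assumes "group G" "representation G d \<rho>"
  shows "\<rho> \<one>\<^bsub>G\<^esub> = 1\<^sub>m d"
proof -
  interpret group_hom G "GL d" \<rho>
    using assms GL_group by (simp add: group_hom_def group_hom_axioms_def representation_def)
  show ?thesis using hom_one by (simp add: GL_one)
qed

lemma representationI:
  fixes G (structure)
  assumes "group G"
    and car: "\<And>g. g \<in> carrier G \<Longrightarrow> \<rho> g \<in> carrier_mat d d"
    and mul: "\<And>g h. g \<in> carrier G \<Longrightarrow> h \<in> carrier G \<Longrightarrow> \<rho> (g \<otimes> h) = \<rho> g * \<rho> h"
    and one: "\<rho> \<one> = 1\<^sub>m d"
  shows "representation G d \<rho>"
proof -
  interpret group G by fact
  have "\<rho> g \<in> carrier (GL d)" if g: "g \<in> carrier G" for g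
  proof -
    have "\<rho> g * \<rho> (inv g) = 1\<^sub>m d" "\<rho> (inv g) * \<rho> g = 1\<^sub>m d"
      using mul[of g "inv g"] mul[of "inv g" g] one g by auto
    then show ?thesis using car[OF g] car[of "inv g"] g
      unfolding GL_def units_of_def Units_def by (auto simp: ring_mat_simps)
  qed
  then show ?thesis unfolding representation_def hom_def by (auto simp: GL_mult mul)
qed

lemma irreducible_representationD:
  assumes "irreducible_representation G d \<rho>"
  shows "representation G d \<rho>" "d > 0"
    and "vec_subspace d W \<Longrightarrow> (\<And>g w. g \<in> carrier G \<Longrightarrow> w \<in> W \<Longrightarrow> \<rho> g *\<^sub>v w \<in> W) \<Longrightarrow>
      W \<noteq> {0\<^sub>v d} \<Longrightarrow> W = carrier_vec d"
  using assms unfolding irreducible_representation_def subspace_iff_vec_subspace by auto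

section \<open>Sums of matrices\<close>

definition mat_sum :: "nat \<Rightarrow> nat \<Rightarrow> ('i \<Rightarrow> complex mat) \<Rightarrow> 'i set \<Rightarrow> complex mat"
  where "mat_sum d e f S = mat d e (\<lambda>ij. \<Sum>s\<in>S. f s $$ ij)"

lemma mat_sum_carrier [simp]: "mat_sum d e f S \<in> carrier_mat d e"
  "dim_row (mat_sum d e f S) = d" "dim_col (mat_sum d e f S) = e"
  unfolding mat_sum_def by auto

lemma mat_sum_index: "i < d \<Longrightarrow> j < e \<Longrightarrow> mat_sum d e f S $$ (i,j) = (\<Sum>s\<in>S. f s $$ (i,j))"
  unfolding mat_sum_def by simp

lemma mat_sum_cong: "(\<And>s. s \<in> S \<Longrightarrow> f s = g s) \<Longrightarrow> mat_sum d e f S = mat_sum d e g S"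
  unfolding mat_sum_def by (intro cong_mat) (auto intro: sum.cong)

lemma mat_sum_reindex:
  assumes "bij_betw h S T"
  shows "mat_sum d e (\<lambda>s. f (h s)) S = mat_sum d e f T"
  unfolding mat_sum_def by (intro cong_mat) (auto intro: sum.reindex_bij_betw[OF assms])

lemma mult_mat_sum:
  assumes "A \<in> carrier_mat c d" "\<And>s. s \<in> S \<Longrightarrow> f s \<in> carrier_mat d e"
  shows "A * mat_sum d e f S = mat_sum c e (\<lambda>s. A * f s) S"
proof (rule eq_matI)
  fix i j assume "i < dim_row (mat_sum c e (\<lambda>s. A * f s) S)" "j < dim_col (mat_sum c e (\<lambda>s. A * f s) S)"
  then have i: "i < c" and j: "j < e" by auto
  have "(A * mat_sum d e f S) $$ (i,j) = (\<Sum>k<d. A $$ (i,k) * (\<Sum>s\<in>S. f s $$ (k,j)))"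
    using assms(1) i j by (simp add: scalar_prod_def lessThan_atLeast0 mat_sum_index)
  also have "\<dots> = (\<Sum>s\<in>S. \<Sum>k<d. A $$ (i,k) * f s $$ (k,j))"
    by (subst sum.swap) (simp add: sum_distrib_left)
  also have "\<dots> = (\<Sum>s\<in>S. (A * f s) $$ (i,j))"
  proof (rule sum.cong)
    fix s assume "s \<in> S"
    from assms(2)[OF this] show "(\<Sum>k<d. A $$ (i,k) * f s $$ (k,j)) = (A * f s) $$ (i,j)"
      using assms(1) i j by (simp add: scalar_prod_def lessThan_atLeast0)
  qed simp
  finally show "(A * mat_sum d e f S) $$ (i,j) = mat_sum c e (\<lambda>s. A * f s) S $$ (i,j)"
    using i j by (simp add: mat_sum_index)
qed (use assms in auto)

lemma mat_sum_transpose: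
  assumes "\<And>s. s \<in> S \<Longrightarrow> f s \<in> carrier_mat d e"
  shows "(mat_sum d e f S)\<^sup>T = mat_sum e d (\<lambda>s. (f s)\<^sup>T) S"
proof (rule eq_matI)
  fix i j assume "i < dim_row (mat_sum e d (\<lambda>s. (f s)\<^sup>T) S)" "j < dim_col (mat_sum e d (\<lambda>s. (f s)\<^sup>T) S)"
  then have i: "i < e" and j: "j < d" by auto
  have "(\<Sum>s\<in>S. f s $$ (j,i)) = (\<Sum>s\<in>S. (f s)\<^sup>T $$ (i,j))"
    by (rule sum.cong) (use assms i j in fastforce)+
  then show "(mat_sum d e f S)\<^sup>T $$ (i,j) = mat_sum e d (\<lambda>s. (f s)\<^sup>T) S $$ (i,j)"
    using i j by (simp add: mat_sum_index)
qed auto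

lemma mat_sum_mult:
  assumes "A \<in> carrier_mat e c" "\<And>s. s \<in> S \<Longrightarrow> f s \<in> carrier_mat d e"
  shows "mat_sum d e f S * A = mat_sum d c (\<lambda>s. f s * A) S"
proof (rule eq_matI)
  fix i j assume "i < dim_row (mat_sum d c (\<lambda>s. f s * A) S)" "j < dim_col (mat_sum d c (\<lambda>s. f s * A) S)"
  then have i: "i < d" and j: "j < c" by auto
  have "(mat_sum d e f S * A) $$ (i,j) = (\<Sum>k<e. (\<Sum>s\<in>S. f s $$ (i,k)) * A $$ (k,j))"
    using assms(1) i j by (simp add: scalar_prod_def lessThan_atLeast0 mat_sum_index)
  also have "\<dots> = (\<Sum>s\<in>S. \<Sum>k<e. f s $$ (i,k) * A $$ (k,j))"
    by (subst sum.swap) (simp add: sum_distrib_right)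
  also have "\<dots> = (\<Sum>s\<in>S. (f s * A) $$ (i,j))"
  proof (rule sum.cong)
    fix s assume "s \<in> S"
    from assms(2)[OF this] show "(\<Sum>k<e. f s $$ (i,k) * A $$ (k,j)) = (f s * A) $$ (i,j)"
      using assms(1) i j by (simp add: scalar_prod_def lessThan_atLeast0)
  qed simp
  finally show "(mat_sum d e f S * A) $$ (i,j) = mat_sum d c (\<lambda>s. f s * A) S $$ (i,j)"
    using i j by (simp add: mat_sum_index)
qed (use assms in auto)

lemma mat_trace_mat_sum:
  assumes "\<And>s. s \<in> S \<Longrightarrow> f s \<in> carrier_mat d d"
  shows "mat_trace (mat_sum d d f S) = (\<Sum>s\<in>S. mat_trace (f s))"
proof -
  have "mat_trace (mat_sum d d f S) = (\<Sum>i<d. \<Sum>s\<in>S. f s $$ (i,i))"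
    by (simp add: mat_trace_def mat_sum_index)
  also have "\<dots> = (\<Sum>s\<in>S. \<Sum>i<d. f s $$ (i,i))" by (rule sum.swap)
  also have "\<dots> = (\<Sum>s\<in>S. mat_trace (f s))"
    by (rule sum.cong) (use assms in \<open>auto simp: mat_trace_def\<close>)
  finally show ?thesis .
qed

definition mat_unit :: "nat \<Rightarrow> nat \<Rightarrow> nat \<Rightarrow> nat \<Rightarrow> complex mat"
  where "mat_unit d e j k = mat d e (\<lambda>(a,b). if a = j \<and> b = k then 1 else 0)"

lemma mat_unit_carrier [simp]: "mat_unit d e j k \<in> carrier_mat d e"
  unfolding mat_unit_def by simp

lemma mat_unit_transpose: "(mat_unit d e j k)\<^sup>T = mat_unit e d k j"
  unfolding mat_unit_def by (rule eq_matI) auto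

lemma mult_mat_unit_mult:
  assumes "A \<in> carrier_mat c d" "B \<in> carrier_mat e f" "j < d" "k < e" "i < c" "l < f"
  shows "(A * mat_unit d e j k * B) $$ (i,l) = A $$ (i,j) * B $$ (k,l)"
proof -
  have *: "(A * mat_unit d e j k) $$ (i,b) = (if b = k then A $$ (i,j) else 0)" if "b < e" for b
    using assms that
    by (simp add: scalar_prod_def mat_unit_def if_distrib[of "(*) _"] cong: if_cong)
  have row: "row (A * mat_unit d e j k) i $ b = (if b = k then A $$ (i,j) else 0)" if "b < e" for b
    using *[OF that] assms that by (subst index_row(1)) (auto simp: mat_unit_def)
  have "(A * mat_unit d e j k * B) $$ (i,l) = row (A * mat_unit d e j k) i \<bullet> col B l"
    using assms by simp
  also have "\<dots> = (\<Sum>b<e. (if b = k then A $$ (i,j) else 0) * B $$ (b,l))"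
    unfolding scalar_prod_def using assms row
    by (intro sum.cong) (auto simp del: index_row(1))
  also have "\<dots> = A $$ (i,j) * B $$ (k,l)" using assms(4)
    by (simp add: if_distrib[of "\<lambda>x. x * _"] cong: if_cong)
  finally show ?thesis .
qed

section \<open>Schur's lemma and the orthogonality relations\<close>

lemma zero_mat_mult_vec: "v \<in> carrier_vec e \<Longrightarrow> 0\<^sub>m d e *\<^sub>v v = (0\<^sub>v d :: complex vec)"
  by (rule eq_vecI) auto

lemma scalar_mat_mult_vec:
  fixes v :: "complex vec"
  assumes "v \<in> carrier_vec d"
  shows "(c \<cdot>\<^sub>m 1\<^sub>m d) *\<^sub>v v = c \<cdot>\<^sub>v v"
proof (rule eq_vecI)
  fix i assume "i < dim_vec (c \<cdot>\<^sub>v v)"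
  then have i: "i < d" using assms by simp
  have "row (c \<cdot>\<^sub>m 1\<^sub>m d) i = c \<cdot>\<^sub>v unit_vec d i" using i by (intro eq_vecI) auto
  then show "((c \<cdot>\<^sub>m 1\<^sub>m d) *\<^sub>v v) $ i = (c \<cdot>\<^sub>v v) $ i" using i assms by simp
qed (use assms in auto)

lemma range_zero_imp_zero:
  fixes A :: "complex mat"
  assumes "A \<in> carrier_mat d e" "{A *\<^sub>v v | v. v \<in> carrier_vec e} = {0\<^sub>v d}"
  shows "A = 0\<^sub>m d e"
  by (rule mat_eq_by_vec[OF assms(1)]) (use assms(2) in \<open>auto simp: zero_mat_mult_vec\<close>)

text \<open>The range of a nonzero intertwiner is a nonzero invariant subspace of the irreducible
  target, hence everything.\<close>

lemma intertwiner_right_inverse: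
  assumes irr: "irreducible_representation G d \<rho>"
    and A: "A \<in> carrier_mat d e" "A \<noteq> 0\<^sub>m d e"
    and \<sigma>: "\<And>g. g \<in> carrier G \<Longrightarrow> \<sigma> g \<in> carrier_mat e e"
    and int: "\<And>g. g \<in> carrier G \<Longrightarrow> \<rho> g * A = A * \<sigma> g"
  obtains X where "X \<in> carrier_mat e d" "A * X = 1\<^sub>m d"
proof -
  note rep = irreducible_representationD(1)[OF irr]
  define W where "W = {A *\<^sub>v v | v. v \<in> carrier_vec e}"
  have "W = carrier_vec d"
  proof (rule irreducible_representationD(3)[OF irr])
    show "vec_subspace d W" unfolding W_def by (rule vec_subspace_range[OF A(1)])
    show "W \<noteq> {0\<^sub>v d}" using range_zero_imp_zero[OF A(1)] A(2) unfolding W_def by blast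
    fix g w assume g: "g \<in> carrier G" and "w \<in> W"
    then obtain v where v: "v \<in> carrier_vec e" "w = A *\<^sub>v v" unfolding W_def by auto
    have "\<rho> g *\<^sub>v w = A *\<^sub>v (\<sigma> g *\<^sub>v v)"
      using assoc_mult_mat_vec[OF representation_carrier[OF rep g] A(1) v(1)]
        assoc_mult_mat_vec[OF A(1) \<sigma>[OF g] v(1)] int[OF g] v(2) by simp
    then show "\<rho> g *\<^sub>v w \<in> W" using \<sigma>[OF g] v(1) unfolding W_def by auto
  qed
  then have "\<exists>w\<in>carrier_vec e. 1\<^sub>m d *\<^sub>v v = A *\<^sub>v w" if "v \<in> carrier_vec d" for v
    using that unfolding W_def by auto
  then obtain X where "X \<in> carrier_mat e d" "1\<^sub>m d = A * X"
    using mat_from_columns[OF A(1) one_carrier_mat] by metis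
  then show ?thesis using that by metis
qed

text \<open>Schur's lemma: an eigenspace of the intertwiner is invariant, and over the complex numbers
  there is a nonzero one.\<close>

lemma schur_scalar:
  assumes irr: "irreducible_representation G d \<rho>" and A: "A \<in> carrier_mat d d"
    and int: "\<And>g. g \<in> carrier G \<Longrightarrow> \<rho> g * A = A * \<rho> g"
  obtains c where "A = c \<cdot>\<^sub>m 1\<^sub>m d"
proof -
  note rep = irreducible_representationD(1)[OF irr]
  from spectrum_non_empty[OF A irreducible_representationD(2)[OF irr]]
  obtain c v where v: "v \<in> carrier_vec d" "v \<noteq> 0\<^sub>v d" "A *\<^sub>v v = c \<cdot>\<^sub>v v"
    using A unfolding spectrum_def eigenvalue_def eigenvector_def by auto
  define W where "W = {v \<in> carrier_vec d. A *\<^sub>v v = c \<cdot>\<^sub>v v}"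
  have "W = carrier_vec d"
  proof (rule irreducible_representationD(3)[OF irr])
    show "vec_subspace d W" unfolding W_def vec_subspace_def
      using A by (auto simp: mult_add_distrib_mat_vec smult_add_distrib_vec mult_mat_vec
          smult_smult_assoc mult.commute)
    show "W \<noteq> {0\<^sub>v d}" using v unfolding W_def by auto
    fix g w assume g: "g \<in> carrier G" and "w \<in> W"
    then have w: "w \<in> carrier_vec d" "A *\<^sub>v w = c \<cdot>\<^sub>v w" unfolding W_def by auto
    note R = representation_carrier[OF rep g]
    have "A *\<^sub>v (\<rho> g *\<^sub>v w) = \<rho> g *\<^sub>v (A *\<^sub>v w)"
      using assoc_mult_mat_vec[OF A R w(1)] assoc_mult_mat_vec[OF R A w(1)] int[OF g] by simp
    also have "\<dots> = c \<cdot>\<^sub>v (\<rho> g *\<^sub>v w)" using w R by (simp add: mult_mat_vec)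
    finally show "\<rho> g *\<^sub>v w \<in> W" using R w(1) unfolding W_def by auto
  qed
  then have "A *\<^sub>v v = (c \<cdot>\<^sub>m 1\<^sub>m d) *\<^sub>v v" if "v \<in> carrier_vec d" for v
    using that unfolding W_def by (auto simp: scalar_mat_mult_vec)
  then have "A = c \<cdot>\<^sub>m 1\<^sub>m d" by (intro mat_eq_by_vec[OF A]) auto
  then show ?thesis by (rule that)
qed

text \<open>Range and kernel of a nonzero intertwiner between irreducible representations are
  invariant, so the intertwiner is invertible and the traces agree.\<close>

lemma intertwiner_iso:
  assumes irr: "irreducible_representation G d \<rho>" "irreducible_representation G e \<sigma>"
    and A: "A \<in> carrier_mat d e" "A \<noteq> 0\<^sub>m d e"
    and int: "\<And>g. g \<in> carrier G \<Longrightarrow> \<rho> g * A = A * \<sigma> g"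
  shows "rep_character G \<rho> = rep_character G \<sigma>"
proof -
  note rep = irreducible_representationD(1)[OF irr(1)] irreducible_representationD(1)[OF irr(2)]
  note R = representation_carrier[OF rep(1)] and S = representation_carrier[OF rep(2)]
  obtain X where X: "X \<in> carrier_mat e d" "A * X = 1\<^sub>m d"
    using intertwiner_right_inverse[OF irr(1) A S int] by blast
  define W where "W = {v \<in> carrier_vec e. A *\<^sub>v v = 0\<^sub>v d}"
  have "W = {0\<^sub>v e}"
  proof (rule ccontr)
    assume "W \<noteq> {0\<^sub>v e}"
    have "W = carrier_vec e"
    proof (rule irreducible_representationD(3)[OF irr(2) _ _ \<open>W \<noteq> {0\<^sub>v e}\<close>])
      show "vec_subspace e W" unfolding W_def vec_subspace_def
        using A by (auto simp: mult_add_distrib_mat_vec mult_mat_vec)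
      fix g w assume g: "g \<in> carrier G" and "w \<in> W"
      then have w: "w \<in> carrier_vec e" "A *\<^sub>v w = 0\<^sub>v d" unfolding W_def by auto
      have "A *\<^sub>v (\<sigma> g *\<^sub>v w) = \<rho> g *\<^sub>v (A *\<^sub>v w)"
        using assoc_mult_mat_vec[OF A(1) S[OF g] w(1)] assoc_mult_mat_vec[OF R[OF g] A(1) w(1)]
          int[OF g] by simp
      also have "\<dots> = 0\<^sub>v d" using w R[OF g] by auto
      finally show "\<sigma> g *\<^sub>v w \<in> W" using S[OF g] w(1) unfolding W_def by auto
    qed
    then have "A = 0\<^sub>m d e" unfolding W_def
      by (intro mat_eq_by_vec[OF A(1)]) (auto simp: zero_mat_mult_vec)
    then show False using A(2) by simp
  qed
  then have inj: "mat_inj A" using A(1) unfolding mat_inj_def W_def by auto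
  have "A * (X * A) = A * 1\<^sub>m e"
    using assoc_mult_mat[OF A(1) X(1) A(1)] X(2) A(1) by simp
  then have XA: "X * A = 1\<^sub>m e"
    by (rule mat_inj_cancel[OF inj A(1) mult_carrier_mat[OF X(1) A(1)] one_carrier_mat])
  have "mat_trace (\<rho> g) = mat_trace (\<sigma> g)" if g: "g \<in> carrier G" for g
  proof -
    have "\<rho> g = \<rho> g * (A * X)" using R[OF g] X(2) by simp
    also have "\<dots> = A * \<sigma> g * X" using assoc_mult_mat[OF R[OF g] A(1) X(1)] int[OF g] by simp
    also have "\<dots> = A * (\<sigma> g * X)" by (rule assoc_mult_mat[OF A(1) S[OF g] X(1)])
    finally have "mat_trace (\<rho> g) = mat_trace ((\<sigma> g * X) * A)"
      using mat_trace_comm[OF A(1) mult_carrier_mat[OF S[OF g] X(1)]] by simp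
    also have "(\<sigma> g * X) * A = \<sigma> g"
      using assoc_mult_mat[OF S[OF g] X(1) A(1)] XA S[OF g] by simp
    finally show ?thesis .
  qed
  then show ?thesis unfolding rep_character_def by (auto intro: restrict_ext)
qed

locale finite_grp = group G for G (structure) +
  assumes fin: "finite (carrier G)"
begin

lemma card_pos: "card (carrier G) > 0"
  using fin one_closed card_gt_0_iff by blast

lemma inv_cancel_left [simp]: "h \<in> carrier G \<Longrightarrow> g \<in> carrier G \<Longrightarrow> inv h \<otimes> (h \<otimes> g) = g"
  by (simp add: m_assoc[symmetric])

lemma cancel_inv_left [simp]: "h \<in> carrier G \<Longrightarrow> g \<in> carrier G \<Longrightarrow> h \<otimes> (inv h \<otimes> g) = g"
  by (simp add: m_assoc[symmetric])

lemma bij_left_mult: "h \<in> carrier G \<Longrightarrow> bij_betw (\<lambda>g. h \<otimes> g) (carrier G) (carrier G)"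
  by (rule bij_betw_byWitness[where f'="\<lambda>g. inv h \<otimes> g"]) auto

lemma bij_right_mult: "h \<in> carrier G \<Longrightarrow> bij_betw (\<lambda>g. g \<otimes> h) (carrier G) (carrier G)"
  by (rule bij_betw_byWitness[where f'="\<lambda>g. g \<otimes> inv h"]) (auto simp: m_assoc)

lemma bij_inv: "bij_betw (\<lambda>g. inv g) (carrier G) (carrier G)"
  by (rule bij_betw_byWitness[where f'="\<lambda>g. inv g"]) auto

lemma bij_conj: "h \<in> carrier G \<Longrightarrow> bij_betw (\<lambda>g. h \<otimes> g \<otimes> inv h) (carrier G) (carrier G)"
  by (rule bij_betw_byWitness[where f'="\<lambda>g. inv h \<otimes> g \<otimes> h"]) (auto simp: m_assoc)

text \<open>Summing over the group makes an intertwiner of any matrix \<open>X\<close>. Applied to matrix units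
  this turns Schur's lemma into the orthogonality relations for matrix entries.\<close>

lemma average_intertwines:
  assumes rep: "representation G d \<rho>" "representation G e \<sigma>" and X: "X \<in> carrier_mat d e"
    and h: "h \<in> carrier G"
  defines "T \<equiv> mat_sum d e (\<lambda>g. \<rho> g * X * \<sigma> (inv g)) (carrier G)"
  shows "\<rho> h * T = T * \<sigma> h"
proof -
  note R = representation_carrier[OF rep(1)] and S = representation_carrier[OF rep(2)]
  have "\<rho> h * T = mat_sum d e (\<lambda>g. \<rho> h * (\<rho> g * X * \<sigma> (inv g))) (carrier G)"
    unfolding T_def
    by (rule mult_mat_sum[OF R[OF h] mult_carrier_mat[OF mult_carrier_mat[OF R X] S]]) auto
  also have "\<dots> = mat_sum d e (\<lambda>g. (\<rho> (h \<otimes> g) * X * \<sigma> (inv (h \<otimes> g))) * \<sigma> h) (carrier G)"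
  proof (rule mat_sum_cong)
    fix g assume g: "g \<in> carrier G"
    have "\<sigma> (inv (h \<otimes> g)) * \<sigma> h = \<sigma> (inv g)"
      using representation_mult[OF rep(2), of "inv (h \<otimes> g)" h] g h
      by (simp add: inv_mult_group m_assoc)
    then have "(\<rho> (h \<otimes> g) * X * \<sigma> (inv (h \<otimes> g))) * \<sigma> h = \<rho> (h \<otimes> g) * X * \<sigma> (inv g)"
      using assoc_mult_mat[OF mult_carrier_mat[OF R X] S S, of "h \<otimes> g" "inv (h \<otimes> g)" h] g h by simp
    also have "\<dots> = \<rho> h * \<rho> g * X * \<sigma> (inv g)" using representation_mult[OF rep(1) h g] by simp
    also have "\<dots> = \<rho> h * (\<rho> g * X * \<sigma> (inv g))"
      using R[OF h] R[OF g] X S[OF inv_closed[OF g]]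
      by (smt (verit) assoc_mult_mat mult_carrier_mat)
    finally show "\<rho> h * (\<rho> g * X * \<sigma> (inv g)) = \<rho> (h \<otimes> g) * X * \<sigma> (inv (h \<otimes> g)) * \<sigma> h" by simp
  qed
  also have "\<dots> = mat_sum d e (\<lambda>g. (\<rho> g * X * \<sigma> (inv g)) * \<sigma> h) (carrier G)"
    by (rule mat_sum_reindex[OF bij_left_mult[OF h], of d e "\<lambda>g. (\<rho> g * X * \<sigma> (inv g)) * \<sigma> h"])
  also have "\<dots> = T * \<sigma> h"
    unfolding T_def
    by (rule mat_sum_mult[OF S[OF h] mult_carrier_mat[OF mult_carrier_mat[OF R X] S], symmetric]) auto
  finally show ?thesis .
qed

lemma average_index:
  assumes rep: "representation G d \<rho>" "representation G e \<sigma>"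
    and "i < d" "j < d" "k < e" "l < e"
  shows "mat_sum d e (\<lambda>g. \<rho> g * mat_unit d e j k * \<sigma> (inv g)) (carrier G) $$ (i,l) =
    (\<Sum>g\<in>carrier G. \<rho> g $$ (i,j) * \<sigma> (inv g) $$ (k,l))"
  using assms representation_carrier[OF rep(1)] representation_carrier[OF rep(2)]
  by (auto simp: mat_sum_index intro!: sum.cong mult_mat_unit_mult)

lemma schur_orthogonality_distinct:
  assumes irr: "irreducible_representation G d \<rho>" "irreducible_representation G e \<sigma>"
    and ne: "rep_character G \<rho> \<noteq> rep_character G \<sigma>"
    and "i < d" "j < d" "k < e" "l < e"
  shows "(\<Sum>g\<in>carrier G. \<rho> g $$ (i,j) * \<sigma> (inv g) $$ (k,l)) = 0"
proof -
  note rep = irreducible_representationD(1)[OF irr(1)] irreducible_representationD(1)[OF irr(2)]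
  have "mat_sum d e (\<lambda>g. \<rho> g * mat_unit d e j k * \<sigma> (inv g)) (carrier G) = 0\<^sub>m d e"
    using intertwiner_iso[OF irr mat_sum_carrier(1) _ average_intertwines[OF rep mat_unit_carrier]] ne
    by blast
  then show ?thesis using average_index[OF rep assms(4-7)] assms(4,7) by simp
qed

text \<open>The averaged matrix unit is scalar, and its trace is that of the matrix unit times the
  group order; this determines all its entries.\<close>

lemma schur_orthogonality:
  assumes irr: "irreducible_representation G d \<rho>"
    and ij: "i < d" "j < d" "k < d" "l < d"
  shows "(\<Sum>g\<in>carrier G. \<rho> g $$ (i,j) * \<rho> (inv g) $$ (k,l)) =
    (if i = l \<and> j = k then of_nat (card (carrier G)) / of_nat d else 0)"
proof -
  note rep = irreducible_representationD(1)[OF irr]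
  note R = representation_carrier[OF rep]
  define T where "T = mat_sum d d (\<lambda>g. \<rho> g * mat_unit d d j k * \<rho> (inv g)) (carrier G)"
  obtain c where c: "T = c \<cdot>\<^sub>m 1\<^sub>m d"
    using schur_scalar[OF irr mat_sum_carrier(1) average_intertwines[OF rep rep mat_unit_carrier]]
    unfolding T_def by blast
  have tr: "mat_trace (\<rho> g * mat_unit d d j k * \<rho> (inv g)) = (if j = k then 1 else 0)"
    if g: "g \<in> carrier G" for g
  proof -
    have "mat_trace (\<rho> g * mat_unit d d j k * \<rho> (inv g)) =
      mat_trace (\<rho> (inv g) * (\<rho> g * mat_unit d d j k))"
      by (rule mat_trace_comm[OF mult_carrier_mat[OF R[OF g] mat_unit_carrier] R]) (use g in auto)
    also have "\<rho> (inv g) * (\<rho> g * mat_unit d d j k) = \<rho> (inv g) * \<rho> g * mat_unit d d j k"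
      by (rule assoc_mult_mat[OF R R[OF g] mat_unit_carrier, symmetric]) (use g in auto)
    also have "\<rho> (inv g) * \<rho> g = 1\<^sub>m d"
      using representation_mult[OF rep, of "inv g" g] representation_one[OF is_group rep] g by simp
    finally show ?thesis using ij by (auto simp: mat_unit_def mat_trace_def)
  qed
  have "c * of_nat d = mat_trace T" unfolding c by (simp add: mat_trace_smult[of _ d] mat_trace_one)
  also have "\<dots> = (\<Sum>g\<in>carrier G. mat_trace (\<rho> g * mat_unit d d j k * \<rho> (inv g)))"
    unfolding T_def
    by (rule mat_trace_mat_sum[OF mult_carrier_mat[OF mult_carrier_mat[OF R mat_unit_carrier] R]]) auto
  also have "\<dots> = (if j = k then of_nat (card (carrier G)) else 0)" using tr by simp
  finally have "c = (if j = k then of_nat (card (carrier G)) / of_nat d else 0)"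
    using ij(1) by (auto simp: field_simps)
  moreover have "(\<Sum>g\<in>carrier G. \<rho> g $$ (i,j) * \<rho> (inv g) $$ (k,l)) = T $$ (i,l)"
    unfolding T_def using average_index[OF rep rep ij] by simp
  ultimately show ?thesis using ij unfolding c by auto
qed

lemma rep_character_prod:
  assumes rep: "representation G d \<rho>" "representation G e \<sigma>" and "g \<in> carrier G" "h \<in> carrier G"
  shows "rep_character G \<rho> g * rep_character G \<sigma> h = (\<Sum>i<d. \<Sum>k<e. \<rho> g $$ (i,i) * \<sigma> h $$ (k,k))"
  using assms representation_carrier[OF rep(1) assms(3)] representation_carrier[OF rep(2) assms(4)]
  by (simp add: rep_character_def mat_trace_def sum_product)

lemma Irr_orthogonality:
  assumes "\<chi> \<in> Irr G" "\<psi> \<in> Irr G"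
  shows "(\<Sum>g\<in>carrier G. \<chi> g * \<psi> (inv g)) = (if \<chi> = \<psi> then of_nat (card (carrier G)) else 0)"
proof -
  obtain d \<rho> where \<rho>: "irreducible_representation G d \<rho>" "\<chi> = rep_character G \<rho>"
    using assms(1) unfolding Irr_def by auto
  obtain e \<sigma> where \<sigma>: "irreducible_representation G e \<sigma>" "\<psi> = rep_character G \<sigma>"
    using assms(2) unfolding Irr_def by auto
  have sum: "(\<Sum>g\<in>carrier G. rep_character G \<rho> g * rep_character G \<sigma> (inv g)) =
      (\<Sum>i<d. \<Sum>k<e. \<Sum>g\<in>carrier G. \<rho> g $$ (i,i) * \<sigma> (inv g) $$ (k,k))"
    if "irreducible_representation G e \<sigma>" for e \<sigma>
  proof -
    have "(\<Sum>g\<in>carrier G. rep_character G \<rho> g * rep_character G \<sigma> (inv g)) =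
      (\<Sum>g\<in>carrier G. \<Sum>i<d. \<Sum>k<e. \<rho> g $$ (i,i) * \<sigma> (inv g) $$ (k,k))"
      by (intro sum.cong rep_character_prod irreducible_representationD \<rho>(1) that) auto
    also have "\<dots> = (\<Sum>i<d. \<Sum>g\<in>carrier G. \<Sum>k<e. \<rho> g $$ (i,i) * \<sigma> (inv g) $$ (k,k))"
      by (rule sum.swap)
    also have "\<dots> = (\<Sum>i<d. \<Sum>k<e. \<Sum>g\<in>carrier G. \<rho> g $$ (i,i) * \<sigma> (inv g) $$ (k,k))"
      by (intro sum.cong sum.swap) auto
    finally show ?thesis .
  qed
  show ?thesis
  proof (cases "\<chi> = \<psi>")
    case True
    have "(\<Sum>g\<in>carrier G. \<chi> g * \<psi> (inv g)) =
        (\<Sum>i<d. \<Sum>k<d. if i = k \<and> i = k then of_nat (card (carrier G)) / of_nat d else 0)"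
      unfolding True[symmetric] \<rho>(2) sum[OF \<rho>(1)]
      by (intro sum.cong schur_orthogonality[OF \<rho>(1)]) auto
    also have "\<dots> = of_nat (card (carrier G))"
      using irreducible_representationD(2)[OF \<rho>(1)] by simp
    finally show ?thesis using True by simp
  next
    case False
    then have ne: "rep_character G \<rho> \<noteq> rep_character G \<sigma>" using \<rho>(2) \<sigma>(2) by simp
    show ?thesis using False unfolding \<rho>(2) \<sigma>(2) sum[OF \<sigma>(1)]
      by (simp add: schur_orthogonality_distinct[OF \<rho>(1) \<sigma>(1) ne])
  qed
qed

section \<open>Completeness of the irreducible characters\<close>

text \<open>An invariant subspace of least positive dimension is irreducible. If the columns of \<open>E\<close>
  form a basis of it, the action of the group on it is given by the matrices \<open>\<sigma> g\<close> that are
  determined by \<open>R g * E = E * \<sigma> g\<close>.\<close>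

lemma subrepresentation:
  assumes rep: "representation G N R" and W: "vec_subspace N W" "W \<noteq> {0\<^sub>v N}"
    and inv: "\<And>g w. g \<in> carrier G \<Longrightarrow> w \<in> W \<Longrightarrow> R g *\<^sub>v w \<in> W"
  obtains k \<sigma> E where "irreducible_representation G k \<sigma>" "E \<in> carrier_mat N k" "mat_inj E"
    "\<And>v. v \<in> carrier_vec k \<Longrightarrow> E *\<^sub>v v \<in> W" "\<And>g. g \<in> carrier G \<Longrightarrow> R g * E = E * \<sigma> g"
proof -
  note Rc = representation_carrier[OF rep]
  define Q where "Q k E \<longleftrightarrow> E \<in> carrier_mat N k \<and> mat_inj E \<and> (\<forall>v\<in>carrier_vec k. E *\<^sub>v v \<in> W) \<and>
      (\<forall>g\<in>carrier G. \<forall>v\<in>carrier_vec k. \<exists>w\<in>carrier_vec k. R g *\<^sub>v (E *\<^sub>v v) = E *\<^sub>v w)" for k E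
  obtain k0 E0 where E0: "E0 \<in> carrier_mat N k0" "mat_inj E0" "W = {E0 *\<^sub>v v | v. v \<in> carrier_vec k0}"
    by (rule vec_subspace_basis[OF W(1)])
  have E0W: "E0 *\<^sub>v v \<in> W" if "v \<in> carrier_vec k0" for v
    unfolding E0(3) using that by blast
  have E0inv: "\<exists>w\<in>carrier_vec k0. R g *\<^sub>v (E0 *\<^sub>v v) = E0 *\<^sub>v w"
    if "g \<in> carrier G" "v \<in> carrier_vec k0" for g v
    using inv[OF that(1), of "E0 *\<^sub>v v"] that(2) E0(3) by blast
  have Q0: "Q k0 E0" unfolding Q_def by (intro conjI ballI E0(1,2) E0W E0inv)
  have k0: "k0 > 0"
  proof (rule ccontr)
    assume "\<not> k0 > 0"
    then have "E0 *\<^sub>v v = 0\<^sub>v N" if "v \<in> carrier_vec k0" for v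
      using E0(1) that by (intro eq_vecI) (auto simp: scalar_prod_def)
    then have "W \<subseteq> {0\<^sub>v N}" unfolding E0(3) by blast
    then show False using W unfolding vec_subspace_def by auto
  qed
  define P where "P k \<longleftrightarrow> k > 0 \<and> (\<exists>E. Q k E)" for k
  define k where "k = (LEAST k. P k)"
  have "P k" unfolding k_def by (rule LeastI[of P k0]) (use Q0 k0 in \<open>auto simp: P_def\<close>)
  then obtain E where k: "k > 0" and QE: "Q k E" unfolding P_def by auto
  have kmin: "k \<le> l" if "Q l F" "l > 0" for l F
    unfolding k_def by (rule Least_le) (use that in \<open>auto simp: P_def\<close>)
  from QE have E: "E \<in> carrier_mat N k" "mat_inj E" "\<And>v. v \<in> carrier_vec k \<Longrightarrow> E *\<^sub>v v \<in> W"
    and Einv: "\<And>g v. g \<in> carrier G \<Longrightarrow> v \<in> carrier_vec k \<Longrightarrow> \<exists>w\<in>carrier_vec k. R g *\<^sub>v (E *\<^sub>v v) = E *\<^sub>v w"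
    unfolding Q_def by auto
  have "\<exists>X. X \<in> carrier_mat k k \<and> R g * E = E * X" if g: "g \<in> carrier G" for g
  proof (rule mat_from_columns[OF E(1) mult_carrier_mat[OF Rc[OF g] E(1)]])
    fix v :: "complex vec" assume v: "v \<in> carrier_vec k"
    then show "\<exists>w\<in>carrier_vec k. R g * E *\<^sub>v v = E *\<^sub>v w"
      using Einv[OF g v] assoc_mult_mat_vec[OF Rc[OF g] E(1) v] by simp
  qed blast
  then obtain \<sigma> where \<sigma>: "\<And>g. g \<in> carrier G \<Longrightarrow> \<sigma> g \<in> carrier_mat k k \<and> R g * E = E * \<sigma> g"
    by metis
  then have \<sigma>c: "\<And>g. g \<in> carrier G \<Longrightarrow> \<sigma> g \<in> carrier_mat k k"
    and int: "\<And>g. g \<in> carrier G \<Longrightarrow> R g * E = E * \<sigma> g" by auto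
  have rep\<sigma>: "representation G k \<sigma>"
  proof (rule representationI[OF is_group \<sigma>c])
    fix g h assume g: "g \<in> carrier G" and h: "h \<in> carrier G"
    have "E * \<sigma> (g \<otimes> h) = R g * (R h * E)"
      using int[of "g \<otimes> h"] g h representation_mult[OF rep g h] assoc_mult_mat[OF Rc[OF g] Rc[OF h] E(1)]
      by simp
    also have "\<dots> = E * (\<sigma> g * \<sigma> h)"
      unfolding int[OF h] assoc_mult_mat[OF Rc[OF g] E(1) \<sigma>c[OF h], symmetric] int[OF g]
      by (rule assoc_mult_mat[OF E(1) \<sigma>c[OF g] \<sigma>c[OF h]])
    finally show "\<sigma> (g \<otimes> h) = \<sigma> g * \<sigma> h"
      by (rule mat_inj_cancel[OF E(2,1) \<sigma>c mult_carrier_mat[OF \<sigma>c[OF g] \<sigma>c[OF h]], rotated]) (use g h in auto)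
  next
    have "E * \<sigma> \<one> = E * 1\<^sub>m k" using int[OF one_closed] representation_one[OF is_group rep] E(1) by simp
    then show "\<sigma> \<one> = 1\<^sub>m k" by (rule mat_inj_cancel[OF E(2,1) \<sigma>c[OF one_closed] one_carrier_mat])
  qed
  have "irreducible_representation G k \<sigma>"
    unfolding irreducible_representation_def subspace_iff_vec_subspace
  proof (intro conjI allI impI rep\<sigma> k)
    fix U assume U: "vec_subspace k U" and Uinv: "\<forall>g\<in>carrier G. \<forall>w\<in>U. \<sigma> g *\<^sub>v w \<in> U"
    show "U = {0\<^sub>v k} \<or> U = carrier_vec k"
    proof (cases "U = {0\<^sub>v k}")
      case False
      obtain l F where F: "F \<in> carrier_mat k l" "mat_inj F" "U = {F *\<^sub>v v | v. v \<in> carrier_vec l}"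
        by (rule vec_subspace_basis[OF U])
      have l: "l > 0"
      proof (rule ccontr)
        assume "\<not> l > 0"
        then have "F *\<^sub>v v = 0\<^sub>v k" if "v \<in> carrier_vec l" for v
          using F(1) that by (intro eq_vecI) (auto simp: scalar_prod_def)
        then have "U \<subseteq> {0\<^sub>v k}" unfolding F(3) by blast
        then show False using U False unfolding vec_subspace_def by auto
      qed
      have Fk: "F *\<^sub>v v \<in> carrier_vec k" if "v \<in> carrier_vec l" for v using that F(1) by auto
      have EF: "E * F \<in> carrier_mat N l" using E(1) F(1) by auto
      have EFv: "(E * F) *\<^sub>v v = E *\<^sub>v (F *\<^sub>v v)" if "v \<in> carrier_vec l" for v
        by (rule assoc_mult_mat_vec[OF E(1) F(1) that])
      have "Q l (E * F)"
        unfolding Q_def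
      proof (intro conjI ballI)
        show "mat_inj (E * F)"
          unfolding mat_inj_def
        proof (intro ballI impI)
          fix v assume "v \<in> carrier_vec (dim_col (E * F))" "E * F *\<^sub>v v = 0\<^sub>v (dim_row (E * F))"
          then have v: "v \<in> carrier_vec l" "E *\<^sub>v (F *\<^sub>v v) = 0\<^sub>v N" using EF E(1) F(1) EFv[of v] by auto
          then have "F *\<^sub>v v = 0\<^sub>v k" using mat_injD[OF E(2,1) Fk] by simp
          then show "v = 0\<^sub>v (dim_col (E * F))" using mat_injD[OF F(2,1) v(1)] F(1) by simp
        qed
        show "(E * F) *\<^sub>v v \<in> W" if "v \<in> carrier_vec l" for v
          using EFv[OF that] E(3)[OF Fk[OF that]] by simp
        fix g v assume g: "g \<in> carrier G" and v: "(v :: complex vec) \<in> carrier_vec l"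
        have "\<sigma> g *\<^sub>v (F *\<^sub>v v) \<in> U" using Uinv g v F(3) by blast
        then obtain w where w: "w \<in> carrier_vec l" "\<sigma> g *\<^sub>v (F *\<^sub>v v) = F *\<^sub>v w" using F(3) by auto
        have "R g *\<^sub>v (E *\<^sub>v (F *\<^sub>v v)) = E *\<^sub>v (\<sigma> g *\<^sub>v (F *\<^sub>v v))"
          using assoc_mult_mat_vec[OF Rc[OF g] E(1) Fk[OF v]]
            assoc_mult_mat_vec[OF E(1) \<sigma>c[OF g] Fk[OF v]] int[OF g] by simp
        then show "\<exists>w\<in>carrier_vec l. R g *\<^sub>v ((E * F) *\<^sub>v v) = (E * F) *\<^sub>v w"
          unfolding EFv[OF v] w(2) EFv[OF w(1), symmetric] using w(1) by blast
      qed (rule EF)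
      then have "k \<le> l" using kmin l by blast
      then obtain B where B: "B \<in> carrier_mat k k" "F * B = 1\<^sub>m k" "l = k"
        using mat_inj_inverse[OF F(2,1)] by metis
      have "v \<in> U" if v: "v \<in> carrier_vec k" for v
      proof -
        have "F *\<^sub>v (B *\<^sub>v v) = v"
          using assoc_mult_mat_vec[OF _ B(1) v, of F k] F(1) B v by simp
        then show ?thesis using B v F(3) by (metis (mono_tags, lifting) mem_Collect_eq mult_mat_vec_carrier)
      qed
      then show ?thesis using U unfolding vec_subspace_def by auto
    qed simp
  qed
  then show ?thesis using that E int by blast
qed

text \<open>The action of the element \<open>\<Sum> f(g) g\<close> of the group algebra.\<close>

definition weighted_sum :: "nat \<Rightarrow> ('a \<Rightarrow> complex) \<Rightarrow> ('a \<Rightarrow> complex mat) \<Rightarrow> complex mat"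
  where "weighted_sum d f \<rho> = mat_sum d d (\<lambda>g. f g \<cdot>\<^sub>m \<rho> g) (carrier G)"

definition class_function :: "('a \<Rightarrow> complex) \<Rightarrow> bool"
  where "class_function f \<longleftrightarrow> (\<forall>g\<in>carrier G. \<forall>h\<in>carrier G. f (h \<otimes> g \<otimes> inv h) = f g)"

lemma weighted_sum_carrier [simp]: "weighted_sum d f \<rho> \<in> carrier_mat d d"
  unfolding weighted_sum_def by simp

lemma weighted_sum_commutes:
  assumes f: "class_function f" and rep: "representation G d \<rho>" and h: "h \<in> carrier G"
  shows "\<rho> h * weighted_sum d f \<rho> = weighted_sum d f \<rho> * \<rho> h"
proof -
  note R = representation_carrier[OF rep]
  have "\<rho> h * weighted_sum d f \<rho> = mat_sum d d (\<lambda>g. \<rho> h * (f g \<cdot>\<^sub>m \<rho> g)) (carrier G)"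
    unfolding weighted_sum_def by (rule mult_mat_sum[OF R[OF h]]) (use R in auto)
  also have "\<dots> = mat_sum d d (\<lambda>g. f (h \<otimes> g \<otimes> inv h) \<cdot>\<^sub>m \<rho> (h \<otimes> g \<otimes> inv h) * \<rho> h) (carrier G)"
  proof (rule mat_sum_cong)
    fix g assume g: "g \<in> carrier G"
    have "\<rho> h * (f g \<cdot>\<^sub>m \<rho> g) = f g \<cdot>\<^sub>m (\<rho> h * \<rho> g)"
      by (rule mult_smult_distrib[OF R[OF h] R[OF g]])
    also have "\<rho> h * \<rho> g = \<rho> (h \<otimes> g \<otimes> inv h) * \<rho> h"
      using representation_mult[OF rep h g] representation_mult[OF rep, of "h \<otimes> g \<otimes> inv h" h] g h
      by (simp add: m_assoc)
    also have "f g \<cdot>\<^sub>m \<dots> = f g \<cdot>\<^sub>m \<rho> (h \<otimes> g \<otimes> inv h) * \<rho> h"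
      by (rule mult_smult_assoc_mat[symmetric, OF R R]) (use g h in auto)
    also have "\<dots> = f (h \<otimes> g \<otimes> inv h) \<cdot>\<^sub>m \<rho> (h \<otimes> g \<otimes> inv h) * \<rho> h"
      using f g h unfolding class_function_def by simp
    finally show "\<rho> h * (f g \<cdot>\<^sub>m \<rho> g) = f (h \<otimes> g \<otimes> inv h) \<cdot>\<^sub>m \<rho> (h \<otimes> g \<otimes> inv h) * \<rho> h" .
  qed
  also have "\<dots> = mat_sum d d (\<lambda>g. f g \<cdot>\<^sub>m \<rho> g * \<rho> h) (carrier G)"
    by (rule mat_sum_reindex[OF bij_conj[OF h], of d d "\<lambda>g. f g \<cdot>\<^sub>m \<rho> g * \<rho> h"])
  also have "\<dots> = weighted_sum d f \<rho> * \<rho> h"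
    unfolding weighted_sum_def by (rule mat_sum_mult[symmetric, OF R[OF h]]) (use R in auto)
  finally show ?thesis .
qed

lemma weighted_sum_irreducible:
  assumes f: "class_function f" and irr: "irreducible_representation G d \<rho>"
  shows "weighted_sum d f \<rho> = ((\<Sum>g\<in>carrier G. f g * rep_character G \<rho> g) / of_nat d) \<cdot>\<^sub>m 1\<^sub>m d"
proof -
  note rep = irreducible_representationD(1)[OF irr]
  note R = representation_carrier[OF rep]
  obtain c where c: "weighted_sum d f \<rho> = c \<cdot>\<^sub>m 1\<^sub>m d"
    using schur_scalar[OF irr weighted_sum_carrier weighted_sum_commutes[OF f rep]] by blast
  have "c * of_nat d = mat_trace (weighted_sum d f \<rho>)"
    unfolding c by (simp add: mat_trace_smult[of _ d] mat_trace_one)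
  also have "\<dots> = (\<Sum>g\<in>carrier G. mat_trace (f g \<cdot>\<^sub>m \<rho> g))"
    unfolding weighted_sum_def by (rule mat_trace_mat_sum) (use R in auto)
  also have "\<dots> = (\<Sum>g\<in>carrier G. f g * rep_character G \<rho> g)"
    by (rule sum.cong) (use mat_trace_smult[OF R] in \<open>auto simp: rep_character_def\<close>)
  finally have "c = (\<Sum>g\<in>carrier G. f g * rep_character G \<rho> g) / of_nat d"
    using irreducible_representationD(2)[OF irr] by (simp add: field_simps)
  then show ?thesis unfolding c by (rule arg_cong)
qed

lemma enumeration:
  obtains e where "bij_betw e {..<card (carrier G)} (carrier G)"
  using ex_bij_betw_nat_finite[OF fin] by (auto simp: lessThan_atLeast0)

text \<open>Let \<open>T\<close> be the action of \<open>\<Sum> f(g) g\<close> on the regular representation \<open>R\<close> and \<open>T'\<close> its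
  adjoint, which is the action of the element with coefficients \<open>cnj (f (inv g))\<close>. The entries
  of \<open>T\<close> are the values of \<open>f\<close>, so if \<open>f\<close> is not zero, the range of \<open>T'\<close> is a nonzero invariant
  subspace and contains an irreducible one. There \<open>T\<close> acts as a scalar, which is 0 because \<open>f\<close>
  is orthogonal to the irreducible characters. But the kernel of \<open>T\<close> meets the range of \<open>T'\<close>
  only in 0.\<close>

lemma irreducible_characters_complete:
  assumes f: "class_function f"
    and orth: "\<And>\<chi>. \<chi> \<in> Irr G \<Longrightarrow> (\<Sum>g\<in>carrier G. f g * \<chi> g) = 0"
    and x: "x \<in> carrier G"
  shows "f x = 0"
proof (rule ccontr)
  assume fx: "f x \<noteq> 0"
  define N where "N = card (carrier G)"
  obtain e where e: "bij_betw e {..<N} (carrier G)" using enumeration unfolding N_def by blast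
  have ec: "e i \<in> carrier G" if "i < N" for i using e that by (auto simp: bij_betw_def)
  have einj: "e i = e j \<longleftrightarrow> i = j" if "i < N" "j < N" for i j
    using e that by (auto simp: bij_betw_def inj_on_def)
  have esur: "\<exists>i<N. e i = g" if "g \<in> carrier G" for g
    using e that unfolding bij_betw_def by (metis imageE lessThan_iff)
  define R where "R g = mat N N (\<lambda>(i,j). if e i = g \<otimes> e j then 1 else (0::complex))" for g
  have Rc: "R g \<in> carrier_mat N N" for g unfolding R_def by simp
  have rep: "representation G N R"
  proof (rule representationI[OF is_group Rc])
    fix g h assume g: "g \<in> carrier G" and h: "h \<in> carrier G"
    show "R (g \<otimes> h) = R g * R h"
    proof (rule eq_matI)
      fix i j assume "i < dim_row (R g * R h)" "j < dim_col (R g * R h)"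
      then have ij: "i < N" "j < N" unfolding R_def by auto
      obtain k where k: "k < N" "e k = h \<otimes> e j" using esur[of "h \<otimes> e j"] h ec[OF ij(2)] by auto
      have "(R g * R h) $$ (i,j) = (\<Sum>m\<in>{0..<N}. (if e i = g \<otimes> e m then 1 else 0) * (if e m = h \<otimes> e j then 1 else 0))"
        using ij by (simp add: R_def scalar_prod_def)
      also have "\<dots> = (\<Sum>m\<in>{0..<N}. if m = k then (if e i = g \<otimes> e k then 1 else 0) else 0)"
        by (rule sum.cong) (use k einj in \<open>auto simp flip: k(2)\<close>)
      also have "\<dots> = R (g \<otimes> h) $$ (i,j)" using k ij g h ec[OF ij(2)] by (simp add: R_def m_assoc)
      finally show "R (g \<otimes> h) $$ (i,j) = (R g * R h) $$ (i,j)" by simp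
    qed (auto simp: R_def)
  next
    show "R \<one> = 1\<^sub>m N" by (rule eq_matI) (use ec einj in \<open>auto simp: R_def\<close>)
  qed
  have entry: "weighted_sum N \<phi> R $$ (i,j) = \<phi> (e i \<otimes> inv (e j))" if ij: "i < N" "j < N" for \<phi> i j
  proof -
    have "weighted_sum N \<phi> R $$ (i,j) = (\<Sum>g\<in>carrier G. \<phi> g * (if e i = g \<otimes> e j then 1 else 0))"
      using ij by (simp add: weighted_sum_def mat_sum_index R_def)
    also have "\<dots> = (\<Sum>g\<in>carrier G. if g = e i \<otimes> inv (e j) then \<phi> (e i \<otimes> inv (e j)) else 0)"
      by (rule sum.cong) (use ec[OF ij(1)] ec[OF ij(2)] in \<open>auto simp: m_assoc inv_solve_right\<close>)
    also have "\<dots> = \<phi> (e i \<otimes> inv (e j))" using fin ec ij by simp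
    finally show ?thesis .
  qed
  define f' where "f' g = cnj (f (inv g))" for g
  have f': "class_function f'"
    unfolding class_function_def
  proof (intro ballI)
    fix g h assume g: "g \<in> carrier G" and h: "h \<in> carrier G"
    have "inv (h \<otimes> g \<otimes> inv h) = h \<otimes> inv g \<otimes> inv h" using g h by (simp add: inv_mult_group m_assoc)
    then show "f' (h \<otimes> g \<otimes> inv h) = f' g" using f g h unfolding f'_def class_function_def by simp
  qed
  define T where "T = weighted_sum N f R"
  define T' where "T' = weighted_sum N f' R"
  have T: "T \<in> carrier_mat N N" and T': "T' \<in> carrier_mat N N" unfolding T_def T'_def by auto
  have adj: "T' $$ (i,j) = cnj (T $$ (j,i))" if "i < N" "j < N" for i j
    using entry[OF that] entry[OF that(2,1)] ec[OF that(1)] ec[OF that(2)]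
    unfolding T_def T'_def f'_def by (simp add: inv_mult_group)
  \<comment> \<open>If T w = 0 for w = T' v, then the squared norm of w is the inner product of v and T w,
    hence 0.\<close>
  have ker: "T' *\<^sub>v v = 0\<^sub>v N" if v: "v \<in> carrier_vec N" and 0: "T *\<^sub>v (T' *\<^sub>v v) = 0\<^sub>v N" for v
  proof -
    define w where "w = T' *\<^sub>v v"
    have w: "w \<in> carrier_vec N" using T' v unfolding w_def by auto
    have Tw: "(\<Sum>i<N. T $$ (j,i) * w $ i) = 0" if "j < N" for j
    proof -
      have "(T *\<^sub>v w) $ j = 0" using 0 that unfolding w_def by simp
      then show ?thesis using T w that by (simp add: scalar_prod_def lessThan_atLeast0)
    qed
    have wi: "cnj (w $ i) = (\<Sum>j<N. T $$ (j,i) * cnj (v $ j))" if "i < N" for i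
      using T' v that adj[OF that] by (simp add: w_def scalar_prod_def lessThan_atLeast0)
    have "(\<Sum>i<N. w $ i * cnj (w $ i)) = (\<Sum>i<N. \<Sum>j<N. w $ i * (T $$ (j,i) * cnj (v $ j)))"
      by (rule sum.cong) (auto simp: wi sum_distrib_left)
    also have "\<dots> = (\<Sum>j<N. \<Sum>i<N. w $ i * (T $$ (j,i) * cnj (v $ j)))" by (rule sum.swap)
    also have "\<dots> = (\<Sum>j<N. cnj (v $ j) * (\<Sum>i<N. T $$ (j,i) * w $ i))"
      by (rule sum.cong) (auto simp: sum_distrib_left mult_ac)
    also have "\<dots> = 0" using Tw by simp
    finally have "(\<Sum>i<N. complex_of_real ((cmod (w $ i))\<^sup>2)) = 0"
      by (simp only: complex_norm_square)
    then have "(\<Sum>i<N. (cmod (w $ i))\<^sup>2) = 0" by (metis of_real_eq_0_iff of_real_sum)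
    then have "\<forall>i<N. w $ i = 0" by (subst (asm) sum_nonneg_eq_0_iff) auto
    then show ?thesis using w unfolding w_def[symmetric] by (intro eq_vecI) auto
  qed
  define W where "W = {T' *\<^sub>v v | v. v \<in> carrier_vec N}"
  have W: "vec_subspace N W" unfolding W_def by (rule vec_subspace_range[OF T'])
  have W0: "W \<noteq> {0\<^sub>v N}"
  proof
    assume "W = {0\<^sub>v N}"
    then have T0: "T' = 0\<^sub>m N N" using range_zero_imp_zero[OF T'] unfolding W_def by blast
    obtain i where i: "i < N" "e i = inv x" using esur[of "inv x"] x by auto
    obtain j where j: "j < N" "e j = \<one>" using esur[of "\<one>"] by auto
    have "f' (inv x) = 0" using T0 entry[OF i(1) j(1), of f'] i j x unfolding T'_def by simp
    then show False using fx x unfolding f'_def by simp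
  qed
  have Winv: "R g *\<^sub>v w \<in> W" if g: "g \<in> carrier G" and w: "w \<in> W" for g w
  proof -
    obtain v where v: "v \<in> carrier_vec N" "w = T' *\<^sub>v v" using w unfolding W_def by auto
    have "R g *\<^sub>v w = T' *\<^sub>v (R g *\<^sub>v v)"
      using assoc_mult_mat_vec[OF Rc T' v(1), of g] assoc_mult_mat_vec[OF T' Rc v(1), of g] v(2)
        weighted_sum_commutes[OF f' rep g] unfolding T'_def by simp
    then show ?thesis using Rc[of g] v unfolding W_def by auto
  qed
  obtain k \<sigma> E where \<sigma>: "irreducible_representation G k \<sigma>" and E: "E \<in> carrier_mat N k" "mat_inj E"
    and EW: "\<And>v. v \<in> carrier_vec k \<Longrightarrow> E *\<^sub>v v \<in> W" and int: "\<And>g. g \<in> carrier G \<Longrightarrow> R g * E = E * \<sigma> g"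
    using subrepresentation[OF rep W W0 Winv] by metis
  note k = irreducible_representationD(2)[OF \<sigma>]
  note S = representation_carrier[OF irreducible_representationD(1)[OF \<sigma>]]
  have \<sigma>Irr: "rep_character G \<sigma> \<in> Irr G" using \<sigma> unfolding Irr_def by blast
  have "T * E = mat_sum N k (\<lambda>g. f g \<cdot>\<^sub>m R g * E) (carrier G)"
    unfolding T_def weighted_sum_def by (rule mat_sum_mult[OF E(1)]) (use Rc in auto)
  also have "\<dots> = mat_sum N k (\<lambda>g. E * (f g \<cdot>\<^sub>m \<sigma> g)) (carrier G)"
    by (rule mat_sum_cong)
      (use mult_smult_assoc_mat[OF Rc E(1)] mult_smult_distrib[OF E(1) S] int in auto)
  also have "\<dots> = E * weighted_sum k f \<sigma>"
    unfolding weighted_sum_def by (rule mult_mat_sum[OF E(1), symmetric]) (use S in auto)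
  also have "weighted_sum k f \<sigma> = 0 \<cdot>\<^sub>m 1\<^sub>m k"
    using weighted_sum_irreducible[OF f \<sigma>] orth[OF \<sigma>Irr] by simp
  finally have TE: "T * E = E * (0 \<cdot>\<^sub>m 1\<^sub>m k)" .
  define u :: "complex vec" where "u = unit_vec k 0"
  have u: "u \<in> carrier_vec k" unfolding u_def by simp
  have "T *\<^sub>v (E *\<^sub>v u) = E *\<^sub>v ((0 \<cdot>\<^sub>m 1\<^sub>m k) *\<^sub>v u)"
    using assoc_mult_mat_vec[OF T E(1) u] assoc_mult_mat_vec[OF E(1), of "0 \<cdot>\<^sub>m 1\<^sub>m k" k u] TE u by simp
  also have "(0 \<cdot>\<^sub>m 1\<^sub>m k) *\<^sub>v u = 0\<^sub>v k" using scalar_mat_mult_vec[OF u, of 0] u by auto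
  also have "E *\<^sub>v 0\<^sub>v k = 0\<^sub>v N" using E(1) by auto
  finally have "T *\<^sub>v (E *\<^sub>v u) = 0\<^sub>v N" .
  moreover obtain v where v: "v \<in> carrier_vec N" "E *\<^sub>v u = T' *\<^sub>v v" using EW[OF u] unfolding W_def by auto
  ultimately have "E *\<^sub>v u = 0\<^sub>v N" using ker[OF v(1)] by simp
  then have "u = 0\<^sub>v k" using mat_injD[OF E(2,1) u] by simp
  then show False using k unfolding u_def by simp
qed

lemma Irr_class_function:
  assumes "\<chi> \<in> Irr G"
  shows "class_function \<chi>"
  unfolding class_function_def
proof (intro ballI)
  fix g h assume g: "g \<in> carrier G" and h: "h \<in> carrier G"
  obtain d \<rho> where \<rho>: "irreducible_representation G d \<rho>" "\<chi> = rep_character G \<rho>"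
    using assms unfolding Irr_def by auto
  note rep = irreducible_representationD(1)[OF \<rho>(1)]
  note R = representation_carrier[OF rep]
  have "mat_trace (\<rho> (h \<otimes> g \<otimes> inv h)) = mat_trace (\<rho> (h \<otimes> g) * \<rho> (inv h))"
    using representation_mult[OF rep, of "h \<otimes> g" "inv h"] g h by simp
  also have "\<dots> = mat_trace (\<rho> (inv h) * \<rho> (h \<otimes> g))"
    by (rule mat_trace_comm[OF R R]) (use g h in auto)
  also have "\<rho> (inv h) * \<rho> (h \<otimes> g) = \<rho> g"
    using representation_mult[OF rep, of "inv h" "h \<otimes> g"] g h by simp
  finally show "\<chi> (h \<otimes> g \<otimes> inv h) = \<chi> g" using g h \<rho>(2) by (simp add: rep_character_def)
qed

text \<open>By orthogonality, distinct irreducible characters are linearly independent functions on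
  the group, so there are at most \<open>card (carrier G)\<close> of them.\<close>

lemma finite_Irr: "finite (Irr G)"
proof (rule finite_if_finite_subsets_card_bdd[of _ "card (carrier G)", THEN conjunct1])
  fix S assume S: "S \<subseteq> Irr G" "finite S"
  define N where "N = card (carrier G)"
  define m where "m = card S"
  obtain e where e: "bij_betw e {..<N} (carrier G)" using enumeration unfolding N_def by blast
  obtain c where c: "bij_betw c {..<m} S"
    using ex_bij_betw_nat_finite[OF S(2)] unfolding m_def by (auto simp: lessThan_atLeast0)
  define A where "A = mat N m (\<lambda>(i,j). c j (e i))"
  have A: "A \<in> carrier_mat N m" unfolding A_def by simp
  have "mat_inj A"
    unfolding mat_inj_def
  proof (intro ballI impI)
    fix v assume "v \<in> carrier_vec (dim_col A)" "A *\<^sub>v v = 0\<^sub>v (dim_row A)"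
    then have v: "v \<in> carrier_vec m" "A *\<^sub>v v = 0\<^sub>v N" using A by auto
    have lin: "(\<Sum>j<m. c j g * v $ j) = 0" if "g \<in> carrier G" for g
    proof -
      obtain i where i: "i < N" "e i = g"
        using e \<open>g \<in> carrier G\<close> unfolding bij_betw_def by (metis imageE lessThan_iff)
      have "(A *\<^sub>v v) $ i = 0" using v i by simp
      then show ?thesis using i v(1) by (simp add: A_def scalar_prod_def lessThan_atLeast0)
    qed
    have "v $ l = 0" if l: "l < m" for l
    proof -
      have cS: "c j \<in> Irr G" if "j < m" for j using c S(1) that by (auto simp: bij_betw_def)
      have "0 = (\<Sum>g\<in>carrier G. (\<Sum>j<m. c j g * v $ j) * c l (inv g))" using lin by simp
      also have "\<dots> = (\<Sum>g\<in>carrier G. \<Sum>j<m. v $ j * (c j g * c l (inv g)))"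
        by (simp add: sum_distrib_left sum_distrib_right mult_ac)
      also have "\<dots> = (\<Sum>j<m. \<Sum>g\<in>carrier G. v $ j * (c j g * c l (inv g)))" by (rule sum.swap)
      also have "\<dots> = (\<Sum>j<m. v $ j * (if c j = c l then of_nat N else 0))"
        by (rule sum.cong) (use Irr_orthogonality[OF cS cS[OF l]] in \<open>auto simp: sum_distrib_left[symmetric] N_def\<close>)
      also have "\<dots> = (\<Sum>j<m. if j = l then v $ l * of_nat N else 0)"
        by (rule sum.cong) (use c l in \<open>auto simp: bij_betw_def inj_on_def\<close>)
      also have "\<dots> = v $ l * of_nat N" using l by simp
      finally show ?thesis using card_pos N_def by simp
    qed
    then show "v = 0\<^sub>v (dim_col A)" using v(1) A by (intro eq_vecI) auto
  qed
  then show "card S \<le> card (carrier G)" using mat_inj_le[OF _ A] unfolding m_def N_def by simp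
qed

lemma Irr_degree:
  assumes "\<chi> \<in> Irr G"
  obtains d where "d > 0" "\<chi> \<one> = of_nat d"
proof -
  obtain d \<rho> where \<rho>: "irreducible_representation G d \<rho>" "\<chi> = rep_character G \<rho>"
    using assms unfolding Irr_def by auto
  show ?thesis
    using that[of d] irreducible_representationD(2)[OF \<rho>(1)]
      representation_one[OF is_group irreducible_representationD(1)[OF \<rho>(1)]] \<rho>(2)
    by (simp add: rep_character_def mat_trace_one)
qed

text \<open>The difference of the two sides is a class function orthogonal to all irreducible
  characters.\<close>

lemma class_function_expansion:
  assumes f: "class_function f" and g: "g \<in> carrier G"
  shows "f g = (\<Sum>\<chi>\<in>Irr G. ((\<Sum>h\<in>carrier G. f h * \<chi> (inv h)) / of_nat (card (carrier G))) * \<chi> g)"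
proof -
  define c where "c \<chi> = (\<Sum>h\<in>carrier G. f h * \<chi> (inv h)) / of_nat (card (carrier G))" for \<chi>
  define F where "F g = f (inv g) - (\<Sum>\<chi>\<in>Irr G. c \<chi> * \<chi> (inv g))" for g
  have F: "class_function F"
    unfolding class_function_def
  proof (intro ballI)
    fix g h assume g: "g \<in> carrier G" and h: "h \<in> carrier G"
    have eq: "inv (h \<otimes> g \<otimes> inv h) = h \<otimes> inv g \<otimes> inv h" using g h by (simp add: inv_mult_group m_assoc)
    have "\<chi> (h \<otimes> inv g \<otimes> inv h) = \<chi> (inv g)" if "\<chi> \<in> Irr G" for \<chi>
      using Irr_class_function[OF that] g h unfolding class_function_def by simp
    then have "(\<Sum>\<chi>\<in>Irr G. c \<chi> * \<chi> (h \<otimes> inv g \<otimes> inv h)) = (\<Sum>\<chi>\<in>Irr G. c \<chi> * \<chi> (inv g))"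
      by (intro sum.cong) auto
    moreover have "f (h \<otimes> inv g \<otimes> inv h) = f (inv g)" using f g h unfolding class_function_def by simp
    ultimately show "F (h \<otimes> g \<otimes> inv h) = F g" unfolding F_def eq by simp
  qed
  have "F (inv g) = 0"
  proof (rule irreducible_characters_complete[OF F])
    fix \<psi> assume \<psi>: "\<psi> \<in> Irr G"
    have "(\<Sum>g\<in>carrier G. F g * \<psi> g) = (\<Sum>g\<in>carrier G. F (inv g) * \<psi> (inv g))"
      by (rule sum.reindex_bij_betw[OF bij_inv, symmetric])
    also have "\<dots> = (\<Sum>g\<in>carrier G. f g * \<psi> (inv g) - (\<Sum>\<chi>\<in>Irr G. c \<chi> * (\<chi> g * \<psi> (inv g))))"
      by (rule sum.cong) (auto simp: F_def right_diff_distrib left_diff_distrib sum_distrib_left sum_distrib_right mult_ac)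
    also have "\<dots> = (\<Sum>g\<in>carrier G. f g * \<psi> (inv g)) - (\<Sum>g\<in>carrier G. \<Sum>\<chi>\<in>Irr G. c \<chi> * (\<chi> g * \<psi> (inv g)))"
      by (rule sum_subtractf)
    also have "(\<Sum>g\<in>carrier G. \<Sum>\<chi>\<in>Irr G. c \<chi> * (\<chi> g * \<psi> (inv g))) =
        (\<Sum>\<chi>\<in>Irr G. \<Sum>g\<in>carrier G. c \<chi> * (\<chi> g * \<psi> (inv g)))" by (rule sum.swap)
    also have "\<dots> = (\<Sum>\<chi>\<in>Irr G. c \<chi> * (if \<chi> = \<psi> then of_nat (card (carrier G)) else 0))"
      by (rule sum.cong) (use Irr_orthogonality[OF _ \<psi>] in \<open>auto simp: sum_distrib_left[symmetric]\<close>)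
    also have "\<dots> = c \<psi> * of_nat (card (carrier G))"
      using \<psi> finite_Irr by (simp add: if_distrib cong: if_cong)
    also have "\<dots> = (\<Sum>g\<in>carrier G. f g * \<psi> (inv g))" using card_pos unfolding c_def by simp
    finally show "(\<Sum>g\<in>carrier G. F g * \<psi> g) = 0" by simp
  qed (use g in auto)
  then show ?thesis using g unfolding F_def c_def by simp
qed

text \<open>Count, for every \<open>z\<close>, the elements that conjugate \<open>x\<close> into \<open>z\<close>, and likewise for \<open>y\<close>. The
  inner products of these class functions with \<open>\<chi>\<close> are \<open>\<chi> x\<close> and \<open>\<chi> y\<close> up to the group order, so
  the two counts coincide, and the first one is positive at \<open>x\<close>.\<close>

lemma conjugate_if_characters_agree:
  assumes x: "x \<in> carrier G" and y: "y \<in> carrier G" and eq: "\<And>\<chi>. \<chi> \<in> Irr G \<Longrightarrow> \<chi> x = \<chi> y"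
  obtains h where "h \<in> carrier G" "x = h \<otimes> y \<otimes> inv h"
proof -
  define f where "f a z = (\<Sum>h\<in>carrier G. if h \<otimes> a \<otimes> inv h = z then 1 else (0::complex))" for a z
  have cf: "class_function (f a)" if a: "a \<in> carrier G" for a
    unfolding class_function_def
  proof (intro ballI)
    fix g k assume g: "g \<in> carrier G" and k: "k \<in> carrier G"
    have "f a (k \<otimes> g \<otimes> inv k) = (\<Sum>h\<in>carrier G. if (k \<otimes> h) \<otimes> a \<otimes> inv (k \<otimes> h) = k \<otimes> g \<otimes> inv k then 1 else 0)"
      unfolding f_def by (rule sum.reindex_bij_betw[OF bij_left_mult[OF k], symmetric])
    also have "\<dots> = f a g"
      unfolding f_def
    proof (rule sum.cong)
      fix h assume h: "h \<in> carrier G"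
      have "(k \<otimes> h) \<otimes> a \<otimes> inv (k \<otimes> h) = k \<otimes> (h \<otimes> a \<otimes> inv h) \<otimes> inv k"
        using a h k by (simp add: inv_mult_group m_assoc)
      then have "(k \<otimes> h) \<otimes> a \<otimes> inv (k \<otimes> h) = k \<otimes> g \<otimes> inv k \<longleftrightarrow> h \<otimes> a \<otimes> inv h = g"
        using a h k g by simp
      then show "(if (k \<otimes> h) \<otimes> a \<otimes> inv (k \<otimes> h) = k \<otimes> g \<otimes> inv k then 1 else 0) =
        (if h \<otimes> a \<otimes> inv h = g then 1 else (0::complex))" by simp
    qed simp
    finally show "f a (k \<otimes> g \<otimes> inv k) = f a g" .
  qed
  have inner: "(\<Sum>z\<in>carrier G. f a z * \<chi> z) = of_nat (card (carrier G)) * \<chi> a"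
    if a: "a \<in> carrier G" and \<chi>: "\<chi> \<in> Irr G" for a \<chi>
  proof -
    have "(\<Sum>z\<in>carrier G. f a z * \<chi> z) =
        (\<Sum>z\<in>carrier G. \<Sum>h\<in>carrier G. if h \<otimes> a \<otimes> inv h = z then \<chi> z else 0)"
      unfolding f_def sum_distrib_right by (intro sum.cong) auto
    also have "\<dots> = (\<Sum>h\<in>carrier G. \<Sum>z\<in>carrier G. if h \<otimes> a \<otimes> inv h = z then \<chi> z else 0)"
      by (rule sum.swap)
    also have "\<dots> = (\<Sum>h\<in>carrier G. \<chi> a)"
      by (rule sum.cong)
        (use fin a Irr_class_function[OF \<chi>] in \<open>auto simp: class_function_def\<close>)
    finally show ?thesis by simp
  qed
  have cfd: "class_function (\<lambda>z. f x z - f y z)"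
    using cf[OF x] cf[OF y] unfolding class_function_def by simp
  have "f x x - f y x = 0"
    by (rule irreducible_characters_complete[OF cfd _ x])
      (simp add: left_diff_distrib sum_subtractf inner[OF x] inner[OF y] eq)
  moreover have "f x x \<noteq> 0"
  proof -
    have "f x x = of_nat (card {h\<in>carrier G. h \<otimes> x \<otimes> inv h = x})"
      unfolding f_def using fin by (simp add: sum.If_cases Int_def)
    moreover have "\<one> \<in> {h\<in>carrier G. h \<otimes> x \<otimes> inv h = x}" using x by simp
    then have "card {h\<in>carrier G. h \<otimes> x \<otimes> inv h = x} \<noteq> 0" using fin by (auto simp: card_eq_0_iff)
    ultimately show ?thesis by simp
  qed
  ultimately have "f y x \<noteq> 0" by simp
  then have "\<exists>h\<in>carrier G. h \<otimes> y \<otimes> inv h = x"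
    unfolding f_def by (rule contrapos_np) (intro sum.neutral, auto)
  then show ?thesis using that by blast
qed

text \<open>The multiplicity of \<open>\<mu>\<close> in the restriction of \<open>\<chi>\<close> to \<open>H\<close>: the mean of \<open>\<mu> h \<cdot> \<rho> (inv h)\<close>
  over \<open>H\<close> is an idempotent, so its trace is a natural number.\<close>

lemma linear_character_multiplicity:
  assumes H: "subgroup H G" and l1: "\<mu> \<one> = 1"
    and lm: "\<And>g h. g \<in> H \<Longrightarrow> h \<in> H \<Longrightarrow> \<mu> (g \<otimes> h) = \<mu> g * \<mu> h" and \<chi>: "\<chi> \<in> Irr G"
  obtains r where "(\<Sum>h\<in>H. \<mu> h * \<chi> (inv h)) = of_nat (card H) * of_nat r"
proof -
  obtain d \<rho> where \<rho>: "irreducible_representation G d \<rho>" "\<chi> = rep_character G \<rho>"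
    using \<chi> unfolding Irr_def by auto
  note rep = irreducible_representationD(1)[OF \<rho>(1)]
  note R = representation_carrier[OF rep]
  have HG: "h \<in> carrier G" if "h \<in> H" for h using subgroup.mem_carrier[OF H that] .
  have Hf: "finite H" using finite_subset[OF _ fin] HG by blast
  have H1: "\<one> \<in> H" and Hm: "\<And>a b. a \<in> H \<Longrightarrow> b \<in> H \<Longrightarrow> a \<otimes> b \<in> H" and Hi: "\<And>a. a \<in> H \<Longrightarrow> inv a \<in> H"
    using H by (auto simp: subgroup.one_closed subgroup.m_closed subgroup.m_inv_closed)
  have cH: "card H > 0" using H1 Hf card_gt_0_iff by blast
  define Q where "Q = mat_sum d d (\<lambda>h. \<mu> h \<cdot>\<^sub>m \<rho> (inv h)) H"
  have absorb: "Q * (\<mu> k \<cdot>\<^sub>m \<rho> (inv k)) = Q" if k: "k \<in> H" for k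
  proof -
    have "Q * (\<mu> k \<cdot>\<^sub>m \<rho> (inv k)) = mat_sum d d (\<lambda>h. \<mu> h \<cdot>\<^sub>m \<rho> (inv h) * (\<mu> k \<cdot>\<^sub>m \<rho> (inv k))) H"
      unfolding Q_def by (rule mat_sum_mult) (use R HG k in auto)
    also have "\<dots> = mat_sum d d (\<lambda>h. \<mu> (k \<otimes> h) \<cdot>\<^sub>m \<rho> (inv (k \<otimes> h))) H"
    proof (rule mat_sum_cong)
      fix h assume h: "h \<in> H"
      note hG = HG[OF h] and kG = HG[OF k]
      have "\<mu> h \<cdot>\<^sub>m \<rho> (inv h) * (\<mu> k \<cdot>\<^sub>m \<rho> (inv k)) = \<mu> h \<cdot>\<^sub>m (\<mu> k \<cdot>\<^sub>m (\<rho> (inv h) * \<rho> (inv k)))"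
        using mult_smult_assoc_mat[OF R smult_carrier_mat[OF R], of "inv h" "inv k" "\<mu> h" "\<mu> k"]
          mult_smult_distrib[OF R R, of "inv h" "inv k" "\<mu> k"] hG kG by simp
      also have "\<rho> (inv h) * \<rho> (inv k) = \<rho> (inv (k \<otimes> h))"
        using representation_mult[OF rep, of "inv h" "inv k"] hG kG by (simp add: inv_mult_group)
      also have "\<mu> h \<cdot>\<^sub>m (\<mu> k \<cdot>\<^sub>m \<rho> (inv (k \<otimes> h))) = \<mu> (k \<otimes> h) \<cdot>\<^sub>m \<rho> (inv (k \<otimes> h))"
        using lm[OF k h] by (intro eq_matI) auto
      finally show "\<mu> h \<cdot>\<^sub>m \<rho> (inv h) * (\<mu> k \<cdot>\<^sub>m \<rho> (inv k)) = \<mu> (k \<otimes> h) \<cdot>\<^sub>m \<rho> (inv (k \<otimes> h))" .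
    qed
    also have "\<dots> = Q" unfolding Q_def
    proof (rule mat_sum_reindex[of "\<lambda>h. k \<otimes> h" H H d d "\<lambda>h. \<mu> h \<cdot>\<^sub>m \<rho> (inv h)"])
      show "bij_betw (\<lambda>h. k \<otimes> h) H H"
        by (rule bij_betw_byWitness[where f'="\<lambda>h. inv k \<otimes> h"]) (use k HG Hm Hi in auto)
    qed
    finally show ?thesis .
  qed
  have Qc: "Q \<in> carrier_mat d d" unfolding Q_def by simp
  define P where "P = (1 / of_nat (card H)) \<cdot>\<^sub>m Q"
  have QQ: "Q * Q = of_nat (card H) \<cdot>\<^sub>m Q"
  proof -
    have "Q * Q = Q * mat_sum d d (\<lambda>h. \<mu> h \<cdot>\<^sub>m \<rho> (inv h)) H" by (simp add: Q_def)
    also have "\<dots> = mat_sum d d (\<lambda>h. Q * (\<mu> h \<cdot>\<^sub>m \<rho> (inv h))) H"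
      by (rule mult_mat_sum[OF Qc]) (use R HG in auto)
    also have "\<dots> = mat_sum d d (\<lambda>h. Q) H" by (rule mat_sum_cong) (rule absorb)
    also have "\<dots> = of_nat (card H) \<cdot>\<^sub>m Q" by (rule eq_matI) (use Qc in \<open>auto simp: mat_sum_index\<close>)
    finally show ?thesis .
  qed
  have "P * P = P"
  proof -
    have "P * P = (1 / of_nat (card H)) \<cdot>\<^sub>m ((1 / of_nat (card H)) \<cdot>\<^sub>m (Q * Q))"
      unfolding P_def using mult_smult_assoc_mat[OF Qc smult_carrier_mat[OF Qc]] mult_smult_distrib[OF Qc Qc]
      by simp
    also have "\<dots> = P" unfolding QQ P_def by (rule eq_matI) (use cH in auto)
    finally show ?thesis .
  qed
  then obtain r where r: "mat_trace P = of_nat r"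
    using mat_trace_idempotent[of P d] Qc unfolding P_def by (metis smult_carrier_mat)
  have "mat_trace Q = (\<Sum>h\<in>H. mat_trace (\<mu> h \<cdot>\<^sub>m \<rho> (inv h)))"
    unfolding Q_def by (rule mat_trace_mat_sum) (use R HG in auto)
  also have "\<dots> = (\<Sum>h\<in>H. \<mu> h * \<chi> (inv h))"
    by (rule sum.cong) (use HG R in \<open>auto simp: \<rho>(2) rep_character_def mat_trace_smult[of _ d]\<close>)
  finally have "(\<Sum>h\<in>H. \<mu> h * \<chi> (inv h)) = of_nat (card H) * of_nat r"
    using r mat_trace_smult[OF Qc] cH unfolding P_def by (simp add: field_simps)
  then show ?thesis by (rule that)
qed

end

section \<open>The twisted Frobenius-Schur indicator\<close>

locale involutive_auto = finite_grp G for G (structure) +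
  fixes \<tau> :: "'a \<Rightarrow> 'a"
  assumes tau_hom: "\<tau> \<in> hom G G" and tau_tau: "g \<in> carrier G \<Longrightarrow> \<tau> (\<tau> g) = g"
begin

lemma tau_closed [simp]: "g \<in> carrier G \<Longrightarrow> \<tau> g \<in> carrier G"
  using tau_hom by (auto simp: hom_def)

lemma tau_mult: "g \<in> carrier G \<Longrightarrow> h \<in> carrier G \<Longrightarrow> \<tau> (g \<otimes> h) = \<tau> g \<otimes> \<tau> h"
  using tau_hom by (auto simp: hom_def)

lemma tau_one [simp]: "\<tau> \<one> = \<one>"
  using hom_one[OF tau_hom is_group] by simp

lemma tau_inv: "g \<in> carrier G \<Longrightarrow> \<tau> (inv g) = inv (\<tau> g)"
  by (metis inv_closed inv_equality l_inv tau_closed tau_mult tau_one)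

lemma bij_tau: "bij_betw \<tau> (carrier G) (carrier G)"
  by (rule bij_betw_byWitness[where f'=\<tau>]) (auto simp: tau_tau)

text \<open>Put \<open>\<rho>' g = (\<rho> (\<tau> g))\<^sup>T\<close>, which reverses products. The matrices \<open>\<Phi> X = \<Sum> \<rho> g * X * \<rho>' g\<close>
  intertwine \<open>\<rho>\<close> with the representation \<open>g \<mapsto> \<rho>' (inv g)\<close>, whose character is
  \<open>g \<mapsto> \<chi> (\<tau> (inv g))\<close>. By Schur's lemma either all of them vanish, or they are multiples of one
  invertible matrix \<open>A\<close> and the two characters agree. Reindexing the sum by \<open>\<tau>\<close> shows
  \<open>(\<Phi> X)\<^sup>T = \<Phi> (X\<^sup>T)\<close>, hence \<open>A\<^sup>T = c \<cdot> A\<close> with \<open>c\<^sup>2 = 1\<close>. The sums of \<open>\<chi> (g \<otimes> \<tau> g)\<close> and of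
  \<open>\<chi> g \<cdot> \<chi> (\<tau> g)\<close> are both read off from entries of \<open>\<Phi>\<close> at matrix units, transposed to each
  other, so that they differ by the factor \<open>c\<close>.\<close>

lemma twisted_frobenius_schur:
  assumes \<chi>: "\<chi> \<in> Irr G"
  obtains c :: complex where "c \<in> {-1, 0, 1}"
    "(\<Sum>g\<in>carrier G. \<chi> (g \<otimes> \<tau> g)) = c * of_nat (card (carrier G))"
    "c \<noteq> 0 \<longleftrightarrow> (\<forall>g\<in>carrier G. \<chi> (\<tau> g) = \<chi> (inv g))"
proof -
  obtain d \<rho> where irr: "irreducible_representation G d \<rho>" and \<chi>\<rho>: "\<chi> = rep_character G \<rho>"
    using \<chi> unfolding Irr_def by auto
  note rep = irreducible_representationD(1)[OF irr]
  note R = representation_carrier[OF rep]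
  define \<rho>' where "\<rho>' g = (\<rho> (\<tau> g))\<^sup>T" for g
  have R': "\<rho>' g \<in> carrier_mat d d" if "g \<in> carrier G" for g
    unfolding \<rho>'_def using R[OF tau_closed[OF that]] by simp
  have R'mult: "\<rho>' (h \<otimes> g) = \<rho>' g * \<rho>' h" if "g \<in> carrier G" "h \<in> carrier G" for g h
    unfolding \<rho>'_def using that tau_mult representation_mult[OF rep] transpose_mult[OF R R] by simp
  have R'inv: "\<rho>' h * \<rho>' (inv h) = 1\<^sub>m d" if "h \<in> carrier G" for h
    using R'mult[of h "inv h"] that representation_one[OF is_group rep] by (simp add: \<rho>'_def)
  define \<Phi> where "\<Phi> X = mat_sum d d (\<lambda>g. \<rho> g * X * \<rho>' g) (carrier G)" for X
  have \<Phi>c: "\<Phi> X \<in> carrier_mat d d" for X unfolding \<Phi>_def by simp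
  have summand: "\<rho> g * X * \<rho>' g \<in> carrier_mat d d" if "X \<in> carrier_mat d d" "g \<in> carrier G" for X g
    by (rule mult_carrier_mat[OF mult_carrier_mat[OF R that(1)] R']) (use that in auto)
  have fixed: "\<rho> h * \<Phi> X * \<rho>' h = \<Phi> X" if X: "X \<in> carrier_mat d d" and h: "h \<in> carrier G" for X h
  proof -
    have left: "\<rho> h * \<Phi> X = mat_sum d d (\<lambda>g. \<rho> h * (\<rho> g * X * \<rho>' g)) (carrier G)"
      unfolding \<Phi>_def by (rule mult_mat_sum[OF R[OF h] summand[OF X]])
    have "\<rho> h * \<Phi> X * \<rho>' h = mat_sum d d (\<lambda>g. \<rho> h * (\<rho> g * X * \<rho>' g) * \<rho>' h) (carrier G)"
      unfolding left
      by (rule mat_sum_mult[OF R'[OF h] mult_carrier_mat[OF R[OF h] summand[OF X]]])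
    also have "\<dots> = mat_sum d d (\<lambda>g. \<rho> (h \<otimes> g) * X * \<rho>' (h \<otimes> g)) (carrier G)"
    proof (rule mat_sum_cong)
      fix g assume g: "g \<in> carrier G"
      have "\<rho> h * (\<rho> g * X * \<rho>' g) * \<rho>' h = (\<rho> h * \<rho> g) * X * (\<rho>' g * \<rho>' h)"
        using R[OF h] R[OF g] X R'[OF g] R'[OF h] by (smt (verit) assoc_mult_mat mult_carrier_mat)
      then show "\<rho> h * (\<rho> g * X * \<rho>' g) * \<rho>' h = \<rho> (h \<otimes> g) * X * \<rho>' (h \<otimes> g)"
        using representation_mult[OF rep h g] R'mult[OF g h] by simp
    qed
    also have "\<dots> = \<Phi> X"
      unfolding \<Phi>_def by (rule mat_sum_reindex[OF bij_left_mult[OF h], of d d "\<lambda>g. \<rho> g * X * \<rho>' g"])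
    finally show ?thesis .
  qed
  define \<sigma> where "\<sigma> g = \<rho>' (inv g)" for g
  have S: "\<sigma> g \<in> carrier_mat d d" if "g \<in> carrier G" for g using R' that unfolding \<sigma>_def by simp
  have int: "\<rho> h * \<Phi> X = \<Phi> X * \<sigma> h" if X: "X \<in> carrier_mat d d" and h: "h \<in> carrier G" for X h
  proof -
    have "\<Phi> X * \<sigma> h = (\<rho> h * \<Phi> X * \<rho>' h) * \<sigma> h" using fixed[OF X h] by simp
    also have "\<dots> = \<rho> h * \<Phi> X * (\<rho>' h * \<sigma> h)"
      by (rule assoc_mult_mat[OF mult_carrier_mat[OF R[OF h] \<Phi>c] R'[OF h] S[OF h]])
    also have "\<dots> = \<rho> h * \<Phi> X" using R'inv[OF h] right_mult_one_mat[OF mult_carrier_mat[OF R[OF h] \<Phi>c]]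
      unfolding \<sigma>_def by simp
    finally show ?thesis by simp
  qed
  have transp: "(\<Phi> X)\<^sup>T = \<Phi> (X\<^sup>T)" if X: "X \<in> carrier_mat d d" for X
  proof -
    have "(\<Phi> X)\<^sup>T = mat_sum d d (\<lambda>g. (\<rho> g * X * \<rho>' g)\<^sup>T) (carrier G)"
      unfolding \<Phi>_def by (rule mat_sum_transpose[OF summand[OF X]])
    also have "\<dots> = mat_sum d d (\<lambda>g. \<rho> (\<tau> g) * X\<^sup>T * \<rho>' (\<tau> g)) (carrier G)"
    proof (rule mat_sum_cong)
      fix g assume g: "g \<in> carrier G"
      have "(\<rho> g * X * \<rho>' g)\<^sup>T = \<rho> (\<tau> g) * (X\<^sup>T * (\<rho> g)\<^sup>T)"
        using transpose_mult[OF mult_carrier_mat[OF R[OF g] X] R'[OF g]] transpose_mult[OF R[OF g] X]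
        by (simp add: \<rho>'_def)
      also have "\<dots> = \<rho> (\<tau> g) * X\<^sup>T * (\<rho> g)\<^sup>T"
        by (rule assoc_mult_mat[symmetric, OF R]) (use g X R[OF g] in auto)
      finally show "(\<rho> g * X * \<rho>' g)\<^sup>T = \<rho> (\<tau> g) * X\<^sup>T * \<rho>' (\<tau> g)"
        using tau_tau[OF g] by (simp add: \<rho>'_def)
    qed
    also have "\<dots> = \<Phi> (X\<^sup>T)"
      unfolding \<Phi>_def by (rule mat_sum_reindex[OF bij_tau, of d d "\<lambda>g. \<rho> g * X\<^sup>T * \<rho>' g"])
    finally show ?thesis .
  qed
  have entry: "\<Phi> (mat_unit d d j k) $$ (i,l) = (\<Sum>g\<in>carrier G. \<rho> g $$ (i,j) * \<rho> (\<tau> g) $$ (l,k))"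
    if "i < d" "j < d" "k < d" "l < d" for i j k l
  proof -
    have "(\<rho> g * mat_unit d d j k * \<rho>' g) $$ (i,l) = \<rho> g $$ (i,j) * \<rho> (\<tau> g) $$ (l,k)"
      if g: "g \<in> carrier G" for g
      using mult_mat_unit_mult[OF R[OF g] R'[OF g]] \<open>i < d\<close> \<open>j < d\<close> \<open>k < d\<close> \<open>l < d\<close>
        R[OF tau_closed[OF g]] unfolding \<rho>'_def by simp
    then show ?thesis using that unfolding \<Phi>_def by (simp add: mat_sum_index)
  qed
  define S1 where "S1 = (\<Sum>g\<in>carrier G. \<chi> (g \<otimes> \<tau> g))"
  define S2 where "S2 = (\<Sum>g\<in>carrier G. \<chi> g * \<chi> (\<tau> g))"
  have swap3: "(\<Sum>g\<in>carrier G. \<Sum>i<d. \<Sum>j<d. f g i j) = (\<Sum>i<d. \<Sum>j<d. \<Sum>g\<in>carrier G. f g i j)"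
    for f :: "'a \<Rightarrow> nat \<Rightarrow> nat \<Rightarrow> complex"
    by (subst sum.swap) (intro sum.cong refl sum.swap)
  have "\<chi> (g \<otimes> \<tau> g) = (\<Sum>i<d. \<Sum>j<d. \<rho> g $$ (i,j) * \<rho> (\<tau> g) $$ (j,i))" if g: "g \<in> carrier G" for g
    using R[OF g] R[OF tau_closed[OF g]] g representation_mult[OF rep g tau_closed[OF g]]
    by (simp add: \<chi>\<rho> rep_character_def mat_trace_def scalar_prod_def lessThan_atLeast0)
  then have "S1 = (\<Sum>g\<in>carrier G. \<Sum>i<d. \<Sum>j<d. \<rho> g $$ (i,j) * \<rho> (\<tau> g) $$ (j,i))"
    unfolding S1_def by (intro sum.cong) auto
  then have S1: "S1 = (\<Sum>i<d. \<Sum>j<d. \<Phi> (mat_unit d d j i) $$ (i,j))"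
    unfolding swap3 by (simp add: entry)
  have "S2 = (\<Sum>g\<in>carrier G. \<Sum>i<d. \<Sum>j<d. \<rho> g $$ (i,i) * \<rho> (\<tau> g) $$ (j,j))"
    unfolding S2_def \<chi>\<rho> by (intro sum.cong rep_character_prod rep) auto
  then have S2: "S2 = (\<Sum>i<d. \<Sum>j<d. \<Phi> (mat_unit d d i j) $$ (i,j))"
    unfolding swap3 by (simp add: entry)
  have S2_one: "S2 = of_nat (card (carrier G))" if "\<forall>g\<in>carrier G. \<chi> (\<tau> g) = \<chi> (inv g)"
    using Irr_orthogonality[OF \<chi> \<chi>] that unfolding S2_def by simp
  show ?thesis
  proof (cases "\<exists>X\<in>carrier_mat d d. \<Phi> X \<noteq> 0\<^sub>m d d")
    case False
    then have "S1 = 0" "S2 = 0" unfolding S1 S2 by (auto intro!: sum.neutral)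
    then show ?thesis using that[of 0] S2_one card_pos unfolding S1_def by auto
  next
    case True
    then obtain X where X: "X \<in> carrier_mat d d" and A0: "\<Phi> X \<noteq> 0\<^sub>m d d" by auto
    define A where "A = \<Phi> X"
    have A: "A \<in> carrier_mat d d" "A \<noteq> 0\<^sub>m d d" using A0 \<Phi>c unfolding A_def by auto
    have Aint: "\<rho> h * A = A * \<sigma> h" if "h \<in> carrier G" for h using int[OF X that] unfolding A_def .
    obtain B where B: "B \<in> carrier_mat d d" "A * B = 1\<^sub>m d"
      using intertwiner_right_inverse[OF irr A S Aint] by blast
    have BA: "B * A = 1\<^sub>m d" by (rule mat_mult_left_right_inverse[OF A(1) B])
    have Bint: "\<sigma> h * B = B * \<rho> h" if h: "h \<in> carrier G" for h
    proof -
      have "B * \<rho> h = B * (\<rho> h * (A * B))" using B R[OF h] by simp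
      also have "\<dots> = B * (A * \<sigma> h * B)"
        using assoc_mult_mat[OF R[OF h] A(1) B(1)] Aint[OF h] by simp
      also have "\<dots> = B * A * (\<sigma> h * B)"
        using A(1) B(1) S[OF h] by (smt (verit) assoc_mult_mat mult_carrier_mat)
      also have "\<dots> = \<sigma> h * B" using BA left_mult_one_mat[OF mult_carrier_mat[OF S[OF h] B(1)]] by simp
      finally show ?thesis by simp
    qed
    have multiple: "\<exists>c. \<Phi> Y = c \<cdot>\<^sub>m A" if Y: "Y \<in> carrier_mat d d" for Y
    proof -
      have "\<rho> h * (\<Phi> Y * B) = (\<Phi> Y * B) * \<rho> h" if h: "h \<in> carrier G" for h
        using int[OF Y h] Bint[OF h] assoc_mult_mat[OF R[OF h] \<Phi>c[of Y] B(1)]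
          assoc_mult_mat[OF \<Phi>c[of Y] S[OF h] B(1)] assoc_mult_mat[OF \<Phi>c[of Y] B(1) R[OF h]] by simp
      then obtain c where c: "\<Phi> Y * B = c \<cdot>\<^sub>m 1\<^sub>m d"
        using schur_scalar[OF irr mult_carrier_mat[OF \<Phi>c B(1)]] by blast
      have "\<Phi> Y = \<Phi> Y * (B * A)" using BA \<Phi>c[of Y] by simp
      also have "\<dots> = (c \<cdot>\<^sub>m 1\<^sub>m d) * A" using assoc_mult_mat[OF \<Phi>c[of Y] B(1) A(1)] c by simp
      also have "\<dots> = c \<cdot>\<^sub>m A" using mult_smult_assoc_mat[OF one_carrier_mat A(1)] A(1) by simp
      finally show ?thesis by blast
    qed
    obtain c where c: "A\<^sup>T = c \<cdot>\<^sub>m A" using multiple[of "X\<^sup>T"] transp[OF X] X unfolding A_def by auto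
    \<comment> \<open>Transposing twice multiplies a nonzero entry by the square of c.\<close>
    have "c * c = 1"
    proof -
      have ij: "A $$ (j,i) = c * A $$ (i,j)" if "i < d" "j < d" for i j
        using arg_cong[OF c, of "\<lambda>M. M $$ (i,j)"] that A(1) by simp
      obtain i j where "i < d" "j < d" "A $$ (i,j) \<noteq> 0"
        using A by (metis (no_types, lifting) carrier_matD eq_matI index_zero_mat)
      then show ?thesis using ij[of i j] ij[of j i] by (metis mult.assoc mult_cancel_right2)
    qed
    then have c1: "c \<in> {-1, 0, 1}" "c \<noteq> 0" by (auto simp: square_eq_1_iff)
    have c\<Phi>: "\<Phi> (Y\<^sup>T) = c \<cdot>\<^sub>m \<Phi> Y" if Y: "Y \<in> carrier_mat d d" for Y
    proof -
      obtain a where a: "\<Phi> Y = a \<cdot>\<^sub>m A" using multiple[OF Y] by auto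
      have "\<Phi> (Y\<^sup>T) = a \<cdot>\<^sub>m A\<^sup>T" unfolding transp[OF Y, symmetric] a by (rule eq_matI) auto
      also have "\<dots> = c \<cdot>\<^sub>m \<Phi> Y" unfolding a c by (rule eq_matI) auto
      finally show ?thesis .
    qed
    have real: "\<chi> (\<tau> g) = \<chi> (inv g)" if g: "g \<in> carrier G" for g
    proof -
      have "mat_trace (\<rho> (inv g)) = mat_trace (\<rho> (inv g) * (A * B))" using R[of "inv g"] B g by simp
      also have "\<rho> (inv g) * (A * B) = A * (\<rho>' g * B)"
        using assoc_mult_mat[OF R A(1) B(1), of "inv g"] Aint[of "inv g"]
          assoc_mult_mat[OF A(1) R'[OF g] B(1)] g unfolding \<sigma>_def by simp
      also have "mat_trace \<dots> = mat_trace (\<rho>' g * B * A)"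
        by (rule mat_trace_comm[OF A(1) mult_carrier_mat[OF R'[OF g] B(1)]])
      also have "\<rho>' g * B * A = \<rho>' g" using assoc_mult_mat[OF R'[OF g] B(1) A(1)] BA R'[OF g] by simp
      also have "mat_trace (\<rho>' g) = mat_trace (\<rho> (\<tau> g))"
        using R[OF tau_closed[OF g]] unfolding \<rho>'_def by (simp add: mat_trace_def)
      finally show ?thesis using g unfolding \<chi>\<rho> rep_character_def by simp
    qed
    have "S1 = c * S2"
    proof -
      have "\<Phi> (mat_unit d d j i) $$ (i,j) = c * \<Phi> (mat_unit d d i j) $$ (i,j)" if "i < d" "j < d" for i j
        using c\<Phi>[of "mat_unit d d i j"] that \<Phi>c[of "mat_unit d d i j"] by (simp add: mat_unit_transpose)
      then show ?thesis unfolding S1 S2 by (simp add: sum_distrib_left)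
    qed
    then show ?thesis using that[OF c1(1)] S2_one real c1(2) unfolding S1_def by auto
  qed
qed

definition twisted_roots :: "'a \<Rightarrow> 'a set"
  where "twisted_roots g = {x \<in> carrier G. x \<otimes> \<tau> x = g}"

lemma twisted_roots_class_function: "class_function (\<lambda>g. of_nat (card (twisted_roots g)))"
  unfolding class_function_def
proof (intro ballI)
  fix g h assume g: "g \<in> carrier G" and h: "h \<in> carrier G"
  have "bij_betw (\<lambda>x. h \<otimes> x \<otimes> inv (\<tau> h)) (twisted_roots g) (twisted_roots (h \<otimes> g \<otimes> inv h))"
  proof (rule bij_betw_byWitness[where f'="\<lambda>x. inv h \<otimes> x \<otimes> \<tau> h"])
    show "(\<lambda>x. h \<otimes> x \<otimes> inv (\<tau> h)) ` twisted_roots g \<subseteq> twisted_roots (h \<otimes> g \<otimes> inv h)"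
      using g h by (auto simp: twisted_roots_def tau_mult tau_inv tau_tau m_assoc)
    show "(\<lambda>x. inv h \<otimes> x \<otimes> \<tau> h) ` twisted_roots (h \<otimes> g \<otimes> inv h) \<subseteq> twisted_roots g"
    proof
      fix y assume "y \<in> (\<lambda>x. inv h \<otimes> x \<otimes> \<tau> h) ` twisted_roots (h \<otimes> g \<otimes> inv h)"
      then obtain x where x: "x \<in> carrier G" "x \<otimes> \<tau> x = h \<otimes> g \<otimes> inv h" "y = inv h \<otimes> x \<otimes> \<tau> h"
        unfolding twisted_roots_def by auto
      have "y \<otimes> \<tau> y = inv h \<otimes> (x \<otimes> \<tau> x) \<otimes> h"
        using x(1,3) h by (simp add: tau_mult tau_inv tau_tau m_assoc)
      also have "\<dots> = g" unfolding x(2) using g h by (simp add: m_assoc)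
      finally show "y \<in> twisted_roots g" using x h unfolding twisted_roots_def by auto
    qed
  qed (use h in \<open>auto simp: twisted_roots_def m_assoc\<close>)
  then show "of_nat (card (twisted_roots (h \<otimes> g \<otimes> inv h))) = (of_nat (card (twisted_roots g)) :: complex)"
    by (metis bij_betw_same_card)
qed

lemma twisted_roots_inner:
  assumes \<chi>: "\<chi> \<in> Irr G"
  shows "(\<Sum>g\<in>carrier G. of_nat (card (twisted_roots g)) * \<chi> (inv g)) = (\<Sum>x\<in>carrier G. \<chi> (x \<otimes> \<tau> x))"
proof -
  have "(\<Sum>g\<in>carrier G. of_nat (card (twisted_roots g)) * \<chi> (inv g)) =
      (\<Sum>g\<in>carrier G. \<Sum>x\<in>carrier G. if x \<otimes> \<tau> x = g then \<chi> (inv g) else 0)"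
    unfolding twisted_roots_def using fin by (intro sum.cong) (auto simp: sum.If_cases Int_def)
  also have "\<dots> = (\<Sum>x\<in>carrier G. \<Sum>g\<in>carrier G. if x \<otimes> \<tau> x = g then \<chi> (inv g) else 0)"
    by (rule sum.swap)
  also have "\<dots> = (\<Sum>x\<in>carrier G. \<chi> (inv (x \<otimes> \<tau> x)))" using fin by simp
  also have "\<dots> = (\<Sum>x\<in>carrier G. \<chi> (inv (\<tau> x) \<otimes> \<tau> (inv (\<tau> x))))"
    by (intro sum.cong) (auto simp: inv_mult_group tau_inv tau_tau)
  also have "\<dots> = (\<Sum>x\<in>carrier G. \<chi> (x \<otimes> \<tau> x))"
  proof (rule sum.reindex_bij_betw[of "\<lambda>x. inv (\<tau> x)"])
    show "bij_betw (\<lambda>x. inv (\<tau> x)) (carrier G) (carrier G)"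
      using bij_betw_trans[OF bij_tau bij_inv] by (simp add: o_def)
  qed
  finally show ?thesis .
qed

definition twisted_indicator :: "('a \<Rightarrow> complex) \<Rightarrow> complex"
  where "twisted_indicator \<chi> = (\<Sum>g\<in>carrier G. \<chi> (g \<otimes> \<tau> g)) / of_nat (card (carrier G))"

lemma twisted_indicator:
  assumes "\<chi> \<in> Irr G"
  shows "twisted_indicator \<chi> \<in> {-1, 0, 1}"
    and "twisted_indicator \<chi> \<noteq> 0 \<longleftrightarrow> (\<forall>g\<in>carrier G. \<chi> (\<tau> g) = \<chi> (inv g))"
    and "(\<Sum>g\<in>carrier G. of_nat (card (twisted_roots g)) * \<chi> (inv g)) =
      twisted_indicator \<chi> * of_nat (card (carrier G))"
proof -
  obtain c :: complex where c: "c \<in> {-1, 0, 1}"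
    "(\<Sum>g\<in>carrier G. \<chi> (g \<otimes> \<tau> g)) = c * of_nat (card (carrier G))"
    "c \<noteq> 0 \<longleftrightarrow> (\<forall>g\<in>carrier G. \<chi> (\<tau> g) = \<chi> (inv g))"
    by (rule twisted_frobenius_schur[OF assms])
  have eq: "twisted_indicator \<chi> = c" using c(2) card_pos unfolding twisted_indicator_def by simp
  show "twisted_indicator \<chi> \<in> {-1, 0, 1}" unfolding eq by (rule c(1))
  show "twisted_indicator \<chi> \<noteq> 0 \<longleftrightarrow> (\<forall>g\<in>carrier G. \<chi> (\<tau> g) = \<chi> (inv g))"
    unfolding eq by (rule c(3))
  show "(\<Sum>g\<in>carrier G. of_nat (card (twisted_roots g)) * \<chi> (inv g)) =
      twisted_indicator \<chi> * of_nat (card (carrier G))"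
    unfolding twisted_roots_inner[OF assms] eq by (rule c(2))
qed

lemma twisted_roots_expansion:
  assumes "g \<in> carrier G"
  shows "of_nat (card (twisted_roots g)) = (\<Sum>\<chi>\<in>Irr G. twisted_indicator \<chi> * \<chi> g)"
  unfolding class_function_expansion[OF twisted_roots_class_function assms]
  by (rule sum.cong) (use twisted_indicator(3) card_pos in simp_all)

text \<open>The number of twisted roots of \<open>\<one>\<close> is the sum of the degrees weighted by the indicators.
  Degrees are positive and indicators at most 1, so equality of the degree sums forces all
  indicators to be 1.\<close>

theorem degree_sum_criterion:
  assumes deg: "(\<Sum>\<chi>\<in>Irr G. \<chi> \<one>) = of_nat (card (twisted_roots \<one>))" and g: "g \<in> carrier G"
  shows "(\<Sum>\<chi>\<in>Irr G. \<chi> g) = of_nat (card (twisted_roots g))"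
    and "\<exists>h\<in>carrier G. \<tau> g = h \<otimes> inv g \<otimes> inv h"
proof -
  have "(\<Sum>\<chi>\<in>Irr G. (1 - twisted_indicator \<chi>) * \<chi> \<one>) = 0"
    using deg twisted_roots_expansion[OF one_closed] by (simp add: left_diff_distrib sum_subtractf)
  then have "(\<Sum>\<chi>\<in>Irr G. Re ((1 - twisted_indicator \<chi>) * \<chi> \<one>)) = 0" by (metis Re_sum zero_complex.simps(1))
  moreover have nn: "Re ((1 - twisted_indicator \<chi>) * \<chi> \<one>) \<ge> 0" if \<chi>: "\<chi> \<in> Irr G" for \<chi>
  proof -
    obtain d where "d > 0" "\<chi> \<one> = of_nat d" by (rule Irr_degree[OF \<chi>])
    then show ?thesis using twisted_indicator(1)[OF \<chi>] by auto
  qed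
  ultimately have z: "\<forall>\<chi>\<in>Irr G. Re ((1 - twisted_indicator \<chi>) * \<chi> \<one>) = 0"
    using sum_nonneg_eq_0_iff[OF finite_Irr, of "\<lambda>\<chi>. Re ((1 - twisted_indicator \<chi>) * \<chi> \<one>)"] by blast
  have one: "twisted_indicator \<chi> = 1" if \<chi>: "\<chi> \<in> Irr G" for \<chi>
  proof -
    obtain d where "d > 0" "\<chi> \<one> = of_nat d" by (rule Irr_degree[OF \<chi>])
    then show ?thesis using z \<chi> twisted_indicator(1)[OF \<chi>] by auto
  qed
  show "(\<Sum>\<chi>\<in>Irr G. \<chi> g) = of_nat (card (twisted_roots g))" using twisted_roots_expansion[OF g] one by simp
  have "\<chi> (\<tau> g) = \<chi> (inv g)" if "\<chi> \<in> Irr G" for \<chi> using twisted_indicator(2)[OF that] one[OF that] g by simp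
  then show "\<exists>h\<in>carrier G. \<tau> g = h \<otimes> inv g \<otimes> inv h"
    using conjugate_if_characters_agree[of "\<tau> g" "inv g"] g by (metis inv_closed tau_closed)
qed

text \<open>Conjugacy of \<open>\<tau> g\<close> and \<open>inv g\<close> excludes the indicator 0, and a nonnegative multiplicity in
  the twisted root count excludes -1.\<close>

theorem indicator_criterion:
  assumes conj: "\<And>g. g \<in> carrier G \<Longrightarrow> \<exists>h\<in>carrier G. \<tau> g = h \<otimes> inv g \<otimes> inv h"
    and pos: "\<And>\<chi>. \<chi> \<in> Irr G \<Longrightarrow>
      \<exists>r. (\<Sum>g\<in>carrier G. of_nat (card (twisted_roots g)) * \<chi> (inv g)) = of_nat r"
    and g: "g \<in> carrier G"
  shows "(\<Sum>\<chi>\<in>Irr G. \<chi> g) = of_nat (card (twisted_roots g))"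
proof -
  have one: "twisted_indicator \<chi> = 1" if \<chi>: "\<chi> \<in> Irr G" for \<chi>
  proof -
    have "\<chi> (\<tau> g) = \<chi> (inv g)" if g: "g \<in> carrier G" for g
    proof -
      obtain h where "h \<in> carrier G" "\<tau> g = h \<otimes> inv g \<otimes> inv h" using conj[OF g] by auto
      then show ?thesis using Irr_class_function[OF \<chi>] g unfolding class_function_def by simp
    qed
    then have "twisted_indicator \<chi> \<noteq> 0" using twisted_indicator(2)[OF \<chi>] by simp
    moreover obtain r where r: "twisted_indicator \<chi> * of_nat (card (carrier G)) = of_nat r" using pos[OF \<chi>] twisted_indicator(3)[OF \<chi>] by metis
    have "twisted_indicator \<chi> \<noteq> -1"
    proof
      assume "twisted_indicator \<chi> = -1"
      then have "Re (of_nat r) = - real (card (carrier G))" using r by (metis Re_complex_of_real mult_minus1 of_real_of_nat_eq uminus_complex.simps(1))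
      then show False using card_pos by simp
    qed
    ultimately show ?thesis using twisted_indicator(1)[OF \<chi>] by auto
  qed
  then show ?thesis using twisted_roots_expansion[OF g] by simp
qed

end

section \<open>Generalized involution models as families of linear characters\<close>

lemma linear_charactersD:
  assumes "group K" "\<psi> \<in> linear_characters K"
  shows "\<psi> \<one>\<^bsub>K\<^esub> = 1"
    and "g \<in> carrier K \<Longrightarrow> h \<in> carrier K \<Longrightarrow> \<psi> (g \<otimes>\<^bsub>K\<^esub> h) = \<psi> g * \<psi> h"
proof -
  interpret group K by fact
  obtain \<rho> where \<rho>: "representation K 1 \<rho>" "\<psi> = rep_character K \<rho>"
    using assms(2) unfolding linear_characters_def by auto
  have val: "\<psi> g = \<rho> g $$ (0,0)" if "g \<in> carrier K" for g
    using representation_carrier[OF \<rho>(1) that] that by (simp add: \<rho>(2) rep_character_def mat_trace_def)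
  show "\<psi> \<one>\<^bsub>K\<^esub> = 1" using representation_one[OF assms(1) \<rho>(1)] by (simp add: val)
  assume g: "g \<in> carrier K" and h: "h \<in> carrier K"
  then show "\<psi> (g \<otimes>\<^bsub>K\<^esub> h) = \<psi> g * \<psi> h"
    using representation_mult[OF \<rho>(1) g h] representation_carrier[OF \<rho>(1) g]
      representation_carrier[OF \<rho>(1) h] by (simp add: val scalar_prod_def)
qed

lemma linear_charactersI:
  assumes "group K" and one: "\<psi> \<one>\<^bsub>K\<^esub> = 1"
    and mult: "\<And>g h. g \<in> carrier K \<Longrightarrow> h \<in> carrier K \<Longrightarrow> \<psi> (g \<otimes>\<^bsub>K\<^esub> h) = \<psi> g * \<psi> h"
  shows "restrict \<psi> (carrier K) \<in> linear_characters K"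
proof -
  define \<rho> where "\<rho> g = mat 1 1 (\<lambda>_. \<psi> g)" for g
  have "representation K 1 \<rho>"
  proof (rule representationI[OF assms(1)])
    show "\<rho> (g \<otimes>\<^bsub>K\<^esub> h) = \<rho> g * \<rho> h" if "g \<in> carrier K" "h \<in> carrier K" for g h
      by (rule eq_matI) (auto simp: \<rho>_def mult[OF that] scalar_prod_def)
    show "\<rho> \<one>\<^bsub>K\<^esub> = 1\<^sub>m 1" by (rule eq_matI) (auto simp: \<rho>_def one)
  qed (simp add: \<rho>_def)
  moreover have "restrict \<psi> (carrier K) = rep_character K \<rho>"
    unfolding rep_character_def by (rule restrict_ext) (simp add: \<rho>_def mat_trace_def)
  ultimately show ?thesis unfolding linear_characters_def by blast
qed

context involutive_auto
begin

abbreviation Invs where "Invs \<equiv> twisted_involutions G \<tau>"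

text \<open>The same formula as in \<open>twisted_conj\<close>, but on all group elements, so that it can be
  rewritten without membership in the set of twisted involutions.\<close>

definition act :: "'a \<Rightarrow> 'a \<Rightarrow> 'a" where "act g \<omega> = g \<otimes> \<omega> \<otimes> inv (\<tau> g)"

definition stab :: "'a \<Rightarrow> 'a set" where "stab \<omega> = {g \<in> carrier G. act g \<omega> = \<omega>}"

definition orb :: "'a \<Rightarrow> 'a set" where "orb \<omega> = (\<lambda>g. act g \<omega>) ` carrier G"

lemma Invs_carrier: "\<omega> \<in> Invs \<Longrightarrow> \<omega> \<in> carrier G"
  unfolding twisted_involutions_def by simp

lemma finite_Invs: "finite Invs"
  using finite_subset[OF _ fin] Invs_carrier by blast

lemma act_closed:
  assumes "g \<in> carrier G" "\<omega> \<in> Invs"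
  shows "act g \<omega> \<in> Invs"
proof -
  have \<omega>: "\<omega> \<in> carrier G" "\<omega> \<otimes> \<tau> \<omega> = \<one>" using assms unfolding twisted_involutions_def by auto
  have "act g \<omega> \<otimes> \<tau> (act g \<omega>) = g \<otimes> (\<omega> \<otimes> \<tau> \<omega>) \<otimes> inv g"
    using assms(1) \<omega>(1) by (simp add: act_def tau_mult tau_inv tau_tau m_assoc)
  then show ?thesis using assms(1) \<omega> unfolding twisted_involutions_def act_def by simp
qed

lemma act_mult:
  "g \<in> carrier G \<Longrightarrow> h \<in> carrier G \<Longrightarrow> \<omega> \<in> carrier G \<Longrightarrow> act (g \<otimes> h) \<omega> = act g (act h \<omega>)"
  unfolding act_def by (simp add: tau_mult inv_mult_group m_assoc)

lemma act_one: "\<omega> \<in> carrier G \<Longrightarrow> act \<one> \<omega> = \<omega>"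
  unfolding act_def by simp

lemma act_carrier: "g \<in> carrier G \<Longrightarrow> \<omega> \<in> carrier G \<Longrightarrow> act g \<omega> \<in> carrier G"
  unfolding act_def by simp

lemma act_inv: "g \<in> carrier G \<Longrightarrow> \<omega> \<in> carrier G \<Longrightarrow> act (inv g) (act g \<omega>) = \<omega>"
  using act_mult[of "inv g" g \<omega>] act_one by simp

lemma act_eq_iff:
  assumes "x \<in> carrier G" "y \<in> carrier G" "\<omega> \<in> carrier G"
  shows "act x \<omega> = act y \<omega> \<longleftrightarrow> inv y \<otimes> x \<in> stab \<omega>"
proof -
  have "act (inv y \<otimes> x) \<omega> = act (inv y) (act x \<omega>)" using assms by (simp add: act_mult)
  moreover have "act y (act (inv y) (act x \<omega>)) = act x \<omega>"
    using assms act_mult[of y "inv y" "act x \<omega>"] act_one by (simp add: act_carrier)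
  ultimately show ?thesis using assms act_inv[of y \<omega>] unfolding stab_def by auto
qed

lemma twisted_centralizer_eq: "\<omega> \<in> Invs \<Longrightarrow> twisted_centralizer G \<tau> \<omega> = stab \<omega>"
  unfolding twisted_centralizer_def stabilizer_def twisted_conj_def stab_def act_def by simp

lemma orbit_eq: "\<omega> \<in> Invs \<Longrightarrow> orbit G (twisted_conj G \<tau>) \<omega> = orb \<omega>"
  unfolding orbit_def twisted_conj_def orb_def act_def by auto

lemma orbits_eq: "orbits G Invs (twisted_conj G \<tau>) = orb ` Invs"
  unfolding orbits_def using orbit_eq by auto

lemma orb_refl: "\<omega> \<in> carrier G \<Longrightarrow> \<omega> \<in> orb \<omega>"
  unfolding orb_def using act_one by (metis imageI one_closed)

lemma orb_eq:
  assumes "\<omega> \<in> carrier G" "\<omega>' \<in> orb \<omega>"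
  shows "orb \<omega>' = orb \<omega>"
proof -
  obtain x where x: "x \<in> carrier G" "\<omega>' = act x \<omega>" using assms(2) unfolding orb_def by auto
  have "orb \<omega>' = (\<lambda>g. act (g \<otimes> x) \<omega>) ` carrier G"
    unfolding orb_def x(2) by (rule image_cong) (use act_mult x(1) assms(1) in auto)
  also have "\<dots> = (\<lambda>g. act g \<omega>) ` ((\<lambda>g. g \<otimes> x) ` carrier G)" by auto
  also have "(\<lambda>g. g \<otimes> x) ` carrier G = carrier G" using bij_right_mult[OF x(1)] unfolding bij_betw_def by simp
  finally show ?thesis unfolding orb_def .
qed

lemma orb_subset: "\<omega> \<in> Invs \<Longrightarrow> orb \<omega> \<subseteq> Invs"
  unfolding orb_def using act_closed by auto

lemma stab_subgroup:
  assumes "\<omega> \<in> Invs"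
  shows "subgroup (stab \<omega>) G"
proof -
  have \<omega>: "\<omega> \<in> carrier G" using Invs_carrier[OF assms] .
  show ?thesis
    by (rule subgroupI) (use \<omega> act_one act_mult in \<open>auto simp: stab_def intro: act_inv, metis act_inv\<close>)
qed

lemma stab_act:
  assumes "x \<in> carrier G" "\<omega> \<in> carrier G" "g \<in> carrier G"
  shows "act g (act x \<omega>) = act x \<omega> \<longleftrightarrow> inv x \<otimes> g \<otimes> x \<in> stab \<omega>"
  using act_eq_iff[of "g \<otimes> x" x \<omega>] assms act_mult by (simp add: m_assoc)

lemma sum_over_orbit:
  fixes k :: "'a \<Rightarrow> complex"
  assumes \<omega>: "\<omega> \<in> carrier G"
  shows "(\<Sum>x\<in>carrier G. k (act x \<omega>)) = of_nat (card (stab \<omega>)) * (\<Sum>\<omega>'\<in>orb \<omega>. k \<omega>')"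
proof -
  have card: "card {x \<in> carrier G. act x \<omega> = \<omega>'} = card (stab \<omega>)" if \<omega>': "\<omega>' \<in> orb \<omega>" for \<omega>'
  proof -
    obtain a where a: "a \<in> carrier G" "\<omega>' = act a \<omega>" using \<omega>' unfolding orb_def by auto
    have "bij_betw (\<lambda>h. a \<otimes> h) (stab \<omega>) {x \<in> carrier G. act x \<omega> = \<omega>'}"
    proof (rule bij_betw_byWitness[where f'="\<lambda>x. inv a \<otimes> x"])
      show "(\<lambda>x. inv a \<otimes> x) ` {x \<in> carrier G. act x \<omega> = \<omega>'} \<subseteq> stab \<omega>"
        using a act_eq_iff[OF _ a(1) \<omega>] by auto
      show "(\<lambda>h. a \<otimes> h) ` stab \<omega> \<subseteq> {x \<in> carrier G. act x \<omega> = \<omega>'}"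
        using a \<omega> act_mult by (auto simp: stab_def)
    qed (use a in \<open>auto simp: stab_def\<close>)
    then show ?thesis by (rule bij_betw_same_card[symmetric])
  qed
  have "(\<Sum>x\<in>carrier G. k (act x \<omega>)) =
      (\<Sum>\<omega>'\<in>orb \<omega>. \<Sum>x\<in>{x\<in>carrier G. act x \<omega> = \<omega>'}. k (act x \<omega>))"
    unfolding orb_def by (rule sum.image_gen[OF fin])
  also have "\<dots> = (\<Sum>\<omega>'\<in>orb \<omega>. of_nat (card (stab \<omega>)) * k \<omega>')"
    by (rule sum.cong) (use card in auto)
  finally show ?thesis by (simp add: sum_distrib_left)
qed

text \<open>A summand of the induced character depends only on the point \<open>act x \<omega>\<close> of the orbit, once
  \<open>\<psi>\<close> has been transported along the orbit by conjugation; and every point arises from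
  \<open>card (stab \<omega>)\<close> elements \<open>x\<close>.\<close>

lemma induced_character_as_fixed_points:
  assumes \<omega>: "\<omega> \<in> Invs" and g: "g \<in> carrier G"
    and F: "\<And>x h. x \<in> carrier G \<Longrightarrow> h \<in> stab \<omega> \<Longrightarrow> F (act x \<omega>) (x \<otimes> h \<otimes> inv x) = \<psi> h"
  shows "induced_character G (stab \<omega>) \<psi> g = (\<Sum>\<omega>'\<in>{\<omega>'\<in>orb \<omega>. act g \<omega>' = \<omega>'}. F \<omega>' g)"
proof -
  have \<omega>G: "\<omega> \<in> carrier G" using Invs_carrier[OF \<omega>] .
  interpret S: subgroup "stab \<omega>" G by (rule stab_subgroup[OF \<omega>])
  have cS: "card (stab \<omega>) > 0" using S.one_closed finite_subset[OF S.subset fin] card_gt_0_iff by blast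
  have forb: "finite (orb \<omega>)" unfolding orb_def using fin by simp
  have "(\<Sum>x | x \<in> carrier G \<and> inv x \<otimes> g \<otimes> x \<in> stab \<omega>. \<psi> (inv x \<otimes> g \<otimes> x)) =
      (\<Sum>x\<in>carrier G. if inv x \<otimes> g \<otimes> x \<in> stab \<omega> then \<psi> (inv x \<otimes> g \<otimes> x) else 0)"
    using fin by (simp add: sum.If_cases Int_def)
  also have "\<dots> = (\<Sum>x\<in>carrier G. if act g (act x \<omega>) = act x \<omega> then F (act x \<omega>) g else 0)"
  proof (rule sum.cong)
    fix x assume x: "x \<in> carrier G"
    have "F (act x \<omega>) g = \<psi> (inv x \<otimes> g \<otimes> x)" if "inv x \<otimes> g \<otimes> x \<in> stab \<omega>"
      using F[OF x that] x g by (simp add: m_assoc)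
    then show "(if inv x \<otimes> g \<otimes> x \<in> stab \<omega> then \<psi> (inv x \<otimes> g \<otimes> x) else 0) =
        (if act g (act x \<omega>) = act x \<omega> then F (act x \<omega>) g else 0)"
      using stab_act[OF x \<omega>G g] by simp
  qed simp
  also have "\<dots> = of_nat (card (stab \<omega>)) * (\<Sum>\<omega>'\<in>orb \<omega>. if act g \<omega>' = \<omega>' then F \<omega>' g else 0)"
    by (rule sum_over_orbit[OF \<omega>G, of "\<lambda>\<omega>'. if act g \<omega>' = \<omega>' then F \<omega>' g else 0"])
  also have "(\<Sum>\<omega>'\<in>orb \<omega>. if act g \<omega>' = \<omega>' then F \<omega>' g else 0) =
      (\<Sum>\<omega>'\<in>{\<omega>'\<in>orb \<omega>. act g \<omega>' = \<omega>'}. F \<omega>' g)"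
    using forb by (simp add: sum.If_cases Int_def)
  finally show ?thesis using g cS unfolding induced_character_def by simp
qed

lemma frobenius_reciprocity:
  assumes H: "subgroup H G" and \<chi>: "class_function \<chi>"
  shows "(\<Sum>g\<in>carrier G. induced_character G H \<psi> g * \<chi> (inv g)) =
    of_nat (card (carrier G)) / of_nat (card H) * (\<Sum>h\<in>H. \<psi> h * \<chi> (inv h))"
proof -
  define f where "f h = (if h \<in> H then \<psi> h * \<chi> (inv h) else 0)" for h
  have Hc: "H \<subseteq> carrier G" by (rule subgroup.subset[OF H])
  have "(\<Sum>g\<in>carrier G. induced_character G H \<psi> g * \<chi> (inv g)) =
      (\<Sum>g\<in>carrier G. \<Sum>x\<in>carrier G. f (inv x \<otimes> g \<otimes> x) / of_nat (card H))"
  proof (rule sum.cong)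
    fix g assume g: "g \<in> carrier G"
    have \<chi>g: "\<chi> (inv (inv x \<otimes> g \<otimes> x)) = \<chi> (inv g)" if x: "x \<in> carrier G" for x
    proof -
      have "inv (inv x \<otimes> g \<otimes> x) = inv x \<otimes> inv g \<otimes> inv (inv x)"
        using x g by (simp add: inv_mult_group m_assoc)
      then show ?thesis using \<chi>[unfolded class_function_def, rule_format, of "inv g" "inv x"] x g by simp
    qed
    have "induced_character G H \<psi> g * \<chi> (inv g) =
        (\<Sum>x\<in>carrier G. if inv x \<otimes> g \<otimes> x \<in> H then \<psi> (inv x \<otimes> g \<otimes> x) else 0) / of_nat (card H) * \<chi> (inv g)"
      using g fin unfolding induced_character_def by (simp add: sum.If_cases Int_def)
    also have "\<dots> = (\<Sum>x\<in>carrier G. f (inv x \<otimes> g \<otimes> x) / of_nat (card H))"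
      unfolding sum_divide_distrib sum_distrib_right by (rule sum.cong) (auto simp: f_def \<chi>g)
    finally show "induced_character G H \<psi> g * \<chi> (inv g) =
        (\<Sum>x\<in>carrier G. f (inv x \<otimes> g \<otimes> x) / of_nat (card H))" .
  qed simp
  also have "\<dots> = (\<Sum>x\<in>carrier G. \<Sum>g\<in>carrier G. f (inv x \<otimes> g \<otimes> x) / of_nat (card H))"
    by (rule sum.swap)
  also have "\<dots> = (\<Sum>x\<in>carrier G. (\<Sum>h\<in>carrier G. f h) / of_nat (card H))"
  proof (rule sum.cong)
    fix x assume x: "x \<in> carrier G"
    have "(\<Sum>g\<in>carrier G. f (inv x \<otimes> g \<otimes> x)) = (\<Sum>g\<in>carrier G. f g)"
      using sum.reindex_bij_betw[OF bij_conj[of "inv x"], of f] x by simp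
    then show "(\<Sum>g\<in>carrier G. f (inv x \<otimes> g \<otimes> x) / of_nat (card H)) =
        (\<Sum>h\<in>carrier G. f h) / of_nat (card H)" by (simp add: sum_divide_distrib[symmetric])
  qed simp
  also have "(\<Sum>h\<in>carrier G. f h) = (\<Sum>h\<in>H. \<psi> h * \<chi> (inv h))"
    unfolding f_def using fin Hc by (simp add: sum.If_cases Int_absorb1)
  finally show ?thesis by simp
qed

text \<open>A linear character of every stabilizer, compatible with conjugation. On each orbit such a
  family is determined by the character at one point, so that it records the same data as the
  characters of a model.\<close>

definition linear_family :: "('a \<Rightarrow> 'a \<Rightarrow> complex) \<Rightarrow> bool" where
  "linear_family F \<longleftrightarrow> (\<forall>\<omega>\<in>Invs. F \<omega> \<one> = 1 \<and>
    (\<forall>g\<in>stab \<omega>. \<forall>h\<in>stab \<omega>. F \<omega> (g \<otimes> h) = F \<omega> g * F \<omega> h) \<and>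
    (\<forall>x\<in>carrier G. \<forall>g\<in>stab \<omega>. F (act x \<omega>) (x \<otimes> g \<otimes> inv x) = F \<omega> g))"

text \<open>The characters of the model are transported along the orbits. The degree of their induced
  characters then counts the twisted involutions, which are the twisted roots of \<open>\<one>\<close>, and the
  degree criterion applies.\<close>

theorem generalized_involution_model_imp:
  assumes M: "generalized_involution_model G \<tau> M"
  obtains F where "linear_family F"
    "\<And>g. g \<in> carrier G \<Longrightarrow>
      (\<Sum>\<omega>\<in>{\<omega>\<in>Invs. act g \<omega> = \<omega>}. F \<omega> g) = of_nat (card (twisted_roots g))"
    "\<And>g. g \<in> carrier G \<Longrightarrow> \<exists>h\<in>carrier G. \<tau> g = h \<otimes> inv g \<otimes> inv h"
proof -
  from M obtain \<iota> where model: "model G M" and inj: "inj_on \<iota> M" and \<iota>I: "\<iota> ` M \<subseteq> Invs"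
    and cent: "\<forall>(H, \<psi>)\<in>M. H = twisted_centralizer G \<tau> (\<iota> (H, \<psi>))"
    and ex1: "\<forall>orb \<in> orbits G Invs (twisted_conj G \<tau>). \<exists>!\<omega>. \<omega> \<in> \<iota> ` M \<and> \<omega> \<in> orb"
    unfolding generalized_involution_model_def by auto
  have finM: "finite M" and lin: "\<And>m. m \<in> M \<Longrightarrow> subgroup (fst m) G \<and> snd m \<in> linear_characters (G\<lparr>carrier := fst m\<rparr>)"
    and sumM: "\<And>g. g \<in> carrier G \<Longrightarrow> (\<Sum>m\<in>M. induced_character G (fst m) (snd m) g) = (\<Sum>\<chi>\<in>Irr G. \<chi> g)"
    using model unfolding model_def by (auto simp: case_prod_beta)
  have \<iota>: "\<iota> m \<in> Invs" "\<iota> m \<in> carrier G" if "m \<in> M" for m using \<iota>I that Invs_carrier by auto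
  have H: "fst m = stab (\<iota> m)" if "m \<in> M" for m
    using cent that \<iota>[OF that] twisted_centralizer_eq by (auto simp: case_prod_beta)
  have snd1: "snd m \<one> = 1" and sndm: "\<And>g h. g \<in> stab (\<iota> m) \<Longrightarrow> h \<in> stab (\<iota> m) \<Longrightarrow> snd m (g \<otimes> h) = snd m g * snd m h"
    if m: "m \<in> M" for m
    using linear_charactersD[of "G\<lparr>carrier := fst m\<rparr>" "snd m"] lin[OF m] H[OF m]
      subgroup.subgroup_is_group[OF _ is_group] by auto
  have unique: "m = m'" if "m \<in> M" "m' \<in> M" "\<omega> \<in> orb (\<iota> m)" "\<omega> \<in> orb (\<iota> m')" for m m' \<omega>
  proof -
    have eq: "orb (\<iota> m) = orb (\<iota> m')" using orb_eq \<iota> that by metis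
    have "orb (\<iota> m) \<in> orbits G Invs (twisted_conj G \<tau>)" unfolding orbits_eq using \<iota> that by auto
    then have "\<iota> m = \<iota> m'"
      using ex1 orb_refl \<iota> that eq by (metis imageI)
    then show ?thesis using inj that unfolding inj_on_def by auto
  qed
  have "\<exists>m x. m \<in> M \<and> x \<in> carrier G \<and> \<omega> = act x (\<iota> m)" if \<omega>: "\<omega> \<in> Invs" for \<omega>
  proof -
    have "orb \<omega> \<in> orbits G Invs (twisted_conj G \<tau>)" unfolding orbits_eq using \<omega> by auto
    then obtain m where m: "m \<in> M" "\<iota> m \<in> orb \<omega>" using ex1 by blast
    then have "\<omega> \<in> orb (\<iota> m)" using orb_eq[OF Invs_carrier[OF \<omega>] m(2)] orb_refl[OF Invs_carrier[OF \<omega>]] by simp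
    then show ?thesis using m(1) unfolding orb_def by (intro exI[of _ m]) auto
  qed
  then obtain m x where mx: "\<And>\<omega>. \<omega> \<in> Invs \<Longrightarrow> m \<omega> \<in> M \<and> x \<omega> \<in> carrier G \<and> \<omega> = act (x \<omega>) (\<iota> (m \<omega>))"
    by metis
  define F where "F \<omega> g = snd (m \<omega>) (inv (x \<omega>) \<otimes> g \<otimes> x \<omega>)" for \<omega> g
  have F: "F (act y (\<iota> p)) (y \<otimes> h \<otimes> inv y) = snd p h"
    if p: "p \<in> M" and y: "y \<in> carrier G" and h: "h \<in> stab (\<iota> p)" for p y h
  proof -
    define \<omega> where "\<omega> = act y (\<iota> p)"
    have \<omega>I: "\<omega> \<in> Invs" unfolding \<omega>_def using act_closed[OF y \<iota>(1)[OF p]] .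
    note mx\<omega> = mx[OF \<omega>I]
    have "m \<omega> = p"
    proof (rule unique)
      show "\<omega> \<in> orb (\<iota> (m \<omega>))" using mx\<omega> unfolding orb_def by blast
      show "\<omega> \<in> orb (\<iota> p)" unfolding \<omega>_def orb_def using y by blast
    qed (use mx\<omega> p in auto)
    then have x\<omega>: "x \<omega> \<in> carrier G" "act (x \<omega>) (\<iota> p) = act y (\<iota> p)" using mx\<omega> \<omega>_def by auto
    define k where "k = inv (x \<omega>) \<otimes> y"
    have k: "k \<in> stab (\<iota> p)" unfolding k_def using act_eq_iff[OF y x\<omega>(1) \<iota>(2)[OF p]] x\<omega>(2) by simp
    interpret S: subgroup "stab (\<iota> p)" G by (rule stab_subgroup[OF \<iota>(1)[OF p]])
    have kG: "k \<in> carrier G" "h \<in> carrier G" using k h S.mem_carrier by auto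
    have ki: "inv k \<in> stab (\<iota> p)" using k by simp
    have "inv (x \<omega>) \<otimes> (y \<otimes> h \<otimes> inv y) \<otimes> x \<omega> = k \<otimes> h \<otimes> inv k"
      unfolding k_def using x\<omega>(1) y kG by (simp add: inv_mult_group m_assoc)
    then have "F \<omega> (y \<otimes> h \<otimes> inv y) = snd p (k \<otimes> h \<otimes> inv k)" unfolding F_def \<open>m \<omega> = p\<close> by simp
    also have "\<dots> = snd p h * (snd p k * snd p (inv k))"
      using sndm[OF p] k h ki by (simp add: S.m_closed)
    also have "snd p k * snd p (inv k) = 1"
      using sndm[OF p k ki] snd1[OF p] kG by simp
    finally show ?thesis unfolding \<omega>_def by simp
  qed
  have fam: "linear_family F"
    unfolding linear_family_def
  proof (intro ballI conjI)
    fix \<omega> assume \<omega>: "\<omega> \<in> Invs"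
    note mx\<omega> = mx[OF \<omega>]
    have mI: "\<iota> (m \<omega>) \<in> carrier G" using \<iota> mx\<omega> by blast
    have conj: "inv (x \<omega>) \<otimes> g \<otimes> x \<omega> \<in> stab (\<iota> (m \<omega>))" if g: "g \<in> stab \<omega>" for g
      using stab_act[of "x \<omega>" "\<iota> (m \<omega>)" g] mx\<omega> mI g unfolding stab_def by auto
    show "F \<omega> \<one> = 1" unfolding F_def using mx\<omega> snd1 by simp
    { fix g h assume g: "g \<in> stab \<omega>" and h: "h \<in> stab \<omega>"
      then have G: "g \<in> carrier G" "h \<in> carrier G" unfolding stab_def by auto
      have "inv (x \<omega>) \<otimes> (g \<otimes> h) \<otimes> x \<omega> = (inv (x \<omega>) \<otimes> g \<otimes> x \<omega>) \<otimes> (inv (x \<omega>) \<otimes> h \<otimes> x \<omega>)"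
        using mx\<omega> G by (simp add: m_assoc)
      then show "F \<omega> (g \<otimes> h) = F \<omega> g * F \<omega> h"
        unfolding F_def using sndm[OF _ conj[OF g] conj[OF h]] mx\<omega> by simp }
    fix y g assume y: "y \<in> carrier G" and g: "g \<in> stab \<omega>"
    have gG: "g \<in> carrier G" using g unfolding stab_def by simp
    define k where "k = inv (x \<omega>) \<otimes> g \<otimes> x \<omega>"
    have "F (act (y \<otimes> x \<omega>) (\<iota> (m \<omega>))) ((y \<otimes> x \<omega>) \<otimes> k \<otimes> inv (y \<otimes> x \<omega>)) = snd (m \<omega>) k"
      by (rule F) (use mx\<omega> y conj[OF g] in \<open>auto simp: k_def\<close>)
    moreover have "act (y \<otimes> x \<omega>) (\<iota> (m \<omega>)) = act y \<omega>" using act_mult[OF y _ mI, of "x \<omega>"] mx\<omega> by auto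
    moreover have "(y \<otimes> x \<omega>) \<otimes> k \<otimes> inv (y \<otimes> x \<omega>) = y \<otimes> g \<otimes> inv y"
      unfolding k_def using y gG mx\<omega> by (simp add: inv_mult_group m_assoc)
    ultimately show "F (act y \<omega>) (y \<otimes> g \<otimes> inv y) = F \<omega> g" unfolding F_def k_def by simp
  qed
  have sum: "(\<Sum>\<omega>\<in>{\<omega>\<in>Invs. act g \<omega> = \<omega>}. F \<omega> g) = (\<Sum>\<chi>\<in>Irr G. \<chi> g)" if g: "g \<in> carrier G" for g
  proof -
    have "(\<Sum>\<chi>\<in>Irr G. \<chi> g) = (\<Sum>p\<in>M. \<Sum>\<omega>\<in>{\<omega>\<in>orb (\<iota> p). act g \<omega> = \<omega>}. F \<omega> g)"
      unfolding sumM[OF g, symmetric]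
    proof (rule sum.cong)
      fix p assume p: "p \<in> M"
      show "induced_character G (fst p) (snd p) g = (\<Sum>\<omega>\<in>{\<omega>\<in>orb (\<iota> p). act g \<omega> = \<omega>}. F \<omega> g)"
        unfolding H[OF p]
        by (rule induced_character_as_fixed_points[where F=F and \<psi>="snd p", OF \<iota>(1)[OF p] g F[OF p]])
    qed simp
    also have "\<dots> = (\<Sum>\<omega>\<in>(\<Union>p\<in>M. {\<omega>\<in>orb (\<iota> p). act g \<omega> = \<omega>}). F \<omega> g)"
    proof (rule sum.UNION_disjoint[symmetric])
      show "\<forall>p\<in>M. finite {\<omega> \<in> orb (\<iota> p). act g \<omega> = \<omega>}" unfolding orb_def using fin by simp
    qed (use finM unique in blast)+
    also have "(\<Union>p\<in>M. {\<omega>\<in>orb (\<iota> p). act g \<omega> = \<omega>}) = {\<omega>\<in>Invs. act g \<omega> = \<omega>}"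
    proof (intro Set.set_eqI iffI)
      fix \<omega> assume "\<omega> \<in> {\<omega>\<in>Invs. act g \<omega> = \<omega>}"
      then show "\<omega> \<in> (\<Union>p\<in>M. {\<omega>\<in>orb (\<iota> p). act g \<omega> = \<omega>})" using mx[of \<omega>] unfolding orb_def by auto
    qed (use orb_subset \<iota> in blast)
    finally show ?thesis by simp
  qed
  have deg: "(\<Sum>\<chi>\<in>Irr G. \<chi> \<one>) = of_nat (card (twisted_roots \<one>))"
  proof -
    have "twisted_roots \<one> = Invs" unfolding twisted_roots_def twisted_involutions_def by simp
    moreover have "{\<omega>\<in>Invs. act \<one> \<omega> = \<omega>} = Invs" using act_one Invs_carrier by auto
    moreover have "(\<Sum>\<omega>\<in>Invs. F \<omega> \<one>) = of_nat (card Invs)" using fam unfolding linear_family_def by simp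
    ultimately show ?thesis using sum[OF one_closed] by simp
  qed
  have "(\<Sum>\<omega>\<in>{\<omega>\<in>Invs. act g \<omega> = \<omega>}. F \<omega> g) = of_nat (card (twisted_roots g))" if "g \<in> carrier G" for g
    using sum[OF that] degree_sum_criterion(1)[OF deg that] by simp
  then show ?thesis by (rule that[OF fam _ degree_sum_criterion(2)[OF deg]])
qed

text \<open>The model consists of the characters at one chosen point of each orbit. The twisted root
  count, being a sum of induced characters, has nonnegative multiplicities, so it is the sum of
  the irreducible characters. As a model is a set of characters, different orbits must not yield
  the same character; they do not, because the sum is multiplicity-free.\<close>

theorem generalized_involution_model_exI:
  assumes auto: "\<tau> \<in> auto G" and F: "linear_family F"
    and sum: "\<And>g. g \<in> carrier G \<Longrightarrow>
      (\<Sum>\<omega>\<in>{\<omega>\<in>Invs. act g \<omega> = \<omega>}. F \<omega> g) = of_nat (card (twisted_roots g))"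
    and conj: "\<And>g. g \<in> carrier G \<Longrightarrow> \<exists>h\<in>carrier G. \<tau> g = h \<otimes> inv g \<otimes> inv h"
  shows "\<exists>M. generalized_involution_model G \<tau> M"
proof -
  have F1: "F \<omega> \<one> = 1" and Fm: "\<And>g h. g \<in> stab \<omega> \<Longrightarrow> h \<in> stab \<omega> \<Longrightarrow> F \<omega> (g \<otimes> h) = F \<omega> g * F \<omega> h"
    and Fa: "\<And>x g. x \<in> carrier G \<Longrightarrow> g \<in> stab \<omega> \<Longrightarrow> F (act x \<omega>) (x \<otimes> g \<otimes> inv x) = F \<omega> g"
    if "\<omega> \<in> Invs" for \<omega>
    using F that unfolding linear_family_def by auto
  define rep where "rep C = (SOME \<omega>. \<omega> \<in> C)" for C :: "'a set"
  define Reps where "Reps = rep ` orb ` Invs"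
  have rep: "rep (orb \<omega>) \<in> orb \<omega>" if "\<omega> \<in> Invs" for \<omega>
    unfolding rep_def by (rule someI[of _ \<omega>]) (use orb_refl Invs_carrier that in auto)
  have RI: "\<omega> \<in> Invs" and Rrep: "rep (orb \<omega>) = \<omega>" if "\<omega> \<in> Reps" for \<omega>
  proof -
    obtain \<omega>' where \<omega>': "\<omega>' \<in> Invs" "\<omega> = rep (orb \<omega>')" using \<open>\<omega> \<in> Reps\<close> unfolding Reps_def by auto
    then show "\<omega> \<in> Invs" using rep orb_subset by auto
    show "rep (orb \<omega>) = \<omega>" using orb_eq[OF Invs_carrier rep] \<omega>' by simp
  qed
  define mk where "mk \<omega> = (stab \<omega>, restrict (F \<omega>) (stab \<omega>))" for \<omega>
  define M where "M = mk ` Reps"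
  have finR: "finite Reps" unfolding Reps_def using finite_Invs by simp
  have sumR: "(\<Sum>\<omega>\<in>Reps. f (orb \<omega>)) = (\<Sum>C\<in>orb ` Invs. f C)" for f :: "'a set \<Rightarrow> complex"
  proof (rule sum.reindex_bij_betw)
    show "bij_betw orb Reps (orb ` Invs)"
    proof (rule bij_betw_byWitness[where f'=rep])
      show "\<forall>C\<in>orb ` Invs. orb (rep C) = C" using rep orb_eq Invs_carrier by auto
      show "\<forall>\<omega>\<in>Reps. rep (orb \<omega>) = \<omega>" using Rrep by blast
      show "orb ` Reps \<subseteq> orb ` Invs" using RI by blast
      show "rep ` orb ` Invs \<subseteq> Reps" unfolding Reps_def by simp
    qed
  qed
  have total: "(\<Sum>\<chi>\<in>Irr G. \<chi> g) = of_nat (card (twisted_roots g))" if g: "g \<in> carrier G" for g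
  proof (rule indicator_criterion[OF conj _ g])
    fix \<chi> assume \<chi>: "\<chi> \<in> Irr G"
    have "\<exists>r. \<forall>\<omega>\<in>Invs. (\<Sum>h\<in>stab \<omega>. F \<omega> h * \<chi> (inv h)) = of_nat (r \<omega>)"
    proof (rule bchoice, intro ballI)
      fix \<omega> assume \<omega>: "\<omega> \<in> Invs"
      obtain r where "(\<Sum>h\<in>stab \<omega>. F \<omega> h * \<chi> (inv h)) = of_nat (card (stab \<omega>)) * of_nat r"
        by (rule linear_character_multiplicity[OF stab_subgroup[OF \<omega>] F1[OF \<omega>] Fm[OF \<omega>] \<chi>])
      then have "(\<Sum>h\<in>stab \<omega>. F \<omega> h * \<chi> (inv h)) = of_nat (card (stab \<omega>) * r)" by simp
      then show "\<exists>r. (\<Sum>h\<in>stab \<omega>. F \<omega> h * \<chi> (inv h)) = of_nat r" by blast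
    qed
    then obtain r where r: "\<And>\<omega>. \<omega> \<in> Invs \<Longrightarrow> (\<Sum>h\<in>stab \<omega>. F \<omega> h * \<chi> (inv h)) = of_nat (r \<omega>)" by blast
    have "(\<Sum>g\<in>carrier G. of_nat (card (twisted_roots g)) * \<chi> (inv g)) =
        (\<Sum>g\<in>carrier G. \<Sum>\<omega>\<in>Invs. if act g \<omega> = \<omega> then F \<omega> g * \<chi> (inv g) else 0)"
      using finite_Invs by (intro sum.cong) (auto simp: sum[symmetric] sum_distrib_right sum.If_cases Int_def)
    also have "\<dots> = (\<Sum>\<omega>\<in>Invs. \<Sum>g\<in>carrier G. if act g \<omega> = \<omega> then F \<omega> g * \<chi> (inv g) else 0)"
      by (rule sum.swap)
    also have "\<dots> = (\<Sum>\<omega>\<in>Invs. of_nat (r \<omega>))"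
      by (rule sum.cong) (use fin in \<open>auto simp: r[symmetric] stab_def sum.If_cases Int_def\<close>)
    also have "\<dots> = of_nat (\<Sum>\<omega>\<in>Invs. r \<omega>)" by simp
    finally show "\<exists>r. (\<Sum>g\<in>carrier G. of_nat (card (twisted_roots g)) * \<chi> (inv g)) = of_nat r" by blast
  qed
  have ind: "induced_character G (stab \<omega>) (restrict (F \<omega>) (stab \<omega>)) g =
      (\<Sum>\<omega>'\<in>{\<omega>'\<in>orb \<omega>. act g \<omega>' = \<omega>'}. F \<omega>' g)" if "\<omega> \<in> Invs" "g \<in> carrier G" for \<omega> g
    by (rule induced_character_as_fixed_points[OF that]) (use Fa[OF that(1)] in auto)
  define P where "P C g = (\<Sum>\<omega>\<in>{\<omega>\<in>C. act g \<omega> = \<omega>}. F \<omega> g)" for C g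
  have orb_disj: "C = C'" if "C \<in> orb ` Invs" "C' \<in> orb ` Invs" "\<omega> \<in> C" "\<omega> \<in> C'" for C C' \<omega>
    using orb_eq Invs_carrier that by blast
  have Psum: "(\<Sum>C\<in>orb ` Invs. P C g) = of_nat (card (twisted_roots g))" if g: "g \<in> carrier G" for g
  proof -
    have "(\<Sum>C\<in>orb ` Invs. P C g) = (\<Sum>\<omega>'\<in>(\<Union>C\<in>orb ` Invs. {\<omega>'\<in>C. act g \<omega>' = \<omega>'}). F \<omega>' g)"
      unfolding P_def
    proof (rule sum.UNION_disjoint[symmetric])
      show "\<forall>C\<in>orb ` Invs. finite {\<omega>'\<in>C. act g \<omega>' = \<omega>'}" unfolding orb_def using fin by auto
      show "\<forall>C\<in>orb ` Invs. \<forall>C'\<in>orb ` Invs. C \<noteq> C' \<longrightarrow>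
          {\<omega>'\<in>C. act g \<omega>' = \<omega>'} \<inter> {\<omega>'\<in>C'. act g \<omega>' = \<omega>'} = {}" using orb_disj by blast
    qed (use finite_Invs in simp)
    also have "(\<Union>C\<in>orb ` Invs. {\<omega>'\<in>C. act g \<omega>' = \<omega>'}) = {\<omega>\<in>Invs. act g \<omega> = \<omega>}"
      using orb_subset orb_refl Invs_carrier by blast
    finally show ?thesis using sum[OF g] by simp
  qed
  \<comment> \<open>If two orbits yielded the same character, its multiplicities would be counted twice in the
    sum and hence all be 0, although its degree is the size of the orbit.\<close>
  have injmk: "inj_on mk Reps"
  proof (rule inj_onI, rule ccontr)
    fix \<omega> \<omega>' assume a: "\<omega> \<in> Reps" "\<omega>' \<in> Reps" "mk \<omega> = mk \<omega>'" "\<omega> \<noteq> \<omega>'"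
    have ne: "orb \<omega> \<noteq> orb \<omega>'" using Rrep a by metis
    have Pmk: "P (orb \<omega>) g = induced_character G (fst (mk \<omega>)) (snd (mk \<omega>)) g"
      if "\<omega> \<in> Invs" "g \<in> carrier G" for \<omega> g
      unfolding mk_def fst_conv snd_conv ind[OF that] P_def ..
    have same: "P (orb \<omega>) g = P (orb \<omega>') g" if "g \<in> carrier G" for g
      unfolding Pmk[OF RI[OF a(1)] that] Pmk[OF RI[OF a(2)] that] a(3) ..
    have "\<exists>r. (\<Sum>g\<in>carrier G. P C g * \<chi> (inv g)) = of_nat (card (carrier G)) * of_nat r"
      if C: "C \<in> orb ` Invs" and \<chi>: "\<chi> \<in> Irr G" for C \<chi>
    proof -
      obtain \<omega> where \<omega>: "\<omega> \<in> Invs" "C = orb \<omega>" using C by auto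
      note H = stab_subgroup[OF \<omega>(1)]
      obtain r where r: "(\<Sum>h\<in>stab \<omega>. F \<omega> h * \<chi> (inv h)) = of_nat (card (stab \<omega>)) * of_nat r"
        by (rule linear_character_multiplicity[OF H F1[OF \<omega>(1)] Fm[OF \<omega>(1)] \<chi>])
      have "finite (stab \<omega>)" using finite_subset[OF subgroup.subset[OF H] fin] .
      then have c: "card (stab \<omega>) > 0" using subgroup.one_closed[OF H] card_gt_0_iff by blast
      have "(\<Sum>g\<in>carrier G. P C g * \<chi> (inv g)) =
          (\<Sum>g\<in>carrier G. induced_character G (stab \<omega>) (restrict (F \<omega>) (stab \<omega>)) g * \<chi> (inv g))"
        by (rule sum.cong) (use ind[OF \<omega>(1)] in \<open>auto simp: P_def \<omega>(2)\<close>)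
      also have "\<dots> = of_nat (card (carrier G)) / of_nat (card (stab \<omega>)) *
          (\<Sum>h\<in>stab \<omega>. restrict (F \<omega>) (stab \<omega>) h * \<chi> (inv h))"
        by (rule frobenius_reciprocity[OF H Irr_class_function[OF \<chi>]])
      also have "\<dots> = of_nat (card (carrier G)) * of_nat r" using r c by simp
      finally show ?thesis by blast
    qed
    then obtain r where r: "\<And>C \<chi>. C \<in> orb ` Invs \<Longrightarrow> \<chi> \<in> Irr G \<Longrightarrow>
        (\<Sum>g\<in>carrier G. P C g * \<chi> (inv g)) = of_nat (card (carrier G)) * of_nat (r C \<chi>)"
      by metis
    have r0: "r (orb \<omega>) \<chi> = 0" if \<chi>: "\<chi> \<in> Irr G" for \<chi>
    proof -
      have "of_nat (card (carrier G)) * of_nat (\<Sum>C\<in>orb ` Invs. r C \<chi>) =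
          (\<Sum>C\<in>orb ` Invs. \<Sum>g\<in>carrier G. P C g * \<chi> (inv g))"
        by (simp add: sum_distrib_left r[OF _ \<chi>])
      also have "\<dots> = (\<Sum>g\<in>carrier G. \<Sum>C\<in>orb ` Invs. P C g * \<chi> (inv g))" by (rule sum.swap)
      also have "\<dots> = (\<Sum>g\<in>carrier G. \<Sum>\<psi>\<in>Irr G. \<psi> g * \<chi> (inv g))"
        by (rule sum.cong) (simp_all add: sum_distrib_right[symmetric] Psum total)
      also have "\<dots> = (\<Sum>\<psi>\<in>Irr G. \<Sum>g\<in>carrier G. \<psi> g * \<chi> (inv g))" by (rule sum.swap)
      also have "\<dots> = of_nat (card (carrier G))" using finite_Irr \<chi> by (simp add: Irr_orthogonality)
      finally have "complex_of_nat (\<Sum>C\<in>orb ` Invs. r C \<chi>) = of_nat 1" using card_pos by simp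
      then have one: "(\<Sum>C\<in>orb ` Invs. r C \<chi>) = 1" by (simp only: of_nat_eq_iff)
      have "(\<Sum>C\<in>{orb \<omega>, orb \<omega>'}. r C \<chi>) \<le> (\<Sum>C\<in>orb ` Invs. r C \<chi>)"
        by (rule sum_mono2) (use finite_Invs RI a in auto)
      then have "r (orb \<omega>) \<chi> + r (orb \<omega>') \<chi> \<le> 1" using ne one by simp
      moreover have "of_nat (card (carrier G)) * complex_of_nat (r (orb \<omega>) \<chi>) =
          of_nat (card (carrier G)) * of_nat (r (orb \<omega>') \<chi>)"
      proof -
        have "(\<Sum>g\<in>carrier G. P (orb \<omega>) g * \<chi> (inv g)) = (\<Sum>g\<in>carrier G. P (orb \<omega>') g * \<chi> (inv g))"
          by (rule sum.cong) (simp_all add: same)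
        then show ?thesis unfolding r[OF imageI[OF RI[OF a(1)]] \<chi>] r[OF imageI[OF RI[OF a(2)]] \<chi>] .
      qed
      then have "r (orb \<omega>) \<chi> = r (orb \<omega>') \<chi>" using card_pos by simp
      ultimately show ?thesis by simp
    qed
    \<comment> \<open>A combination of the irreducible characters that picks out the value at the identity.\<close>
    define \<delta> where "\<delta> g = (if g = \<one> then 1 else 0 :: complex)" for g
    have "class_function \<delta>"
      unfolding class_function_def \<delta>_def
    proof (intro ballI)
      fix g h assume g: "g \<in> carrier G" and h: "h \<in> carrier G"
      have "g = inv h \<otimes> (h \<otimes> g \<otimes> inv h) \<otimes> h" using g h by (simp add: m_assoc)
      then have "h \<otimes> g \<otimes> inv h = \<one> \<longleftrightarrow> g = \<one>" using g h by (metis l_inv r_inv r_one inv_closed)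
      then show "(if h \<otimes> g \<otimes> inv h = \<one> then 1 else 0) = (if g = \<one> then 1 else (0::complex))" by simp
    qed
    from class_function_expansion[OF this]
    have reg: "\<delta> g = (\<Sum>\<chi>\<in>Irr G. \<chi> \<one> / of_nat (card (carrier G)) * \<chi> g)" if "g \<in> carrier G" for g
      using that fin by (simp add: \<delta>_def if_distrib[of "\<lambda>x. x * _"] cong: if_cong)
    have "P (orb \<omega>) \<one> = (\<Sum>g\<in>carrier G. P (orb \<omega>) g * \<delta> (inv g))"
      using fin by (simp add: \<delta>_def if_distrib[of "(*) _"] inv_eq_1_iff cong: if_cong)
    also have "\<dots> = (\<Sum>g\<in>carrier G. \<Sum>\<chi>\<in>Irr G. \<chi> \<one> / of_nat (card (carrier G)) * (P (orb \<omega>) g * \<chi> (inv g)))"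
      by (rule sum.cong) (simp_all add: reg sum_distrib_left mult_ac)
    also have "\<dots> = (\<Sum>\<chi>\<in>Irr G. \<Sum>g\<in>carrier G. \<chi> \<one> / of_nat (card (carrier G)) * (P (orb \<omega>) g * \<chi> (inv g)))"
      by (rule sum.swap)
    also have "\<dots> = 0"
    proof (rule sum.neutral, rule ballI)
      fix \<chi> assume \<chi>: "\<chi> \<in> Irr G"
      have "(\<Sum>g\<in>carrier G. P (orb \<omega>) g * \<chi> (inv g)) = 0"
        using r[of "orb \<omega>" \<chi>] r0[OF \<chi>] RI[OF a(1)] \<chi> by simp
      then show "(\<Sum>g\<in>carrier G. \<chi> \<one> / of_nat (card (carrier G)) * (P (orb \<omega>) g * \<chi> (inv g))) = 0"
        by (simp only: sum_distrib_left[symmetric] mult_zero_right)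
    qed
    finally have "P (orb \<omega>) \<one> = 0" .
    moreover have "P (orb \<omega>) \<one> = of_nat (card (orb \<omega>))"
    proof -
      have "{\<omega>'\<in>orb \<omega>. act \<one> \<omega>' = \<omega>'} = orb \<omega>"
        using act_one orb_subset[OF RI[OF a(1)]] Invs_carrier by auto
      then show ?thesis unfolding P_def using F1 orb_subset[OF RI[OF a(1)]] by (simp add: subset_iff)
    qed
    moreover have "card (orb \<omega>) \<noteq> 0"
      using orb_refl[OF Invs_carrier[OF RI[OF a(1)]]] fin unfolding orb_def by (auto simp: card_eq_0_iff)
    ultimately show False by simp
  qed
  define \<iota> where "\<iota> = inv_into Reps mk"
  have \<iota>mk: "\<iota> (mk \<omega>) = \<omega>" if "\<omega> \<in> Reps" for \<omega> unfolding \<iota>_def using injmk that by simp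
  have \<iota>M: "\<iota> ` M = Reps" unfolding M_def using \<iota>mk by (auto simp: image_iff)
  have "model G M"
    unfolding model_def
  proof (intro conjI ballI)
    show "finite M" unfolding M_def using finR by simp
  next
    fix p assume "p \<in> M"
    then obtain \<omega> where \<omega>: "\<omega> \<in> Reps" "p = mk \<omega>" unfolding M_def by auto
    have sub: "subgroup (stab \<omega>) G" by (rule stab_subgroup[OF RI[OF \<omega>(1)]])
    have "restrict (F \<omega>) (carrier (G\<lparr>carrier := stab \<omega>\<rparr>)) \<in> linear_characters (G\<lparr>carrier := stab \<omega>\<rparr>)"
      by (rule linear_charactersI[OF subgroup.subgroup_is_group[OF sub is_group]])
        (use F1 Fm RI[OF \<omega>(1)] in auto)
    then show "case p of (H, \<psi>) \<Rightarrow> subgroup H G \<and> \<psi> \<in> linear_characters (G\<lparr>carrier := H\<rparr>)"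
      using sub unfolding \<omega>(2) mk_def by simp
  next
    fix g assume g: "g \<in> carrier G"
    have "(\<Sum>(H, \<psi>)\<in>M. induced_character G H \<psi> g) = (\<Sum>\<omega>\<in>Reps. P (orb \<omega>) g)"
      unfolding M_def sum.reindex[OF injmk] by (rule sum.cong) (use ind RI g in \<open>auto simp: mk_def P_def\<close>)
    also have "\<dots> = (\<Sum>C\<in>orb ` Invs. P C g)" by (rule sumR)
    finally show "(\<Sum>(H, \<psi>)\<in>M. induced_character G H \<psi> g) = (\<Sum>\<chi>\<in>Irr G. \<chi> g)"
      using Psum[OF g] total[OF g] by simp
  qed
  moreover have "inj_on \<iota> M" unfolding \<iota>_def by (rule inj_on_inv_into) (simp add: M_def)
  moreover have "\<iota> ` M \<subseteq> Invs" using \<iota>M RI by auto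
  moreover have "\<forall>(H, \<psi>)\<in>M. H = twisted_centralizer G \<tau> (\<iota> (H, \<psi>))"
  proof
    fix p assume "p \<in> M"
    then obtain \<omega> where \<omega>: "\<omega> \<in> Reps" "p = mk \<omega>" unfolding M_def by auto
    then have "twisted_centralizer G \<tau> (\<iota> p) = stab \<omega>"
      using \<iota>mk twisted_centralizer_eq RI by simp
    then show "case p of (H, \<psi>) \<Rightarrow> H = twisted_centralizer G \<tau> (\<iota> (H, \<psi>))" unfolding \<omega>(2) mk_def by simp
  qed
  moreover have "\<forall>C \<in> orbits G Invs (twisted_conj G \<tau>). \<exists>!\<omega>. \<omega> \<in> \<iota> ` M \<and> \<omega> \<in> C"
    unfolding orbits_eq \<iota>M
  proof
    fix C assume "C \<in> orb ` Invs"
    then obtain \<omega> where \<omega>: "\<omega> \<in> Invs" "C = orb \<omega>" by auto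
    show "\<exists>!\<omega>. \<omega> \<in> Reps \<and> \<omega> \<in> C"
    proof (rule ex1I[of _ "rep C"])
      show "rep C \<in> Reps \<and> rep C \<in> C" using rep \<omega> unfolding Reps_def by auto
      fix \<omega>' assume "\<omega>' \<in> Reps \<and> \<omega>' \<in> C"
      then show "\<omega>' = rep C" using Rrep[of \<omega>'] orb_eq[OF Invs_carrier[OF \<omega>(1)], of \<omega>'] \<omega>(2) by simp
    qed
  qed
  ultimately have "generalized_involution_model G \<tau> M"
    unfolding generalized_involution_model_def using auto tau_tau by blast
  then show ?thesis by blast
qed

end

section \<open>Enumerating permutations that satisfy equations\<close>

text \<open>For evaluation, a permutation of \<open>{1..n}\<close> is represented by the list of its arguments and
  values, starting with the argument \<open>n\<close>. The value 0 of the two lookup functions below means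
  that there is no entry; it is not a point.\<close>

fun images :: "nat \<Rightarrow> (nat \<Rightarrow> nat) \<Rightarrow> (nat \<times> nat) list" where
  "images 0 p = []"
| "images (Suc k) p = (Suc k, p (Suc k)) # images k p"

fun get :: "(nat \<times> nat) list \<Rightarrow> nat \<Rightarrow> nat" where
  "get [] i = 0"
| "get ((j, v) # ps) i = (if i = j then v else get ps i)"

fun rget :: "(nat \<times> nat) list \<Rightarrow> nat \<Rightarrow> nat" where
  "rget [] v = 0"
| "rget ((j, u) # ps) v = (if v = u then j else rget ps v)"

lemma get_images: "get (images k p) i = (if i \<in> {1..k} then p i else 0)"
  by (induction k) auto

lemma rget_images: "inj_on p {1..k} \<Longrightarrow> i \<in> {1..k} \<Longrightarrow> rget (images k p) (p i) = i"
proof (induction k)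
  case (Suc k)
  have "p i \<noteq> p (Suc k)" if "i \<noteq> Suc k" using inj_onD[OF Suc.prems(1), of i "Suc k"] Suc.prems(2) that by auto
  moreover have "inj_on p {1..k}" by (rule inj_on_subset[OF Suc.prems(1)]) auto
  ultimately show ?case using Suc.IH Suc.prems(2) by (cases "i = Suc k") auto
qed simp

lemma rget_nonzero: "rget (images k p) v \<noteq> 0 \<Longrightarrow> rget (images k p) v \<in> {1..k} \<and> p (rget (images k p) v) = v"
  by (induction k) (auto split: if_splits)

lemma images_cong: "(\<And>i. i \<in> {1..k} \<Longrightarrow> p i = q i) \<Longrightarrow> images k p = images k q"
  by (induction k) auto

lemma set_images: "set (images k p) = (\<lambda>i. (i, p i)) ` {1..k}"
  by (induction k) (auto simp: atLeastAtMostSuc_conv)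

text \<open>Injective maps are built up one argument at a time. The predicate is tested on every
  initial segment, which prunes the search.\<close>

fun enum :: "((nat \<times> nat) list \<Rightarrow> bool) \<Rightarrow> nat \<Rightarrow> nat \<Rightarrow> (nat \<times> nat) list list" where
  "enum P n 0 = [[]]"
| "enum P n (Suc k) = concat (map (\<lambda>ps. filter P (map (\<lambda>v. (Suc k, v) # ps)
      (filter (\<lambda>v. \<not> list_ex (\<lambda>(_, u). u = v) ps) [1..<Suc n]))) (enum P n k))"

lemma set_enum:
  "set (enum P n k) = images k ` {p. inj_on p {1..k} \<and> p ` {1..k} \<subseteq> {1..n} \<and> (\<forall>j\<in>{1..k}. P (images j p))}"
proof (induction k)
  case (Suc k)
  let ?S = "\<lambda>k. {p. inj_on p {1..k} \<and> p ` {1..k} \<subseteq> {1..n} \<and> (\<forall>j\<in>{1..k}. P (images j p))}"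
  have mem: "xs \<in> set (enum P n (Suc k)) \<longleftrightarrow>
      (\<exists>ps\<in>set (enum P n k). \<exists>v. v \<in> {1..n} \<and> (\<forall>(j, u)\<in>set ps. u \<noteq> v) \<and> xs = (Suc k, v) # ps \<and> P xs)" for xs
    unfolding enum.simps
    by (simp del: upt_Suc add: image_iff less_Suc_eq_le list_ex_iff case_prod_beta) blast
  show ?case
  proof (rule Set.set_eqI)
    fix xs
    show "xs \<in> set (enum P n (Suc k)) \<longleftrightarrow> xs \<in> images (Suc k) ` ?S (Suc k)"
    proof
      assume "xs \<in> set (enum P n (Suc k))"
      then obtain p v where p: "p \<in> ?S k" and v: "v \<in> {1..n}" "\<forall>(j, u)\<in>set (images k p). u \<noteq> v"
        and xs: "xs = (Suc k, v) # images k p" "P xs"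
        unfolding mem Suc.IH by blast
      define p' where "p' = p(Suc k := v)"
      have eq: "images j p' = images j p" if "j \<le> k" for j
        by (rule images_cong) (use that in \<open>auto simp: p'_def\<close>)
      have "images (Suc k) p' = xs" using eq[of k] xs by (simp add: p'_def)
      moreover have "p' \<in> ?S (Suc k)"
      proof -
        have "p' i = p i" if "i \<in> {1..k}" for i using that by (simp add: p'_def)
        then have "inj_on p' {1..k}" using p inj_on_cong[of "{1..k}" p' p] by simp
        moreover have "p' (Suc k) \<notin> p' ` {1..k}"
          using v(2) by (auto simp: p'_def set_images)
        ultimately have "inj_on p' {1..Suc k}" by (simp add: atLeastAtMostSuc_conv)
        moreover have "p' ` {1..Suc k} \<subseteq> {1..n}" using p v(1) by (auto simp: p'_def le_Suc_eq)
        moreover have "P (images j p')" if "j \<in> {1..Suc k}" for j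
          using that p xs \<open>images (Suc k) p' = xs\<close> eq[of j] by (cases "j = Suc k") auto
        ultimately show ?thesis by simp
      qed
      ultimately show "xs \<in> images (Suc k) ` ?S (Suc k)" by blast
    next
      assume "xs \<in> images (Suc k) ` ?S (Suc k)"
      then obtain p where p: "p \<in> ?S (Suc k)" "xs = images (Suc k) p" by blast
      have "p \<in> ?S k" using p(1) by (auto simp: inj_on_def)
      then have 1: "images k p \<in> set (enum P n k)" unfolding Suc.IH by (rule imageI)
      have "p ` {1..Suc k} \<subseteq> {1..n}" using p(1) by blast
      then have 2: "p (Suc k) \<in> {1..n}" by (rule subsetD) (rule imageI, simp)
      have 3: "\<forall>(j, u)\<in>set (images k p). u \<noteq> p (Suc k)"
        using p(1) by (fastforce simp: set_images inj_on_def)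
      have "P (images (Suc k) p)" using p(1) by (simp del: images.simps)
      then have 4: "P xs" unfolding p(2) .
      show "xs \<in> set (enum P n (Suc k))" unfolding mem
        by (intro bexI[OF _ 1] exI[of _ "p (Suc k)"] conjI 2 3 4) (simp add: p(2))
    qed
  qed
qed auto

lemma distinct_concat_map:
  assumes "distinct xs" "\<And>x. x \<in> set xs \<Longrightarrow> distinct (f x)"
    and "\<And>x y. x \<in> set xs \<Longrightarrow> y \<in> set xs \<Longrightarrow> x \<noteq> y \<Longrightarrow> set (f x) \<inter> set (f y) = {}"
  shows "distinct (concat (map f xs))"
  using assms
proof (induction xs)
  case (Cons x xs)
  have "set (f x) \<inter> set (concat (map f xs)) = {}" using Cons.prems(1) Cons.prems(3)[of x] by fastforce
  moreover have "distinct (concat (map f xs))" using Cons by auto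
  ultimately show ?case using Cons.prems(2) by simp
qed simp

lemma distinct_enum: "distinct (enum P n k)"
proof (induction k)
  case (Suc k)
  show ?case unfolding enum.simps
    by (rule distinct_concat_map[OF Suc]) (auto simp: distinct_map inj_on_def simp del: upt_Suc intro!: distinct_filter)
qed simp

lemma enum_permutations:
  assumes "\<And>p. p permutes {1..n} \<Longrightarrow> Q p \<longleftrightarrow> (\<forall>k\<in>{1..n}. P (images k p))"
  shows "bij_betw (images n) {p. p permutes {1..n} \<and> Q p} (set (enum P n n))"
proof -
  have inj: "inj_on (images n) {p. p permutes {1..n} \<and> Q p}"
  proof (rule inj_onI)
    fix p q assume p: "p \<in> {p. p permutes {1..n} \<and> Q p}" and q: "q \<in> {p. p permutes {1..n} \<and> Q p}"
      and eq: "images n p = images n q"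
    show "p = q"
    proof
      fix i
      show "p i = q i"
        using arg_cong[OF eq, of "\<lambda>ps. get ps i"] p q permutes_not_in[of p "{1..n}" i] permutes_not_in[of q "{1..n}" i]
        by (cases "i \<in> {1..n}") (auto simp: get_images)
    qed
  qed
  have "images n ` {p. p permutes {1..n} \<and> Q p} = set (enum P n n)"
  proof (intro equalityI subsetI)
    fix xs assume "xs \<in> images n ` {p. p permutes {1..n} \<and> Q p}"
    then obtain p where p: "p permutes {1..n}" "Q p" "xs = images n p" by auto
    then have "inj_on p {1..n} \<and> p ` {1..n} \<subseteq> {1..n} \<and> (\<forall>j\<in>{1..n}. P (images j p))"
      using assms permutes_inj_on[OF p(1)] permutes_image[OF p(1)] by auto
    then show "xs \<in> set (enum P n n)" unfolding set_enum p(3) by blast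
  next
    fix xs assume "xs \<in> set (enum P n n)"
    then obtain p where p: "inj_on p {1..n}" "p ` {1..n} \<subseteq> {1..n}" "\<forall>j\<in>{1..n}. P (images j p)"
      and xs: "xs = images n p" unfolding set_enum by blast
    define p' where "p' i = (if i \<in> {1..n} then p i else i)" for i
    have "bij_betw p {1..n} {1..n}" using p by (simp add: bij_betw_def endo_inj_surj)
    then have "bij_betw p' {1..n} {1..n}" by (rule iffD2[OF bij_betw_cong, rotated]) (simp add: p'_def)
    then have perm: "p' permutes {1..n}" by (rule bij_imp_permutes) (auto simp: p'_def)
    have eq: "images j p' = images j p" if "j \<le> n" for j
      by (rule images_cong) (use that in \<open>auto simp: p'_def\<close>)
    have "\<forall>k\<in>{1..n}. P (images k p')" using p(3) eq by simp
    then have "Q p'" using assms[OF perm] by simp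
    then show "xs \<in> images n ` {p. p permutes {1..n} \<and> Q p}" using perm eq[of n] xs by (intro rev_image_eqI[of p']) auto
  qed
  then show ?thesis using inj by (simp add: bij_betw_def)
qed

lemma sum_enum:
  assumes "\<And>p. p permutes {1..n} \<Longrightarrow> Q p \<longleftrightarrow> (\<forall>k\<in>{1..n}. P (images k p))"
  shows "(\<Sum>p | p permutes {1..n} \<and> Q p. f (images n p)) = sum_list (map f (enum P n n))"
proof -
  have "(\<Sum>p | p permutes {1..n} \<and> Q p. f (images n p)) = (\<Sum>xs\<in>set (enum P n n). f xs)"
    by (rule sum.reindex_bij_betw[OF enum_permutations[OF assms]])
  then show ?thesis using distinct_enum by (simp add: sum_list_distinct_conv_sum_set)
qed

text \<open>Composition with the transposition of the largest point and its image yields a permutation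
  of the remaining points.\<close>

function even_list :: "(nat \<times> nat) list \<Rightarrow> bool" where
  "even_list [] = True"
| "even_list ((m, v) # ps) = (if v = m then even_list ps
     else \<not> even_list (map (\<lambda>(j, u). (j, if u = m then v else u)) ps))"
  by pat_completeness auto
termination by (relation "measure length") auto

lemma even_list_images: "p permutes {1..n} \<Longrightarrow> even_list (images n p) \<longleftrightarrow> evenperm p"
proof (induction n arbitrary: p)
  case (Suc n)
  let ?m = "Suc n" let ?v = "p (Suc n)"
  have ins: "{1..Suc n} = insert (Suc n) {1..n}" by auto
  define p' where "p' = Transposition.transpose ?v ?m \<circ> p"
  have p': "p' permutes {1..n}"
    using permutes_insert_lemma[of p "Suc n" "{1..n}"] Suc.prems unfolding ins p'_def by (simp add: transpose_commute)
  have pp: "permutation p" using Suc.prems permutation_permutes by blast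
  have "map (\<lambda>(j, u). (j, if u = ?m then ?v else u)) (images k p) = images k p'" if "k \<le> n" for k
    using that
  proof (induction k)
    case (Suc k)
    have "p (Suc k) \<noteq> p (Suc n)" using Suc.prems permutes_inj[OF \<open>p permutes {1..Suc n}\<close>]
      by (auto simp: inj_eq)
    then show ?case using Suc by (auto simp: p'_def transpose_def)
  qed simp
  note map_eq = this[OF order_refl]
  show ?case
  proof (cases "?v = ?m")
    case True
    then have "p' = p" by (simp add: p'_def)
    then show ?thesis using Suc.IH[OF p'] True by simp
  next
    case False
    have "evenperm p' \<longleftrightarrow> \<not> evenperm p"
      unfolding p'_def using False pp by (simp add: evenperm_comp permutation_swap_id evenperm_swap)
    then show ?thesis using Suc.IH[OF p'] False map_eq by simp
  qed
qed simp

text \<open>A search for the permutations \<open>p\<close> with \<open>p \<circ> q = r \<circ> p\<close> and \<open>p \<circ> p = t\<close>: square roots,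
  commuting involutions and inverting involutions are of this form. The four tests are the
  instances of the two equations that involve the newest argument \<open>m\<close> and otherwise only
  arguments with known values. They are nested conditionals instead of a conjunction so that
  evaluation by rewriting stops at the first failure.\<close>

fun extends_ok :: "(nat \<times> nat) list \<Rightarrow> (nat \<times> nat) list \<Rightarrow> (nat \<times> nat) list \<Rightarrow> (nat \<times> nat) list \<Rightarrow> bool" where
  "extends_ok q r t [] = True"
| "extends_ok q r t ((m, v) # ps) =
    (if (let u = get ps (rget q m) in u = 0 \<or> v = get r u)
     then if (let j = rget ps m in j = 0 \<or> v = get t j)
     then if (let w = get ((m, v) # ps) v in w = 0 \<or> w = get t m)
     then let w = get ((m, v) # ps) (get q m) in w = 0 \<or> w = get r v
     else False else False else False)"

lemma extends_ok_iff:
  assumes p: "p permutes {1..n}" and q: "q permutes {1..n}" and r: "r permutes {1..n}" and t: "t permutes {1..n}"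
  shows "p \<circ> q = r \<circ> p \<and> p \<circ> p = t \<longleftrightarrow>
    (\<forall>k\<in>{1..n}. extends_ok (images n q) (images n r) (images n t) (images k p))"
proof
  have in_n: "f i \<in> {1..n} \<longleftrightarrow> i \<in> {1..n}" if "f permutes {1..n}" for f i
    using permutes_in_image[OF that] by blast
  note inn = in_n[OF p] in_n[OF q] in_n[OF r] in_n[OF t]
  have rq: "rget (images n q) (q i) = i" if "i \<in> {1..n}" for i
    by (rule rget_images[OF permutes_inj_on[OF q] that])
  have rp: "rget (images k p) (p i) = i" if "i \<in> {1..k}" for i k
    by (rule rget_images[OF permutes_inj_on[OF p] that])
  {
    assume "p \<circ> q = r \<circ> p \<and> p \<circ> p = t"
    then have 1: "p (q i) = r (p i)" "p (p i) = t i" for i by (auto simp: fun_eq_iff)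
    show "\<forall>k\<in>{1..n}. extends_ok (images n q) (images n r) (images n t) (images k p)"
    proof
      fix k assume k: "k \<in> {1..n}"
      then obtain l where l: "k = Suc l" by (cases k) auto
      obtain i where i: "i \<in> {1..n}" "q i = k" using k permutes_image[OF q] by (metis imageE)
      have a: "let u = get (images l p) (rget (images n q) k) in u = 0 \<or> p k = get (images n r) u"
        using rq[OF i(1)] i 1(1)[of i] inn(1)[of i] by (auto simp: get_images Let_def)
      have b: "let j = rget (images l p) k in j = 0 \<or> p k = get (images n t) j"
        using rget_nonzero[of l p k] k l 1(2)[of "rget (images l p) k"] by (auto simp: get_images Let_def)
      have c: "let w = get (images k p) (p k) in w = 0 \<or> w = get (images n t) k"
        using k 1(2)[of k] by (auto simp: get_images Let_def)
      have d: "let w = get (images k p) (get (images n q) k) in w = 0 \<or> w = get (images n r) (p k)"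
        using k 1(1)[of k] inn(1)[of k] by (auto simp: get_images Let_def)
      show "extends_ok (images n q) (images n r) (images n t) (images k p)"
        using a b c d unfolding l images.simps extends_ok.simps by (simp only: if_True)
    qed
  }
  assume a: "\<forall>k\<in>{1..n}. extends_ok (images n q) (images n r) (images n t) (images k p)"
  have ok: "(let u = get (images (k - 1) p) (rget (images n q) k) in u = 0 \<or> p k = get (images n r) u) \<and>
      (let j = rget (images (k - 1) p) k in j = 0 \<or> p k = get (images n t) j) \<and>
      (let w = get (images k p) (p k) in w = 0 \<or> w = get (images n t) k) \<and>
      (let w = get (images k p) (get (images n q) k) in w = 0 \<or> w = get (images n r) (p k))"
    if k: "k \<in> {1..n}" for k
  proof -
    obtain l where l: "k = Suc l" using k by (cases k) auto
    have ifs: "(if A then if B then if C then D else False else False else False) \<longleftrightarrow> A \<and> B \<and> C \<and> D" for A B C D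
      by simp
    show ?thesis using bspec[OF a k] unfolding l images.simps extends_ok.simps diff_Suc_1 ifs .
  qed
  have pos: "f i \<noteq> 0" if "f permutes {1..n}" "i \<in> {1..n}" for f i using in_n[OF that(1), of i] that(2) by auto
  have gn: "get (images k f) i = f i" if "i \<in> {1..k}" for k f i using that by (simp add: get_images)
  have pq: "p (q i) = r (p i)" if i: "i \<in> {1..n}" for i
  proof (cases "q i \<le> i")
    case True
    have qi: "q i \<in> {1..n}" and pi: "p i \<in> {1..n}" using inn i by blast+
    have "get (images i p) (q i) = p (q i)" by (rule gn) (use True qi in auto)
    then show ?thesis using ok[OF i] pos[OF p qi] unfolding gn[OF i] gn[OF pi] Let_def by auto
  next
    case False
    have qi: "q i \<in> {1..n}" and pi: "p i \<in> {1..n}" using inn i by blast+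
    have "get (images (q i - 1) p) i = p i" by (rule gn) (use False i in auto)
    then show ?thesis using ok[OF qi] pos[OF p i] unfolding rq[OF i] Let_def by (auto simp: gn[OF pi])
  qed
  have pp: "p (p i) = t i" if i: "i \<in> {1..n}" for i
  proof (cases "p i \<le> i")
    case True
    have pi: "p i \<in> {1..n}" using inn i by blast
    have "get (images i p) (p i) = p (p i)" by (rule gn) (use True pi in auto)
    then show ?thesis using ok[OF i] pos[OF p pi] unfolding gn[OF i] Let_def by auto
  next
    case False
    have pi: "p i \<in> {1..n}" using inn(1) i by blast
    have "rget (images (p i - 1) p) (p i) = i" by (rule rp) (use False i in auto)
    then show ?thesis using ok[OF pi] i unfolding Let_def by (auto simp: gn[OF i])
  qed
  have "p (q i) = r (p i) \<and> p (p i) = t i" for i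
    using pq pp permutes_not_in[OF p, of i] permutes_not_in[OF q, of i] permutes_not_in[OF r, of i]
      permutes_not_in[OF t, of i] by (cases "i \<in> {1..n}") auto
  then show "p \<circ> q = r \<circ> p \<and> p \<circ> p = t" by (auto simp: fun_eq_iff)
qed

definition solutions :: "nat \<Rightarrow> (nat \<times> nat) list \<Rightarrow> (nat \<times> nat) list \<Rightarrow> (nat \<times> nat) list \<Rightarrow> (nat \<times> nat) list list" where
  "solutions n q r t = enum (extends_ok q r t) n n"

lemma sum_solutions:
  assumes "q permutes {1..n}" "r permutes {1..n}" "t permutes {1..n}"
  shows "(\<Sum>p | p permutes {1..n} \<and> p \<circ> q = r \<circ> p \<and> p \<circ> p = t. f (images n p)) =
    sum_list (map f (solutions n (images n q) (images n r) (images n t)))"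
  unfolding solutions_def by (rule sum_enum, rule extends_ok_iff) (use assms in auto)

lemma set_solutions:
  assumes "q permutes {1..n}" "r permutes {1..n}" "t permutes {1..n}"
  shows "set (solutions n (images n q) (images n r) (images n t)) =
    images n ` {p. p permutes {1..n} \<and> p \<circ> q = r \<circ> p \<and> p \<circ> p = t}"
proof -
  have "bij_betw (images n) {p. p permutes {1..n} \<and> p \<circ> q = r \<circ> p \<and> p \<circ> p = t}
      (set (enum (extends_ok (images n q) (images n r) (images n t)) n n))"
    by (rule enum_permutations, rule extends_ok_iff) (use assms in auto)
  then show ?thesis unfolding solutions_def bij_betw_def by simp
qed

text \<open>Permutations in which every cycle runs through consecutive numbers satisfy this condition,
  so the conjugacy class of every permutation is represented.\<close>

definition canonical :: "nat \<Rightarrow> (nat \<times> nat) list list" where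
  "canonical n = enum (\<lambda>ps. snd (hd ps) \<le> Suc (fst (hd ps))) n n"

fun inverse_list :: "nat \<Rightarrow> (nat \<times> nat) list \<Rightarrow> (nat \<times> nat) list" where
  "inverse_list 0 ps = []"
| "inverse_list (Suc k) ps = (Suc k, rget ps (Suc k)) # inverse_list k ps"

text \<open>For \<open>n \<le> 7\<close> there are at most three 2-cycles, and a permutation of three objects is odd
  iff it moves exactly two of them, that is, here, the four points of two 2-cycles.\<close>

definition pair_sign :: "(nat \<times> nat) list \<Rightarrow> (nat \<times> nat) list \<Rightarrow> int" where
  "pair_sign z q = (if length (filter (\<lambda>(i, zi). zi \<noteq> i \<and> (let g = get q i in g \<noteq> i \<and> g \<noteq> zi)) z) = 4 then -1 else 1)"

text \<open>The sum of the signs over the commuting involutions of parity \<open>b\<close> equals the number of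
  square roots of parity \<open>b\<close>, and a permutation of parity \<open>b\<close> inverts \<open>q\<close>. The latter is sought
  among involutions, for which the search is short.\<close>

definition model_check :: "nat \<Rightarrow> bool \<Rightarrow> bool" where
  "model_check n b \<longleftrightarrow> list_all (\<lambda>q. if even_list q then
     sum_list (map (\<lambda>z. if even_list z = b then pair_sign z q else 0) (solutions n q q (images n id))) =
     sum_list (map (\<lambda>y. if even_list y = b then 1 else 0 :: int) (solutions n q q q)) \<and>
     list_ex (\<lambda>y. even_list y = b) (solutions n q (inverse_list n q) (images n id))
     else True) (canonical n)"

section \<open>Conjugation of permutations\<close>

lemma permutes_conj:
  assumes "x permutes S" "p permutes S"
  shows "(x \<circ> p \<circ> inv' x) permutes S"
  using assms by (intro permutes_compose permutes_inv)

lemma conj_apply: "x permutes S \<Longrightarrow> (x \<circ> p \<circ> inv' x) (x i) = x (p i)"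
  by (simp add: permutes_inverses)

lemma evenperm_conj:
  assumes "permutation x" "permutation p"
  shows "evenperm (x \<circ> p \<circ> inv' x) \<longleftrightarrow> evenperm p"
  using assms by (auto simp: evenperm_comp evenperm_inv permutation_inverse permutation_compose)

lemma conj_comp: "x permutes S \<Longrightarrow> (x \<circ> p \<circ> inv' x) \<circ> (x \<circ> q \<circ> inv' x) = x \<circ> (p \<circ> q) \<circ> inv' x"
  by (auto simp: fun_eq_iff permutes_inverses)

lemma conj_commute_iff:
  assumes "x permutes S"
  shows "(x \<circ> p \<circ> inv' x) \<circ> (x \<circ> q \<circ> inv' x) = (x \<circ> q \<circ> inv' x) \<circ> (x \<circ> p \<circ> inv' x) \<longleftrightarrow> p \<circ> q = q \<circ> p"
proof
  assume a: "(x \<circ> p \<circ> inv' x) \<circ> (x \<circ> q \<circ> inv' x) = (x \<circ> q \<circ> inv' x) \<circ> (x \<circ> p \<circ> inv' x)"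
  show "p \<circ> q = q \<circ> p"
  proof
    fix i
    have "x (p (q i)) = x (q (p i))"
      using fun_cong[OF a, of "x i"] by (simp add: permutes_inverses[OF assms])
    then show "(p \<circ> q) i = (q \<circ> p) i" using permutes_inj[OF assms] by (simp add: inj_eq)
  qed
qed (simp add: conj_comp[OF assms])

lemma bij_betw_conj:
  assumes x: "x permutes S"
    and P: "\<And>p. p permutes S \<Longrightarrow> P p \<longleftrightarrow> Q (x \<circ> p \<circ> inv' x)"
  shows "bij_betw (\<lambda>p. x \<circ> p \<circ> inv' x) {p. p permutes S \<and> P p} {p. p permutes S \<and> Q p}"
proof (rule bij_betw_byWitness[where f'="\<lambda>p. inv' x \<circ> p \<circ> x"])
  show "(\<lambda>p. inv' x \<circ> p \<circ> x) ` {p. p permutes S \<and> Q p} \<subseteq> {p. p permutes S \<and> P p}"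
  proof
    fix q assume "q \<in> (\<lambda>p. inv' x \<circ> p \<circ> x) ` {p. p permutes S \<and> Q p}"
    then obtain p where p: "p permutes S" "Q p" "q = inv' x \<circ> p \<circ> x" by auto
    have "q permutes S" unfolding p(3) using x p(1) by (intro permutes_compose permutes_inv)
    moreover have "x \<circ> q \<circ> inv' x = p" unfolding p(3) by (auto simp: fun_eq_iff permutes_inverses[OF x])
    ultimately show "q \<in> {p. p permutes S \<and> P p}" using P p(2) by auto
  qed
  show "(\<lambda>p. x \<circ> p \<circ> inv' x) ` {p. p permutes S \<and> P p} \<subseteq> {p. p permutes S \<and> Q p}"
    using P permutes_conj[OF x] by auto
qed (auto simp: fun_eq_iff permutes_inverses[OF x])

text \<open>If \<open>x\<close> has been adjusted so that the inequality holds up to \<open>j\<close>, and \<open>Suc j\<close> is mapped to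
  some \<open>v > Suc (Suc j)\<close>, exchanging the names of \<open>v\<close> and \<open>Suc (Suc j)\<close> repairs the inequality
  at \<open>Suc j\<close> and does not disturb it below.\<close>

lemma canonical_conjugate:
  assumes p: "p permutes {1..n}"
  obtains x where "x permutes {1..n}" "\<And>i. i \<in> {1..n} \<Longrightarrow> (x \<circ> p \<circ> inv' x) i \<le> Suc i"
proof -
  have "\<exists>x. x permutes {1..n} \<and> (\<forall>i\<in>{1..j}. (x \<circ> p \<circ> inv' x) i \<le> Suc i)" if "j \<le> n" for j
    using that
  proof (induction j)
    case 0
    show ?case by (intro exI[of _ id] conjI permutes_id) simp
  next
    case (Suc j)
    then obtain x where x: "x permutes {1..n}" and le: "\<And>i. i \<in> {1..j} \<Longrightarrow> (x \<circ> p \<circ> inv' x) i \<le> Suc i" by auto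
    define q where "q = x \<circ> p \<circ> inv' x"
    have q: "q permutes {1..n}" unfolding q_def by (rule permutes_conj[OF x p])
    show ?case
    proof (cases "q (Suc j) \<le> Suc (Suc j)")
      case True
      have "q i \<le> Suc i" if "i \<in> {1..Suc j}" for i
        using that True le[of i] unfolding q_def[symmetric] by (cases "i = Suc j") auto
      then show ?thesis using x unfolding q_def by blast
    next
      case False
      define v where "v = q (Suc j)"
      define t where "t = Transposition.transpose v (Suc (Suc j))"
      have v: "v > Suc (Suc j)" "v \<in> {1..n}"
        using False permutes_in_image[OF q, of "Suc j"] Suc.prems unfolding v_def by auto
      have t: "t permutes {1..n}" unfolding t_def by (rule permutes_swap_id) (use v in auto)
      have tx: "t \<circ> x permutes {1..n}" by (rule permutes_compose[OF x t])
      have tt: "t (t i) = i" for i unfolding t_def by simp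
      have "inv' (t \<circ> x) = inv' x \<circ> t"
        using permutes_inv_o[OF x] tt permutes_inverses[OF x]
        by (intro inv_unique_comp) (auto simp: fun_eq_iff)
      then have eq: "(t \<circ> x) \<circ> p \<circ> inv' (t \<circ> x) = t \<circ> q \<circ> t" unfolding q_def by (simp add: o_assoc)
      have "(t \<circ> q \<circ> t) i \<le> Suc i" if i: "i \<in> {1..Suc j}" for i
      proof -
        have "t i = i" using i v unfolding t_def by (auto simp: transpose_def)
        show ?thesis
        proof (cases "i = Suc j")
          case True
          then show ?thesis using \<open>t i = i\<close> v_def by (simp add: t_def)
        next
          case False
          then have "q i \<le> Suc i" using le i unfolding q_def by simp
          then have "t (q i) = q i" using False i v unfolding t_def by (auto simp: transpose_def)
          then show ?thesis using \<open>t i = i\<close> \<open>q i \<le> Suc i\<close> by simp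
        qed
      qed
      then show ?thesis using tx unfolding eq[symmetric] by blast
    qed
  qed
  from this[OF order_refl] show ?thesis using that by auto
qed

lemma images_canonical:
  assumes "q permutes {1..n}" "\<And>i. i \<in> {1..n} \<Longrightarrow> q i \<le> Suc i"
  shows "images n q \<in> set (canonical n)"
proof -
  have "images n q \<in> images n ` {p. p permutes {1..n} \<and> (\<forall>i\<in>{1..n}. p i \<le> Suc i)}" using assms by auto
  also have "\<dots> = set (canonical n)"
    unfolding canonical_def
  proof (rule bij_betw_imp_surj_on, rule enum_permutations)
    fix p assume "p permutes {1..n}"
    have "snd (hd (images k p)) \<le> Suc (fst (hd (images k p))) \<longleftrightarrow> p k \<le> Suc k" if "k \<in> {1..n}" for k
      using that by (cases k) auto
    then show "(\<forall>i\<in>{1..n}. p i \<le> Suc i) \<longleftrightarrow>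
      (\<forall>k\<in>{1..n}. snd (hd (images k p)) \<le> Suc (fst (hd (images k p))))" by auto
  qed
  finally show ?thesis .
qed

section \<open>The sign of the action on the 2-cycles of an involution\<close>

definition two_cycles :: "(nat \<Rightarrow> nat) \<Rightarrow> nat set set" where
  "two_cycles z = {{i, z i} | i. z i \<noteq> i}"

definition on_cycles :: "(nat \<Rightarrow> nat) \<Rightarrow> (nat \<Rightarrow> nat) \<Rightarrow> nat set \<Rightarrow> nat set" where
  "on_cycles z g B = (if B \<in> two_cycles z then g ` B else B)"

text \<open>The linear characters that form the model for every \<open>n \<le> 7\<close>.\<close>

definition cycle_sign :: "(nat \<Rightarrow> nat) \<Rightarrow> (nat \<Rightarrow> nat) \<Rightarrow> complex" where
  "cycle_sign z g = of_int (sign (on_cycles z g))"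

lemma commute_apply: "g \<circ> z = z \<circ> g \<Longrightarrow> g (z i) = z (g i)"
  by (metis comp_apply)

lemma image_two_cycles:
  assumes g: "inj g" "g \<circ> z = z \<circ> g" and B: "B \<in> two_cycles z"
  shows "g ` B \<in> two_cycles z"
proof -
  obtain i where i: "B = {i, z i}" "z i \<noteq> i" using B unfolding two_cycles_def by auto
  have "g ` B = {g i, z (g i)}" using i(1) commute_apply[OF g(2)] by simp
  moreover have "z (g i) \<noteq> g i" using i(2) g commute_apply[OF g(2), of i] by (metis injD)
  ultimately show ?thesis unfolding two_cycles_def by blast
qed

lemma finite_two_cycles: "z permutes {1..n} \<Longrightarrow> finite (two_cycles z)"
proof -
  assume z: "z permutes {1..n}"
  have "two_cycles z \<subseteq> (\<lambda>i. {i, z i}) ` {1..n}"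
    using permutes_not_in[OF z] unfolding two_cycles_def by force
  then show ?thesis using finite_subset by blast
qed

lemma on_cycles_permutes:
  assumes z: "z permutes {1..n}" and g: "g permutes {1..n}" "g \<circ> z = z \<circ> g"
  shows "on_cycles z g permutes two_cycles z"
proof (rule bij_imp_permutes)
  have "inj_on (on_cycles z g) (two_cycles z)"
    using permutes_inj[OF g(1)] by (auto simp: on_cycles_def inj_on_def inj_image_eq_iff)
  moreover have "on_cycles z g ` two_cycles z \<subseteq> two_cycles z"
    using image_two_cycles[OF permutes_inj[OF g(1)] g(2)] by (auto simp: on_cycles_def)
  ultimately show "bij_betw (on_cycles z g) (two_cycles z) (two_cycles z)"
    using finite_two_cycles[OF z] by (simp add: bij_betw_def endo_inj_surj)
qed (simp add: on_cycles_def)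

lemma cycle_sign_mult:
  assumes z: "z permutes {1..n}" and g: "g permutes {1..n}" "g \<circ> z = z \<circ> g" and h: "h permutes {1..n}" "h \<circ> z = z \<circ> h"
  shows "cycle_sign z (g \<circ> h) = cycle_sign z g * cycle_sign z h"
proof -
  have "on_cycles z (g \<circ> h) = on_cycles z g \<circ> on_cycles z h"
    using image_two_cycles[OF permutes_inj[OF h(1)] h(2)] by (auto simp: on_cycles_def fun_eq_iff)
  moreover have "permutation (on_cycles z g)" "permutation (on_cycles z h)"
    using on_cycles_permutes[OF z] g h finite_two_cycles[OF z] permutation_permutes by blast+
  ultimately show ?thesis unfolding cycle_sign_def by (simp add: sign_compose)
qed

lemma cycle_sign_id: "cycle_sign z id = 1"
proof -
  have "on_cycles z id = id" by (simp add: fun_eq_iff on_cycles_def)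
  then show ?thesis unfolding cycle_sign_def by simp
qed

text \<open>On at most three points the odd permutations are the transpositions.\<close>

lemma sign_of_few_points:
  assumes p: "p permutes S" and S: "finite S" "card S \<le> 3"
  shows "sign p = (if card {x \<in> S. p x \<noteq> x} = 2 then -1 else 1)"
proof -
  define M where "M = {x \<in> S. p x \<noteq> x}"
  have fM: "finite M" "card M \<le> 3" using S card_mono[of S M] unfolding M_def by auto
  have M_iff: "x \<in> M \<longleftrightarrow> p x \<noteq> x" for x using permutes_not_in[OF p] unfolding M_def by auto
  have inj: "p x = p y \<longleftrightarrow> x = y" for x y using permutes_inj[OF p] by (simp add: inj_eq)
  have pM: "p x \<in> M" if "x \<in> M" for x using that unfolding M_iff inj .
  consider "card M = 0" | "card M = 1" | "card M = 2" | "card M = 3" using fM by linarith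
  then show ?thesis
  proof cases
    case 1
    then have "M = {}" using fM by simp
    then have "p = id" using M_iff by (auto simp: fun_eq_iff)
    then show ?thesis using 1 unfolding M_def by simp
  next
    case 2
    then obtain a where "M = {a}" by (auto simp: card_1_singleton_iff)
    then show ?thesis using pM M_iff by blast
  next
    case 3
    then obtain a b where ab: "M = {a, b}" "a \<noteq> b" by (auto simp: card_2_iff)
    then have "p a = b" "p b = a" using pM[of a] pM[of b] M_iff[of a] M_iff[of b] by auto
    moreover have "p x = x" if "x \<noteq> a" "x \<noteq> b" for x using that M_iff[of x] ab by auto
    ultimately have "p = Transposition.transpose a b" by (auto simp: fun_eq_iff transpose_def)
    then show ?thesis using 3 ab unfolding M_def by (simp add: sign_swap_id)
  next
    case 4
    then obtain a where a: "a \<in> M" by fastforce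
    define b where "b = p a"
    define c where "c = p b"
    have bc: "b \<in> M" "c \<in> M" "a \<noteq> b" "b \<noteq> c" using a pM M_iff unfolding b_def c_def by metis+
    have ca: "c \<noteq> a"
    proof
      assume "c = a"
      have "\<not> M \<subseteq> {a, b}" using card_mono[of "{a, b}" M] card_insert_le_m1[of 2 "{b}" a] 4 by fastforce
      then obtain d where d: "d \<in> M" "d \<noteq> a" "d \<noteq> b" by blast
      have "p d \<noteq> a" "p d \<noteq> b" "p d \<noteq> d" "p d \<in> M"
        using d \<open>c = a\<close> inj[of d b] inj[of d a] M_iff pM unfolding c_def b_def by auto
      then have "card {a, b, d, p d} \<le> card M" using a bc d by (intro card_mono fM) auto
      moreover have "card {a, b, d, p d} = 4" using d bc \<open>p d \<noteq> a\<close> \<open>p d \<noteq> b\<close> \<open>p d \<noteq> d\<close> by auto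
      ultimately show False using 4 by simp
    qed
    have M: "M = {a, b, c}"
      by (rule card_seteq[OF fM(1), symmetric]) (use a bc ca 4 in auto)
    have "p c \<in> M" "p c \<noteq> c" "p c \<noteq> b" using pM bc M_iff inj[of c a] ca unfolding b_def by auto
    then have "p c = a" using M by auto
    moreover have "p x = x" if "x \<noteq> a" "x \<noteq> b" "x \<noteq> c" for x using that M_iff[of x] M by auto
    ultimately have "p = Transposition.transpose a b \<circ> Transposition.transpose b c"
      using bc ca by (auto simp: fun_eq_iff transpose_def b_def[symmetric] c_def[symmetric])
    then show ?thesis using 4 bc unfolding M_def
      by (simp add: sign_compose permutation_swap_id sign_swap_id)
  qed
qed

lemma two_cycles_eq:
  assumes "z \<circ> z = id" "B \<in> two_cycles z" "i \<in> B"
  shows "B = {i, z i}" "z i \<noteq> i"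
proof -
  have zz: "z (z j) = j" for j using assms(1) by (metis comp_apply id_apply)
  obtain j where "B = {j, z j}" "z j \<noteq> j" using assms(2) unfolding two_cycles_def by auto
  then show "B = {i, z i}" "z i \<noteq> i" using assms(3) zz[of j] by auto
qed

lemma card_Union_two_cycles:
  assumes "z permutes {1..n}" "z \<circ> z = id" "C \<subseteq> two_cycles z"
  shows "card (\<Union>C) = 2 * card C"
proof -
  have fin: "finite C" using finite_subset[OF assms(3) finite_two_cycles[OF assms(1)]] .
  have two: "card B = 2" if BC: "B \<in> C" for B
  proof -
    obtain i where "B = {i, z i}" "z i \<noteq> i" using BC assms(3) unfolding two_cycles_def by blast
    then show ?thesis by (simp add: card_2_iff)
  qed
  have "2 * card C = card (\<Union>C)"
  proof (rule card_partition[OF fin])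
    show "finite (\<Union>C)" using fin two by (metis card.infinite finite_Union zero_neq_numeral)
    show "\<And>B B'. B \<in> C \<Longrightarrow> B' \<in> C \<Longrightarrow> B \<noteq> B' \<Longrightarrow> B \<inter> B' = {}"
      using two_cycles_eq[OF assms(2)] assms(3) by blast
  qed (rule two)
  then show ?thesis by simp
qed

text \<open>A form of the sign that can be evaluated and is visibly invariant under conjugation.\<close>

lemma cycle_sign_small:
  assumes n: "n \<le> 7" and z: "z permutes {1..n}" "z \<circ> z = id" and g: "g permutes {1..n}" "g \<circ> z = z \<circ> g"
  shows "cycle_sign z g = (if card {i. z i \<noteq> i \<and> g i \<noteq> i \<and> g i \<noteq> z i} = 4 then -1 else 1)"
proof -
  have zz: "z (z j) = j" for j using z(2) by (metis comp_apply id_apply)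
  have fix_out: "z i = i" if "i \<notin> {1..n}" for i using permutes_not_in[OF z(1) that] .
  have "\<Union>(two_cycles z) \<subseteq> {1..n}"
    using fix_out two_cycles_eq[OF z(2)] by blast
  then have "card (\<Union>(two_cycles z)) \<le> card {1..n}" by (intro card_mono) auto
  then have c3: "card (two_cycles z) \<le> 3" using card_Union_two_cycles[OF z order_refl] n by simp
  define C where "C = {B \<in> two_cycles z. on_cycles z g B \<noteq> B}"
  have "\<Union>C = {i. z i \<noteq> i \<and> g i \<noteq> i \<and> g i \<noteq> z i}"
  proof (intro equalityI subsetI)
    fix i assume "i \<in> \<Union>C"
    then obtain B where B': "B \<in> C" "i \<in> B" by blast
    then have B: "B \<in> two_cycles z" "g ` B \<noteq> B" "i \<in> B"
      unfolding C_def on_cycles_def by (simp_all split: if_splits)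
    note eq = two_cycles_eq[OF z(2) B(1,3)]
    have "g ` B = {g i, z (g i)}" unfolding eq(1) using commute_apply[OF g(2)] by simp
    then have "g i \<noteq> i" "g i \<noteq> z i" using B(2) zz unfolding eq(1) by auto
    then show "i \<in> {i. z i \<noteq> i \<and> g i \<noteq> i \<and> g i \<noteq> z i}" using eq(2) by simp
  next
    fix i assume i: "i \<in> {i. z i \<noteq> i \<and> g i \<noteq> i \<and> g i \<noteq> z i}"
    define B where "B = {i, z i}"
    have "B \<in> two_cycles z" unfolding B_def two_cycles_def using i by auto
    moreover have "g ` B \<noteq> B" using i unfolding B_def by auto
    ultimately have "B \<in> C" unfolding C_def on_cycles_def by simp
    then show "i \<in> \<Union>C" unfolding B_def by blast
  qed
  moreover have "card (\<Union>C) = 2 * card C" by (rule card_Union_two_cycles[OF z]) (auto simp: C_def)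
  moreover have "sign (on_cycles z g) = (if card C = 2 then -1 else 1)"
    unfolding C_def
    by (rule sign_of_few_points[OF on_cycles_permutes[OF z(1) g] finite_two_cycles[OF z(1)] c3])
  ultimately show ?thesis unfolding cycle_sign_def by auto
qed

lemma cycle_sign_conj:
  assumes n: "n \<le> 7" and z: "z permutes {1..n}" "z \<circ> z = id" and g: "g permutes {1..n}" "g \<circ> z = z \<circ> g"
    and x: "x permutes {1..n}"
  shows "cycle_sign (x \<circ> z \<circ> inv' x) (x \<circ> g \<circ> inv' x) = cycle_sign z g"
proof -
  let ?z = "x \<circ> z \<circ> inv' x" and ?g = "x \<circ> g \<circ> inv' x"
  have z': "?z permutes {1..n}" "?g permutes {1..n}" using permutes_conj[OF x] z g by auto
  have zz: "?z \<circ> ?z = id" unfolding conj_comp[OF x] z(2) using permutes_inv_o[OF x] by simp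
  have cc: "?g \<circ> ?z = ?z \<circ> ?g" unfolding conj_commute_iff[OF x] by (rule g(2))
  have "{i. ?z i \<noteq> i \<and> ?g i \<noteq> i \<and> ?g i \<noteq> ?z i} = x ` {i. z i \<noteq> i \<and> g i \<noteq> i \<and> g i \<noteq> z i}"
  proof (intro equalityI subsetI)
    fix i assume i: "i \<in> {i. ?z i \<noteq> i \<and> ?g i \<noteq> i \<and> ?g i \<noteq> ?z i}"
    define j where "j = inv' x i"
    have ij: "i = x j" unfolding j_def using permutes_inverses[OF x] by simp
    have "x (z j) \<noteq> x j" "x (g j) \<noteq> x j" "x (g j) \<noteq> x (z j)"
      using i unfolding ij mem_Collect_eq conj_apply[OF x] by blast+
    then have "z j \<noteq> j \<and> g j \<noteq> j \<and> g j \<noteq> z j" by auto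
    then show "i \<in> x ` {i. z i \<noteq> i \<and> g i \<noteq> i \<and> g i \<noteq> z i}" unfolding ij by blast
  next
    fix i assume "i \<in> x ` {i. z i \<noteq> i \<and> g i \<noteq> i \<and> g i \<noteq> z i}"
    then obtain j where j: "i = x j" "z j \<noteq> j" "g j \<noteq> j" "g j \<noteq> z j" by blast
    have ne: "x a = x b \<longleftrightarrow> a = b" for a b using permutes_inj[OF x] by (rule inj_eq)
    have "?z i = x (z j)" "?g i = x (g j)" unfolding j(1) conj_apply[OF x] by (rule refl)+
    moreover have "x (z j) \<noteq> x j" "x (g j) \<noteq> x j" "x (g j) \<noteq> x (z j)" unfolding ne using j by blast+
    ultimately show "i \<in> {i. ?z i \<noteq> i \<and> ?g i \<noteq> i \<and> ?g i \<noteq> ?z i}"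
      unfolding mem_Collect_eq j(1) by presburger
  qed
  then have "card {i. ?z i \<noteq> i \<and> ?g i \<noteq> i \<and> ?g i \<noteq> ?z i} = card {i. z i \<noteq> i \<and> g i \<noteq> i \<and> g i \<noteq> z i}"
    by (simp only: card_image[OF inj_on_subset[OF permutes_inj[OF x] subset_UNIV]])
  then show ?thesis
    unfolding cycle_sign_small[OF n z g] cycle_sign_small[OF n z'(1) zz z'(2) cc] by simp
qed

lemma pair_sign_images:
  assumes n: "n \<le> 7" and z: "z permutes {1..n}" "z \<circ> z = id" and g: "g permutes {1..n}" "g \<circ> z = z \<circ> g"
  shows "of_int (pair_sign (images n z) (images n g)) = cycle_sign z g"
proof -
  have "length (filter (\<lambda>(i, zi). zi \<noteq> i \<and> (let g = get (images n g) i in g \<noteq> i \<and> g \<noteq> zi)) (images k z)) =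
      card {i. i \<in> {1..k} \<and> z i \<noteq> i \<and> g i \<noteq> i \<and> g i \<noteq> z i}" if "k \<le> n" for k
    using that
  proof (induction k)
    case (Suc k)
    have "{i. i \<in> {1..Suc k} \<and> z i \<noteq> i \<and> g i \<noteq> i \<and> g i \<noteq> z i} =
      (if z (Suc k) \<noteq> Suc k \<and> g (Suc k) \<noteq> Suc k \<and> g (Suc k) \<noteq> z (Suc k) then {Suc k} else {}) \<union>
      {i. i \<in> {1..k} \<and> z i \<noteq> i \<and> g i \<noteq> i \<and> g i \<noteq> z i}" by (auto simp: le_Suc_eq)
    then show ?case using Suc by (auto simp: get_images)
  qed simp
  moreover have "{i. i \<in> {1..n} \<and> z i \<noteq> i \<and> g i \<noteq> i \<and> g i \<noteq> z i} = {i. z i \<noteq> i \<and> g i \<noteq> i \<and> g i \<noteq> z i}"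
    using permutes_not_in[OF z(1)] by auto
  ultimately show ?thesis unfolding pair_sign_def cycle_sign_small[OF n z g] by simp
qed

lemma inverse_list_images:
  assumes "q permutes {1..n}"
  shows "inverse_list n (images n q) = images n (inv' q)"
proof -
  have "inverse_list k (images n q) = images k (inv' q)" if "k \<le> n" for k
    using that
  proof (induction k)
    case (Suc k)
    have "inv' q (Suc k) \<in> {1..n}" using permutes_in_image[OF permutes_inv[OF assms]] Suc.prems by auto
    then have "rget (images n q) (q (inv' q (Suc k))) = inv' q (Suc k)"
      by (rule rget_images[OF permutes_inj_on[OF assms]])
    then show ?case using Suc permutes_inverses[OF assms] by simp
  qed simp
  then show ?thesis by simp
qed

lemma model_check_canonical:
  assumes n: "n \<le> 7" and mc: "model_check n b" and q: "q permutes {1..n}" "evenperm q"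
    and can: "\<And>i. i \<in> {1..n} \<Longrightarrow> q i \<le> Suc i"
  shows "(\<Sum>z | z permutes {1..n} \<and> z \<circ> z = id \<and> evenperm z = b \<and> z \<circ> q = q \<circ> z. cycle_sign z q) =
      of_nat (card {y. y permutes {1..n} \<and> evenperm y = b \<and> y \<circ> y = q})"
    and "\<exists>y. y permutes {1..n} \<and> evenperm y = b \<and> y \<circ> q = inv' q \<circ> y"
proof -
  have "even_list (images n q)" using even_list_images[OF q(1)] q(2) by simp
  then have eq: "sum_list (map (\<lambda>z. if even_list z = b then pair_sign z (images n q) else 0)
        (solutions n (images n q) (images n q) (images n id))) =
      sum_list (map (\<lambda>y. if even_list y = b then 1 else 0 :: int) (solutions n (images n q) (images n q) (images n q)))"
    and ex: "list_ex (\<lambda>y. even_list y = b) (solutions n (images n q) (inverse_list n (images n q)) (images n id))"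
    using mc images_canonical[OF q(1) can] unfolding model_check_def list_all_iff by auto
  have fin: "finite {p. p permutes {1..n} \<and> P p}" for P :: "(nat \<Rightarrow> nat) \<Rightarrow> bool"
    using finite_permutations[of "{1..n}"] by (rule rev_finite_subset) auto
  have "complex_of_int (\<Sum>p | p permutes {1..n} \<and> p \<circ> q = q \<circ> p \<and> p \<circ> p = id.
      if even_list (images n p) = b then pair_sign (images n p) (images n q) else 0) =
    (\<Sum>p | p permutes {1..n} \<and> p \<circ> q = q \<circ> p \<and> p \<circ> p = id. if evenperm p = b then cycle_sign p q else 0)"
    unfolding of_int_sum
  proof (rule sum.cong)
    fix p assume "p \<in> {p. p permutes {1..n} \<and> p \<circ> q = q \<circ> p \<and> p \<circ> p = id}"
    then have p: "p permutes {1..n}" "p \<circ> q = q \<circ> p" "p \<circ> p = id" by auto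
    then show "complex_of_int (if even_list (images n p) = b then pair_sign (images n p) (images n q) else 0) =
        (if evenperm p = b then cycle_sign p q else 0)"
      using pair_sign_images[OF n p(1,3) q(1)] even_list_images[OF p(1)] by simp
  qed simp
  also have "\<dots> = (\<Sum>p | p permutes {1..n} \<and> p \<circ> p = id \<and> evenperm p = b \<and> p \<circ> q = q \<circ> p. cycle_sign p q)"
    by (rule sum.mono_neutral_cong_right[OF fin]) auto
  finally have L: "complex_of_int (\<Sum>p | p permutes {1..n} \<and> p \<circ> q = q \<circ> p \<and> p \<circ> p = id.
      if even_list (images n p) = b then pair_sign (images n p) (images n q) else 0) =
    (\<Sum>p | p permutes {1..n} \<and> p \<circ> p = id \<and> evenperm p = b \<and> p \<circ> q = q \<circ> p. cycle_sign p q)" .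
  have "(\<Sum>p | p permutes {1..n} \<and> p \<circ> q = q \<circ> p \<and> p \<circ> p = q. if even_list (images n p) = b then 1 else 0 :: int) =
    (\<Sum>p | p permutes {1..n} \<and> evenperm p = b \<and> p \<circ> p = q. 1)"
    by (rule sum.mono_neutral_cong_right[OF fin]) (auto simp: even_list_images o_assoc)
  then have R: "(\<Sum>p | p permutes {1..n} \<and> p \<circ> q = q \<circ> p \<and> p \<circ> p = q. if even_list (images n p) = b then 1 else 0 :: int) =
    int (card {p. p permutes {1..n} \<and> evenperm p = b \<and> p \<circ> p = q})" by simp
  show "(\<Sum>z | z permutes {1..n} \<and> z \<circ> z = id \<and> evenperm z = b \<and> z \<circ> q = q \<circ> z. cycle_sign z q) =
      of_nat (card {y. y permutes {1..n} \<and> evenperm y = b \<and> y \<circ> y = q})"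
    unfolding L[symmetric] sum_solutions[OF q(1) q(1) permutes_id, of "\<lambda>z. if even_list z = b then pair_sign z (images n q) else 0"] eq
      sum_solutions[OF q(1) q(1) q(1), of "\<lambda>y. if even_list y = b then 1 else 0", symmetric] R by simp
  obtain xs where xs: "xs \<in> set (solutions n (images n q) (images n (inv' q)) (images n id))" "even_list xs = b"
    using ex unfolding list_ex_iff inverse_list_images[OF q(1)] by blast
  then obtain p where "p permutes {1..n}" "p \<circ> q = inv' q \<circ> p" "xs = images n p"
    unfolding set_solutions[OF q(1) permutes_inv[OF q(1)] permutes_id] by blast
  then show "\<exists>y. y permutes {1..n} \<and> evenperm y = b \<and> y \<circ> q = inv' q \<circ> y"
    using xs(2) even_list_images by metis
qed

text \<open>All quantities in question are invariant under conjugation, so it is enough to evaluate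
  them on the representatives.\<close>

theorem model_check_sound:
  assumes n: "n \<le> 7" and mc: "model_check n b" and g: "g permutes {1..n}" "evenperm g"
  shows "(\<Sum>z | z permutes {1..n} \<and> z \<circ> z = id \<and> evenperm z = b \<and> z \<circ> g = g \<circ> z. cycle_sign z g) =
      of_nat (card {y. y permutes {1..n} \<and> evenperm y = b \<and> y \<circ> y = g})"
    and "\<exists>y. y permutes {1..n} \<and> evenperm y = b \<and> y \<circ> g = inv' g \<circ> y"
proof -
  obtain x where x: "x permutes {1..n}" and can: "\<And>i. i \<in> {1..n} \<Longrightarrow> (x \<circ> g \<circ> inv' x) i \<le> Suc i"
    using canonical_conjugate[OF g(1)] by blast
  define q where "q = x \<circ> g \<circ> inv' x"
  have perm: "permutation p" if "p permutes {1..n}" for p using that permutation_permutes by blast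
  have q: "q permutes {1..n}" "evenperm q"
    unfolding q_def using permutes_conj[OF x g(1)] evenperm_conj[OF perm[OF x] perm[OF g(1)]] g(2) by auto
  have conj_id: "x \<circ> id \<circ> inv' x = id" using permutes_inv_o[OF x] by simp
  have inj: "x \<circ> p \<circ> inv' x = x \<circ> p' \<circ> inv' x \<longleftrightarrow> p = p'" for p p'
  proof
    assume a: "x \<circ> p \<circ> inv' x = x \<circ> p' \<circ> inv' x"
    show "p = p'"
    proof
      fix i show "p i = p' i"
        using fun_cong[OF a, of "x i"] permutes_inj[OF x] by (simp add: permutes_inverses[OF x] inj_eq)
    qed
  qed simp
  have "(\<Sum>z | z permutes {1..n} \<and> z \<circ> z = id \<and> evenperm z = b \<and> z \<circ> g = g \<circ> z. cycle_sign z g) =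
      (\<Sum>z | z permutes {1..n} \<and> z \<circ> z = id \<and> evenperm z = b \<and> z \<circ> g = g \<circ> z. cycle_sign (x \<circ> z \<circ> inv' x) q)"
    unfolding q_def by (rule sum.cong) (auto simp: cycle_sign_conj[OF n _ _ g(1) _ x])
  also have "\<dots> = (\<Sum>z | z permutes {1..n} \<and> z \<circ> z = id \<and> evenperm z = b \<and> z \<circ> q = q \<circ> z. cycle_sign z q)"
  proof (rule sum.reindex_bij_betw, rule bij_betw_conj[OF x])
    fix p assume p: "p permutes {1..n}"
    show "(p \<circ> p = id \<and> evenperm p = b \<and> p \<circ> g = g \<circ> p) \<longleftrightarrow>
      ((x \<circ> p \<circ> inv' x) \<circ> (x \<circ> p \<circ> inv' x) = id \<and> evenperm (x \<circ> p \<circ> inv' x) = b \<and>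
        (x \<circ> p \<circ> inv' x) \<circ> q = q \<circ> (x \<circ> p \<circ> inv' x))"
      unfolding q_def conj_comp[OF x] evenperm_conj[OF perm[OF x] perm[OF p]] inj
      using inj[of "p \<circ> p" id] conj_id by simp
  qed
  also have "\<dots> = of_nat (card {y. y permutes {1..n} \<and> evenperm y = b \<and> y \<circ> y = q})"
    by (rule model_check_canonical(1)[OF n mc q]) (use can in \<open>simp add: q_def\<close>)
  also have "card {y. y permutes {1..n} \<and> evenperm y = b \<and> y \<circ> y = q} =
      card {y. y permutes {1..n} \<and> evenperm y = b \<and> y \<circ> y = g}"
  proof (rule bij_betw_same_card[symmetric], rule bij_betw_conj[OF x])
    fix p assume p: "p permutes {1..n}"
    show "(evenperm p = b \<and> p \<circ> p = g) \<longleftrightarrow>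
      (evenperm (x \<circ> p \<circ> inv' x) = b \<and> (x \<circ> p \<circ> inv' x) \<circ> (x \<circ> p \<circ> inv' x) = q)"
      unfolding q_def evenperm_conj[OF perm[OF x] perm[OF p]] conj_comp[OF x] inj by simp
  qed
  finally show "(\<Sum>z | z permutes {1..n} \<and> z \<circ> z = id \<and> evenperm z = b \<and> z \<circ> g = g \<circ> z. cycle_sign z g) =
      of_nat (card {y. y permutes {1..n} \<and> evenperm y = b \<and> y \<circ> y = g})" .
  obtain y where y: "y permutes {1..n}" "evenperm y = b" "y \<circ> q = inv' q \<circ> y"
    using model_check_canonical(2)[OF n mc q] can q_def by auto
  define y' where "y' = inv' x \<circ> y \<circ> x"
  have "y' permutes {1..n}" unfolding y'_def using x y(1) by (intro permutes_compose permutes_inv)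
  moreover have "evenperm y' = b"
    using evenperm_conj[OF permutation_inverse[OF perm[OF x]] perm[OF y(1)]] y(2) unfolding y'_def
    by (simp add: inv_inv_eq[OF permutes_bij[OF x]])
  moreover have "y' \<circ> g = inv' g \<circ> y'"
  proof -
    have "y (q (x i)) = inv' q (y (x i))" for i using fun_cong[OF y(3), of "x i"] by simp
    then have "y (x (g i)) = inv' q (y (x i))" for i unfolding q_def by (simp add: permutes_inverses[OF x])
    then have e: "q (y (x (g i))) = y (x i)" for i by (simp add: permutes_inverses[OF q(1)])
    have "g (y' (g i)) = y' i" for i
    proof -
      have "x (g (inv' x (y (x (g i))))) = y (x i)" using e[of i] unfolding q_def by simp
      then have "inv' x (x (g (inv' x (y (x (g i)))))) = inv' x (y (x i))" by simp
      then show ?thesis unfolding y'_def by (simp add: permutes_inverses[OF x])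
    qed
    then have "inv' g (g (y' (g i))) = inv' g (y' i)" for i by simp
    then show ?thesis by (simp add: fun_eq_iff permutes_inverses[OF g(1)])
  qed
  ultimately show "\<exists>y. y permutes {1..n} \<and> evenperm y = b \<and> y \<circ> g = inv' g \<circ> y" by blast
qed

section \<open>Models of alternating groups in terms of involutions of symmetric groups\<close>

text \<open>The parity \<open>b\<close> is \<open>True\<close> for even permutations. The identity is included.\<close>

definition invols :: "nat \<Rightarrow> bool \<Rightarrow> (nat \<Rightarrow> nat) set" where
  "invols n b = {z. z permutes {1..n} \<and> z \<circ> z = id \<and> evenperm z = b}"

definition square_roots :: "nat \<Rightarrow> bool \<Rightarrow> (nat \<Rightarrow> nat) \<Rightarrow> (nat \<Rightarrow> nat) set" where
  "square_roots n b g = {y. y permutes {1..n} \<and> evenperm y = b \<and> y \<circ> y = g}"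

definition inverting :: "nat \<Rightarrow> bool \<Rightarrow> bool" where
  "inverting n b \<longleftrightarrow> (\<forall>g. g permutes {1..n} \<longrightarrow> evenperm g \<longrightarrow>
    (\<exists>y. y permutes {1..n} \<and> evenperm y = b \<and> y \<circ> g = inv' g \<circ> y))"

text \<open>The equivariant families of linear characters for \<open>A\<^sub>n\<close> with an automorphism that is
  conjugation by an involution of parity \<open>b\<close>, expressed through involutions of \<open>S\<^sub>n\<close> instead of
  twisted involutions.\<close>

definition involution_characters :: "nat \<Rightarrow> bool \<Rightarrow> ((nat \<Rightarrow> nat) \<Rightarrow> (nat \<Rightarrow> nat) \<Rightarrow> complex) \<Rightarrow> bool" where
  "involution_characters n b F \<longleftrightarrow>
    (\<forall>z\<in>invols n b. F z id = 1) \<and>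
    (\<forall>z\<in>invols n b. \<forall>g\<in>carrier (alt_group n). \<forall>h\<in>carrier (alt_group n).
      g \<circ> z = z \<circ> g \<longrightarrow> h \<circ> z = z \<circ> h \<longrightarrow> F z (g \<circ> h) = F z g * F z h) \<and>
    (\<forall>z\<in>invols n b. \<forall>g\<in>carrier (alt_group n). \<forall>x\<in>carrier (alt_group n).
      g \<circ> z = z \<circ> g \<longrightarrow> F (x \<circ> z \<circ> inv' x) (x \<circ> g \<circ> inv' x) = F z g) \<and>
    (\<forall>g\<in>carrier (alt_group n).
      (\<Sum>z\<in>{z\<in>invols n b. z \<circ> g = g \<circ> z}. F z g) = of_nat (card (square_roots n b g)))"

lemma alt_finite_grp: "finite_grp (alt_group n)"
proof -
  interpret group "alt_group n" by (rule alt_group_is_group)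
  have "carrier (alt_group n) \<subseteq> {p. p permutes {1..n}}" using alt_group_carrier by auto
  then show ?thesis by unfold_locales (auto intro: finite_subset finite_permutations)
qed

lemma permutes_permutation: "p permutes {1..n::nat} \<Longrightarrow> permutation p"
  using permutation_permutes by blast

lemma altD: "g \<in> carrier (alt_group n) \<Longrightarrow> g permutes {1..n}" "g \<in> carrier (alt_group n) \<Longrightarrow> evenperm g"
  "g \<in> carrier (alt_group n) \<Longrightarrow> permutation g"
  using alt_group_carrier permutes_permutation by auto

lemma permutes_o_inv [simp]:
  "x permutes S \<Longrightarrow> x \<circ> inv' x = id" "x permutes S \<Longrightarrow> inv' x \<circ> x = id"
  by (auto simp: permutes_inv_o)

lemma (in involutive_auto) linear_familyD:
  assumes "linear_family F" "\<omega> \<in> Invs"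
  shows "F \<omega> \<one> = 1" "g \<in> stab \<omega> \<Longrightarrow> h \<in> stab \<omega> \<Longrightarrow> F \<omega> (g \<otimes> h) = F \<omega> g * F \<omega> h"
    "x \<in> carrier G \<Longrightarrow> g \<in> stab \<omega> \<Longrightarrow> F (act x \<omega>) (x \<otimes> g \<otimes> inv x) = F \<omega> g"
  using assms unfolding linear_family_def by simp_all

text \<open>Right multiplication by \<open>s\<close> turns the twisted action into conjugation, because
  \<open>g \<omega> (\<tau> g)\<^sup>-\<^sup>1 s = g (\<omega> s) g\<^sup>-\<^sup>1\<close>, and \<open>\<omega> \<cdot> \<tau> \<omega>\<close> into the square of \<open>\<omega> s\<close>.\<close>

locale twisted_alt =
  fixes n :: nat and s :: "nat \<Rightarrow> nat" and \<tau> :: "(nat \<Rightarrow> nat) \<Rightarrow> nat \<Rightarrow> nat"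
  assumes s: "s permutes {1..n}" "s \<circ> s = id"
    and \<tau>: "\<And>g. g \<in> carrier (alt_group n) \<Longrightarrow> \<tau> g = s \<circ> g \<circ> s"
begin

lemma s_s: "s (s i) = i"
  using s(2) by (metis comp_apply id_apply)

lemma perm_s: "permutation s"
  using s(1) by (rule permutes_permutation)

lemma tau_carrier: "g \<in> carrier (alt_group n) \<Longrightarrow> s \<circ> g \<circ> s \<in> carrier (alt_group n)"
  using s perm_s altD[of g n] alt_group_carrier
  by (auto simp: evenperm_comp permutation_compose intro!: permutes_compose)

sublocale involutive_auto "alt_group n" \<tau>
proof -
  interpret finite_grp "alt_group n" by (rule alt_finite_grp)
  show "involutive_auto (alt_group n) \<tau>"
  proof unfold_locales
    show "\<tau> \<in> hom (alt_group n) (alt_group n)"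
    proof (rule homI)
      fix g h assume "g \<in> carrier (alt_group n)" "h \<in> carrier (alt_group n)"
      then show "\<tau> (g \<otimes>\<^bsub>alt_group n\<^esub> h) = \<tau> g \<otimes>\<^bsub>alt_group n\<^esub> \<tau> h"
        using m_closed[of g h] by (simp add: \<tau> alt_group_mult fun_eq_iff s_s)
    qed (simp add: \<tau> tau_carrier)
    show "\<tau> (\<tau> g) = g" if "g \<in> carrier (alt_group n)" for g
      using that tau_carrier[OF that] by (simp add: \<tau> fun_eq_iff s_s)
  qed
qed

abbreviation A where "A \<equiv> carrier (alt_group n)"

lemma inv_alt: "g \<in> A \<Longrightarrow> inv\<^bsub>alt_group n\<^esub> g = inv' g"
  by (rule alt_group_inv_equality)

lemma inv'_A: "g \<in> A \<Longrightarrow> inv' g \<in> A"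
  using inv_closed inv_alt by metis

lemma Invs_iff: "\<omega> \<in> Invs \<longleftrightarrow> \<omega> \<in> A \<and> \<omega> \<circ> s \<in> invols n (evenperm s)"
proof -
  have "\<omega> \<circ> \<tau> \<omega> = id \<longleftrightarrow> (\<omega> \<circ> s) \<circ> (\<omega> \<circ> s) = id" if "\<omega> \<in> A" using \<tau>[OF that] by (simp add: o_assoc)
  moreover have "\<omega> \<circ> s permutes {1..n}" "evenperm (\<omega> \<circ> s) = evenperm s" if "\<omega> \<in> A"
    using altD[OF that] s perm_s by (auto simp: evenperm_comp intro: permutes_compose)
  ultimately show ?thesis
    unfolding twisted_involutions_def invols_def by (auto simp: alt_group_mult alt_group_one)
qed

lemma bij_invols: "bij_betw (\<lambda>\<omega>. \<omega> \<circ> s) Invs (invols n (evenperm s))"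
proof (rule bij_betw_byWitness[where f'="\<lambda>z. z \<circ> s"])
  show "(\<lambda>z. z \<circ> s) ` invols n (evenperm s) \<subseteq> Invs"
  proof
    fix \<omega> assume "\<omega> \<in> (\<lambda>z. z \<circ> s) ` invols n (evenperm s)"
    then obtain z where z: "z \<in> invols n (evenperm s)" "\<omega> = z \<circ> s" by auto
    have "\<omega> \<circ> s = z" unfolding z(2) by (simp add: fun_eq_iff s_s)
    moreover have "\<omega> \<in> A" unfolding z(2) using z(1) s perm_s permutes_permutation
      by (auto simp: alt_group_carrier invols_def evenperm_comp intro: permutes_compose)
    ultimately show "\<omega> \<in> Invs" using z(1) unfolding Invs_iff by simp
  qed
qed (auto simp: Invs_iff fun_eq_iff s_s)

lemma act_s:
  assumes "g \<in> A" "\<omega> \<in> A"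
  shows "act g \<omega> \<circ> s = g \<circ> (\<omega> \<circ> s) \<circ> inv' g"
proof -
  have "inv\<^bsub>alt_group n\<^esub> (\<tau> g) = \<tau> (inv' g)" using tau_inv[OF assms(1)] inv_alt[OF assms(1)] by simp
  then show ?thesis using \<tau>[OF inv'_A[OF assms(1)]]
    by (simp add: act_def alt_group_mult fun_eq_iff s_s)
qed

lemma s_inj: "f \<circ> s = f' \<circ> s \<longleftrightarrow> f = f'"
  by (metis comp_assoc comp_id s(2))

lemma conj_eq_iff:
  assumes "g permutes {1..n}"
  shows "g \<circ> z \<circ> inv' g = z \<longleftrightarrow> g \<circ> z = z \<circ> g"
proof
  assume "g \<circ> z \<circ> inv' g = z"
  then have "g \<circ> z \<circ> (inv' g \<circ> g) = z \<circ> g" by (metis comp_assoc)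
  then show "g \<circ> z = z \<circ> g" using assms by simp
next
  assume "g \<circ> z = z \<circ> g"
  then show "g \<circ> z \<circ> inv' g = z" using assms by (simp add: comp_assoc)
qed

lemma stab_iff: "\<omega> \<in> A \<Longrightarrow> g \<in> stab \<omega> \<longleftrightarrow> g \<in> A \<and> g \<circ> (\<omega> \<circ> s) = (\<omega> \<circ> s) \<circ> g"
  using act_s[of g \<omega>] conj_eq_iff[of g "\<omega> \<circ> s"] altD(1)[of g n] s_inj[of "act g \<omega>" \<omega>]
  unfolding stab_def by auto

lemma twisted_roots_card: "card (twisted_roots g) = card (square_roots n (evenperm s) g)"
proof (rule bij_betw_same_card[of "\<lambda>x. x \<circ> s"], rule bij_betw_byWitness[where f'="\<lambda>y. y \<circ> s"])
  show "(\<lambda>x. x \<circ> s) ` twisted_roots g \<subseteq> square_roots n (evenperm s) g"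
  proof
    fix y assume "y \<in> (\<lambda>x. x \<circ> s) ` twisted_roots g"
    then obtain x where x: "x \<in> A" "x \<circ> \<tau> x = g" "y = x \<circ> s" by (auto simp: twisted_roots_def alt_group_mult)
    have "y \<circ> y = g" using x \<tau>[OF x(1)] by (simp add: o_assoc)
    then show "y \<in> square_roots n (evenperm s) g"
      using altD[OF x(1)] s perm_s x(3) by (auto simp: square_roots_def evenperm_comp intro: permutes_compose)
  qed
  show "(\<lambda>y. y \<circ> s) ` square_roots n (evenperm s) g \<subseteq> twisted_roots g"
  proof
    fix x assume "x \<in> (\<lambda>y. y \<circ> s) ` square_roots n (evenperm s) g"
    then obtain y where y: "y permutes {1..n}" "evenperm y = evenperm s" "y \<circ> y = g" "x = y \<circ> s"
      by (auto simp: square_roots_def)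
    have x: "x \<in> A" unfolding alt_group_carrier y(4)
      using y s perm_s permutes_permutation[OF y(1)] by (auto simp: evenperm_comp intro: permutes_compose)
    have "x \<circ> \<tau> x = x \<circ> (s \<circ> x \<circ> s)" using \<tau>[OF x] by simp
    also have "\<dots> = y \<circ> y" unfolding y(4) by (simp add: fun_eq_iff s_s)
    finally have "x \<circ> \<tau> x = y \<circ> y" .
    then show "x \<in> twisted_roots g" using x y(3) by (simp add: twisted_roots_def alt_group_mult)
  qed
qed (auto simp: fun_eq_iff s_s)

lemma fixed_sum:
  assumes "g \<in> A"
  shows "(\<Sum>\<omega>\<in>{\<omega>\<in>Invs. act g \<omega> = \<omega>}. f (\<omega> \<circ> s)) = (\<Sum>z\<in>{z\<in>invols n (evenperm s). z \<circ> g = g \<circ> z}. f z)"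
proof -
  have "act g \<omega> = \<omega> \<longleftrightarrow> (\<omega> \<circ> s) \<circ> g = g \<circ> (\<omega> \<circ> s)" if "\<omega> \<in> Invs" for \<omega>
    using stab_iff[of \<omega> g] that assms Invs_carrier unfolding stab_def by auto
  then have "bij_betw (\<lambda>\<omega>. \<omega> \<circ> s) {\<omega>\<in>Invs. act g \<omega> = \<omega>} {z\<in>invols n (evenperm s). z \<circ> g = g \<circ> z}"
    by (intro bij_betw_Collect[OF bij_invols]) simp
  then show ?thesis by (rule sum.reindex_bij_betw)
qed

lemma inverting_iff:
  "inverting n (evenperm s) \<longleftrightarrow> (\<forall>g\<in>A. \<exists>h\<in>A. \<tau> g = h \<circ> inv' g \<circ> inv' h)"
proof -
  have key: "(\<exists>y. y permutes {1..n} \<and> evenperm y = evenperm s \<and> y \<circ> g = inv' g \<circ> y) \<longleftrightarrow>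
      (\<exists>h\<in>A. \<tau> g = h \<circ> inv' g \<circ> inv' h)" if g: "g \<in> A" for g
  proof
    assume "\<exists>y. y permutes {1..n} \<and> evenperm y = evenperm s \<and> y \<circ> g = inv' g \<circ> y"
    then obtain y where y: "y permutes {1..n}" "evenperm y = evenperm s" "y \<circ> g = inv' g \<circ> y" by auto
    define h where "h = s \<circ> inv' y"
    have py: "permutation y" by (rule permutes_permutation[OF y(1)])
    have hp: "h permutes {1..n}" unfolding h_def by (rule permutes_compose[OF permutes_inv[OF y(1)] s(1)])
    have h: "h \<in> A" unfolding alt_group_carrier using hp y(2) perm_s py
      by (simp add: h_def evenperm_comp evenperm_inv permutation_inverse)
    have "\<tau> g \<circ> h = h \<circ> inv' g"
    proof
      fix i
      have "g (inv' y i) = inv' y (inv' g i)"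
        using fun_cong[OF y(3), of "inv' y i"] permutes_inverses[OF y(1)] by (metis comp_apply)
      then show "(\<tau> g \<circ> h) i = (h \<circ> inv' g) i" unfolding \<tau>[OF g] h_def by (simp add: s_s)
    qed
    then have "\<tau> g \<circ> (h \<circ> inv' h) = h \<circ> inv' g \<circ> inv' h" by (simp add: o_assoc)
    then show "\<exists>h\<in>A. \<tau> g = h \<circ> inv' g \<circ> inv' h" using h hp by auto
  next
    assume "\<exists>h\<in>A. \<tau> g = h \<circ> inv' g \<circ> inv' h"
    then obtain h where h: "h \<in> A" "\<tau> g = h \<circ> inv' g \<circ> inv' h" by auto
    note hp = altD(1)[OF h(1)]
    define y where "y = inv' h \<circ> s"
    have "y permutes {1..n}" unfolding y_def by (rule permutes_compose[OF s(1) permutes_inv[OF hp]])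
    moreover have "evenperm y = evenperm s" unfolding y_def using altD[OF h(1)] perm_s
      by (simp add: evenperm_comp evenperm_inv permutation_inverse)
    moreover have "y \<circ> g = inv' g \<circ> y"
    proof
      fix i
      have "s (g (s (s i))) = h (inv' g (inv' h (s i)))" using fun_cong[OF h(2), of "s i"] \<tau>[OF g] by simp
      then have "inv' h (s (g i)) = inv' g (inv' h (s i))" using permutes_inverses[OF hp] s_s by metis
      then show "(y \<circ> g) i = (inv' g \<circ> y) i" unfolding y_def by simp
    qed
    ultimately show "\<exists>y. y permutes {1..n} \<and> evenperm y = evenperm s \<and> y \<circ> g = inv' g \<circ> y" by blast
  qed
  have "inverting n (evenperm s) \<longleftrightarrow>
      (\<forall>g\<in>A. \<exists>y. y permutes {1..n} \<and> evenperm y = evenperm s \<and> y \<circ> g = inv' g \<circ> y)"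
    unfolding inverting_def by (auto simp: alt_group_carrier)
  then show ?thesis using key by simp
qed

lemma group_inverting:
  "inverting n (evenperm s) \<longleftrightarrow>
    (\<forall>g\<in>A. \<exists>h\<in>A. \<tau> g = h \<otimes>\<^bsub>alt_group n\<^esub> inv\<^bsub>alt_group n\<^esub> g \<otimes>\<^bsub>alt_group n\<^esub> inv\<^bsub>alt_group n\<^esub> h)"
  unfolding inverting_iff by (simp add: alt_group_mult inv_alt cong: ball_cong bex_cong)

theorem model_imp_involution_characters:
  assumes "generalized_involution_model (alt_group n) \<tau> M"
  shows "inverting n (evenperm s)" and "\<exists>F. involution_characters n (evenperm s) F"
proof -
  obtain F where fam: "linear_family F"
    and sum: "\<And>g. g \<in> A \<Longrightarrow> (\<Sum>\<omega>\<in>{\<omega>\<in>Invs. act g \<omega> = \<omega>}. F \<omega> g) = of_nat (card (twisted_roots g))"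
    and conj: "\<And>g. g \<in> A \<Longrightarrow> \<exists>h\<in>A. \<tau> g = h \<otimes>\<^bsub>alt_group n\<^esub> inv\<^bsub>alt_group n\<^esub> g \<otimes>\<^bsub>alt_group n\<^esub> inv\<^bsub>alt_group n\<^esub> h"
    using generalized_involution_model_imp[OF assms] by blast
  show "inverting n (evenperm s)" unfolding group_inverting using conj by blast
  define F' where "F' z = F (z \<circ> s)" for z
  have \<omega>: "z \<circ> s \<in> Invs" "(z \<circ> s) \<circ> s = z" "z \<circ> s \<in> A" if "z \<in> invols n (evenperm s)" for z
  proof -
    show e: "(z \<circ> s) \<circ> s = z" by (simp add: fun_eq_iff s_s)
    have "z \<in> (\<lambda>\<omega>. \<omega> \<circ> s) ` Invs" using bij_invols that unfolding bij_betw_def by simp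
    then obtain \<omega> where "\<omega> \<in> Invs" "z = \<omega> \<circ> s" by (elim imageE)
    then show "z \<circ> s \<in> Invs" by (simp add: comp_assoc s(2))
    then show "z \<circ> s \<in> A" using Invs_carrier by simp
  qed
  have stab: "g \<in> stab (z \<circ> s)" if "z \<in> invols n (evenperm s)" "g \<in> A" "g \<circ> z = z \<circ> g" for z g
    using stab_iff[OF \<omega>(3)[OF that(1)], of g] \<omega>(2)[OF that(1)] that by simp
  have "involution_characters n (evenperm s) F'"
    unfolding involution_characters_def
  proof (intro conjI ballI impI)
    fix z assume z: "z \<in> invols n (evenperm s)"
    show "F' z id = 1" using linear_familyD(1)[OF fam \<omega>(1)[OF z]] unfolding F'_def by (simp add: alt_group_one)
    fix g h assume "g \<in> A" "h \<in> A" "g \<circ> z = z \<circ> g"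
    then have g: "g \<in> stab (z \<circ> s)" using stab[OF z] by simp
    { assume "h \<circ> z = z \<circ> h"
      then have "h \<in> stab (z \<circ> s)" using stab[OF z] \<open>h \<in> A\<close> by simp
      then show "F' z (g \<circ> h) = F' z g * F' z h"
        using linear_familyD(2)[OF fam \<omega>(1)[OF z] g] unfolding F'_def by (simp add: alt_group_mult) }
    have "act h (z \<circ> s) = (act h (z \<circ> s) \<circ> s) \<circ> s" by (simp add: fun_eq_iff s_s)
    also have "\<dots> = (h \<circ> z \<circ> inv' h) \<circ> s" unfolding act_s[OF \<open>h \<in> A\<close> \<omega>(3)[OF z]] \<omega>(2)[OF z] ..
    finally have "F (act h (z \<circ> s)) (h \<circ> g \<circ> inv' h) = F' (h \<circ> z \<circ> inv' h) (h \<circ> g \<circ> inv' h)"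
      unfolding F'_def by simp
    moreover have "F (act h (z \<circ> s)) (h \<otimes>\<^bsub>alt_group n\<^esub> g \<otimes>\<^bsub>alt_group n\<^esub> inv\<^bsub>alt_group n\<^esub> h) = F (z \<circ> s) g"
      by (rule linear_familyD(3)[OF fam \<omega>(1)[OF z] \<open>h \<in> A\<close> g])
    ultimately show "F' (h \<circ> z \<circ> inv' h) (h \<circ> g \<circ> inv' h) = F' z g"
      using inv_alt[OF \<open>h \<in> A\<close>] unfolding F'_def by (simp add: alt_group_mult)
  next
    fix g assume g: "g \<in> A"
    have "(\<Sum>z\<in>{z\<in>invols n (evenperm s). z \<circ> g = g \<circ> z}. F' z g) = (\<Sum>\<omega>\<in>{\<omega>\<in>Invs. act g \<omega> = \<omega>}. F' (\<omega> \<circ> s) g)"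
      by (rule fixed_sum[OF g, symmetric])
    also have "\<dots> = (\<Sum>\<omega>\<in>{\<omega>\<in>Invs. act g \<omega> = \<omega>}. F \<omega> g)"
      by (rule sum.cong) (simp_all add: F'_def comp_assoc s(2))
    finally show "(\<Sum>z\<in>{z\<in>invols n (evenperm s). z \<circ> g = g \<circ> z}. F' z g) = of_nat (card (square_roots n (evenperm s) g))"
      using sum[OF g] twisted_roots_card by simp
  qed
  then show "\<exists>F. involution_characters n (evenperm s) F" by blast
qed

theorem involution_characters_imp_model:
  assumes auto: "\<tau> \<in> auto (alt_group n)" and F: "involution_characters n (evenperm s) F"
    and inv: "inverting n (evenperm s)"
  shows "\<exists>M. generalized_involution_model (alt_group n) \<tau> M"
proof (rule generalized_involution_model_exI[OF auto, of "\<lambda>\<omega>. F (\<omega> \<circ> s)"])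
  show "linear_family (\<lambda>\<omega>. F (\<omega> \<circ> s))"
    unfolding linear_family_def
  proof (intro ballI conjI)
    fix \<omega> assume "\<omega> \<in> Invs"
    then have \<omega>: "\<omega> \<in> A" "\<omega> \<circ> s \<in> invols n (evenperm s)" unfolding Invs_iff by auto
    show "F (\<omega> \<circ> s) \<one>\<^bsub>alt_group n\<^esub> = 1"
      using F \<omega>(2) unfolding involution_characters_def by (simp add: alt_group_one)
    show "F (\<omega> \<circ> s) (g \<otimes>\<^bsub>alt_group n\<^esub> h) = F (\<omega> \<circ> s) g * F (\<omega> \<circ> s) h" if "g \<in> stab \<omega>" "h \<in> stab \<omega>" for g h
      using F \<omega>(2) that stab_iff[OF \<omega>(1)] unfolding involution_characters_def by (simp add: alt_group_mult)
    fix x g assume x: "x \<in> A" and g: "g \<in> stab \<omega>"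
    show "F (act x \<omega> \<circ> s) (x \<otimes>\<^bsub>alt_group n\<^esub> g \<otimes>\<^bsub>alt_group n\<^esub> inv\<^bsub>alt_group n\<^esub> x) = F (\<omega> \<circ> s) g"
      unfolding act_s[OF x \<omega>(1)] inv_alt[OF x] alt_group_mult
      using F \<omega>(2) x g stab_iff[OF \<omega>(1)] unfolding involution_characters_def by blast
  qed
  show "(\<Sum>\<omega>\<in>{\<omega>\<in>Invs. act g \<omega> = \<omega>}. F (\<omega> \<circ> s) g) = of_nat (card (twisted_roots g))" if g: "g \<in> A" for g
    using fixed_sum[OF g, of "\<lambda>z. F z g"] F g twisted_roots_card unfolding involution_characters_def by simp
  show "\<exists>h\<in>A. \<tau> g = h \<otimes>\<^bsub>alt_group n\<^esub> inv\<^bsub>alt_group n\<^esub> g \<otimes>\<^bsub>alt_group n\<^esub> inv\<^bsub>alt_group n\<^esub> h" if "g \<in> A" for g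
    using inv that unfolding group_inverting by blast
qed

end

theorem model_check_imp_characters:
  assumes "n \<le> 7" "model_check n b"
  shows "involution_characters n b cycle_sign" "inverting n b"
proof -
  show "inverting n b" unfolding inverting_def using model_check_sound(2)[OF assms] by blast
  show "involution_characters n b cycle_sign"
    unfolding involution_characters_def
  proof (intro conjI ballI impI)
    fix z assume z: "z \<in> invols n b"
    then have z': "z permutes {1..n}" "z \<circ> z = id" by (auto simp: invols_def)
    show "cycle_sign z id = 1" by (rule cycle_sign_id)
    fix g h assume g: "g \<in> carrier (alt_group n)" "g \<circ> z = z \<circ> g" and h: "h \<in> carrier (alt_group n)"
    show "cycle_sign z (g \<circ> h) = cycle_sign z g * cycle_sign z h" if "h \<circ> z = z \<circ> h"
      by (rule cycle_sign_mult[OF z'(1) altD(1)[OF g(1)] g(2) altD(1)[OF h] that])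
    show "cycle_sign (h \<circ> z \<circ> inv' h) (h \<circ> g \<circ> inv' h) = cycle_sign z g"
      by (rule cycle_sign_conj[OF assms(1) z' altD(1)[OF g(1)] g(2) altD(1)[OF h]])
  next
    fix g assume g: "g \<in> carrier (alt_group n)"
    have "{z \<in> invols n b. z \<circ> g = g \<circ> z} = {z. z permutes {1..n} \<and> z \<circ> z = id \<and> evenperm z = b \<and> z \<circ> g = g \<circ> z}"
      by (auto simp: invols_def)
    then show "(\<Sum>z\<in>{z\<in>invols n b. z \<circ> g = g \<circ> z}. cycle_sign z g) = of_nat (card (square_roots n b g))"
      using model_check_sound(1)[OF assms altD(1,2)[OF g]] by (simp add: square_roots_def)
  qed
qed

section \<open>Automorphisms of alternating groups that preserve 3-cycles\<close>

definition three_cycle :: "nat \<Rightarrow> nat \<Rightarrow> nat \<Rightarrow> nat \<Rightarrow> nat" where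
  "three_cycle a b c = Transposition.transpose a b \<circ> Transposition.transpose b c"

lemma three_cycle_apply:
  assumes "distinct [a, b, c]"
  shows "three_cycle a b c i = (if i = a then b else if i = b then c else if i = c then a else i)"
  using assms by (auto simp: three_cycle_def transpose_def)

lemma three_cycle_rotate: "distinct [a, b, c] \<Longrightarrow> three_cycle a b c = three_cycle b c a"
  by (rule ext) (simp add: three_cycle_apply)

lemma three_cycle_permutes: "{a, b, c} \<subseteq> S \<Longrightarrow> three_cycle a b c permutes S"
  unfolding three_cycle_def by (intro permutes_compose permutes_swap_id) auto

lemma three_cycle_alt: "distinct [a, b, c] \<Longrightarrow> {a, b, c} \<subseteq> {1..n} \<Longrightarrow> three_cycle a b c \<in> carrier (alt_group n)"
  unfolding alt_group_carrier
  by (intro conjI three_cycle_permutes)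
    (auto simp: three_cycle_def evenperm_comp permutation_swap_id evenperm_swap)

lemma three_cycle_inv:
  assumes "distinct [a, b, c]"
  shows "inv' (three_cycle a b c) = three_cycle c b a"
proof (rule inv_unique_comp)
  have d: "distinct [c, b, a]" using assms by auto
  show "three_cycle a b c \<circ> three_cycle c b a = id" "three_cycle c b a \<circ> three_cycle a b c = id"
    using assms by (auto simp: fun_eq_iff three_cycle_apply[OF assms] three_cycle_apply[OF d])
qed

lemma three_cycle_conj:
  assumes x: "x permutes S" and d: "distinct [a, b, c]"
  shows "x \<circ> three_cycle a b c \<circ> inv' x = three_cycle (x a) (x b) (x c)"
proof
  fix i
  have ne: "x u = x v \<longleftrightarrow> u = v" for u v using permutes_inj[OF x] by (rule inj_eq)
  have d': "distinct [x a, x b, x c]" using d by (simp add: ne)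
  obtain j where "i = x j" using permutes_surj[OF x] by (metis surjD)
  then show "(x \<circ> three_cycle a b c \<circ> inv' x) i = three_cycle (x a) (x b) (x c) i"
    unfolding three_cycle_apply[OF d'] by (simp add: permutes_inverses[OF x] three_cycle_apply[OF d] ne)
qed

lemma three_cycle_from:
  assumes d: "distinct [x, y, z]" and q: "q = three_cycle x y z" and u: "q u \<noteq> u"
  shows "distinct [u, q u, q (q u)]" "q = three_cycle u (q u) (q (q u))"
proof -
  have "u = x \<or> u = y \<or> u = z" using u unfolding q three_cycle_apply[OF d] by presburger
  then have "(q u, q (q u)) \<in> {(y, z)} \<and> u = x \<or> (q u, q (q u)) \<in> {(z, x)} \<and> u = y \<or> (q u, q (q u)) \<in> {(x, y)} \<and> u = z"
    using d unfolding q three_cycle_apply[OF d] by auto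
  then show "distinct [u, q u, q (q u)]" "q = three_cycle u (q u) (q (q u))"
    using d three_cycle_rotate[of x y z] three_cycle_rotate[of y z x] q by auto
qed

text \<open>Two 3-cycles whose product is an involution agree at one point: they have the form
  \<open>(u v w)\<close> and \<open>(u v e)\<close> with four different points.\<close>

lemma three_cycle_pair:
  assumes d: "distinct [a, b, c]" and d': "distinct [x, y, z]"
    and p: "p = three_cycle a b c" and q: "q = three_cycle x y z"
    and inv: "\<And>i. p (q (p (q i))) = i" and ne: "p \<circ> q \<noteq> id"
  obtains e where "e \<notin> {a, b, c}"
    "q = three_cycle a b e \<or> q = three_cycle b c e \<or> q = three_cycle c a e"
proof -
  have pa: "p a = b" "p b = c" "p c = a" using d by (auto simp: p three_cycle_apply[OF d])
  have pinj: "p i = p j \<longleftrightarrow> i = j" for i j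
    unfolding p using permutes_inj[OF three_cycle_permutes[of a b c UNIV]] by (simp add: inj_eq)
  show ?thesis
  proof (cases "q a = a \<or> q b = b \<or> q c = c")
    case True
    have fixed: "q v = w \<and> (\<exists>e. e \<notin> {u, v, w} \<and> q = three_cycle v w e)"
      if u: "q u = u" and uvw: "p u = v" "p v = w" "p w = u" "u \<noteq> v" "v \<noteq> w" "u \<noteq> w" for u v w
    proof -
      have "p (q v) = p w" using inv[of u] u uvw by simp
      then have qv: "q v = w" using pinj by simp
      note f = three_cycle_from[OF d' q, of v]
      have "q (q v) \<noteq> u"
      proof
        assume "q (q v) = u"
        then have "q (q (q v)) = u" using u by simp
        moreover have "q (q (q v)) = v" using f qv uvw three_cycle_apply[OF f(1), of "q (q v)"] by simp
        ultimately show False using uvw by simp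
      qed
      then show ?thesis using f qv uvw by (intro conjI exI[of _ "q (q v)"]) auto
    qed
    from True show ?thesis
    proof (elim disjE)
      assume "q a = a"
      then show ?thesis using fixed[of a b c] pa d that by auto
    next
      assume "q b = b"
      then show ?thesis using fixed[of b c a] pa d that by auto
    next
      assume "q c = c"
      then show ?thesis using fixed[of c a b] pa d that by auto
    qed
  next
    case False
    note f = three_cycle_from[OF d' q, of a]
    have qa: "q a \<noteq> a" and qbc: "q b \<noteq> b" "q c \<noteq> c" using False by auto
    have "b \<in> {a, q a, q (q a)}" "c \<in> {a, q a, q (q a)}"
      using qbc f(2)[OF qa] three_cycle_apply[OF f(1)[OF qa]] by (metis insertCI)+
    then have "q a = b \<and> q (q a) = c \<or> q a = c \<and> q (q a) = b" using d by auto
    then show ?thesis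
    proof
      assume "q a = b \<and> q (q a) = c"
      then have "q a = b" "q c = a"
        using three_cycle_apply[OF f(1)[OF qa], of c] f(2)[OF qa] d by auto
      then have "p (q (p (q a))) = b" using pa by simp
      then show ?thesis using inv[of a] d by simp
    next
      assume h: "q a = c \<and> q (q a) = b"
      then have "q = three_cycle c b a" using f(2)[OF qa] three_cycle_rotate[of a c b] d by auto
      then have "p \<circ> q = id" unfolding p using three_cycle_inv[OF d]
          permutes_inv_o(1)[OF three_cycle_permutes[of a b c UNIV]] by simp
      then show ?thesis using ne by simp
    qed
  qed
qed

lemma three_cycle_eq_iff:
  assumes "distinct [a, b, c]" "distinct [a, b, d]"
  shows "three_cycle a b c = three_cycle a b d \<longleftrightarrow> c = d"
proof -
  have "three_cycle a b c b = c" "three_cycle a b d b = d" using assms by (simp_all add: three_cycle_apply)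
  then show ?thesis by metis
qed

text \<open>Conjugating the 3-cycles \<open>(1 2 k)\<close> by each other yields all 3-cycles: \<open>(1 2 l)\<close> or its
  inverse removes one of the points 1 and 2, and a second conjugation the other one.\<close>

lemma generate_from_star:
  assumes n: "n \<ge> 3" and S: "S \<subseteq> carrier (alt_group n)"
    and mult: "\<And>g h. g \<in> S \<Longrightarrow> h \<in> S \<Longrightarrow> g \<circ> h \<in> S" and inv: "\<And>g. g \<in> S \<Longrightarrow> inv' g \<in> S"
    and id: "id \<in> S" and star: "\<And>k. k \<in> {3..n} \<Longrightarrow> three_cycle 1 2 k \<in> S"
  shows "S = carrier (alt_group n)"
proof -
  define P where "P a b c \<longleftrightarrow> three_cycle a b c \<in> S" for a b c
  have rot: "P b c a" if "P a b c" "distinct [a, b, c]" for a b c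
    using that three_cycle_rotate[of a b c] unfolding P_def by simp
  have rev: "P c b a" if "P a b c" "distinct [a, b, c]" for a b c
    using inv[of "three_cycle a b c"] three_cycle_inv[of a b c] that unfolding P_def by simp
  have conj: "P (three_cycle a b c u) (three_cycle a b c v) (three_cycle a b c w)"
    if "P a b c" "P u v w" "distinct [u, v, w]" for a b c u v w
  proof -
    have "three_cycle a b c permutes {1..n}" using that S unfolding P_def by (auto simp: alt_group_carrier)
    from three_cycle_conj[OF this that(3)] show ?thesis
      using mult inv that(1,2) unfolding P_def by metis
  qed
  have 12: "P 1 2 k" if "k \<in> {3..n}" for k using star[OF that] unfolding P_def .
  have 2: "P 2 l k" if "k \<in> {3..n}" "l \<in> {3..n}" "k \<noteq> l" for k l
    using conj[OF 12[OF that(2)] 12[OF that(1)]] that by (simp add: three_cycle_apply)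
  have 1: "P l 1 k" if "k \<in> {3..n}" "l \<in> {3..n}" "k \<noteq> l" for k l
    using conj[OF rev[OF 12[OF that(2)]] 12[OF that(1)]] that by (simp add: three_cycle_apply)
  have 0: "P l m k" if "k \<in> {3..n}" "l \<in> {3..n}" "m \<in> {3..n}" "k \<noteq> l" "l \<noteq> m" "k \<noteq> m" for k l m
    using conj[OF rev[OF 12[OF that(3)]] 1[OF that(1,2,4)]] that by (simp add: three_cycle_apply)
  have first: "P a b c" if abc: "distinct [a, b, c]" "{a, b, c} \<subseteq> {1..n}" "b \<notin> {1, 2}" "c \<notin> {1, 2} \<or> a \<in> {1, 2}" for a b c
  proof -
    have b: "b \<in> {3..n}" using abc by auto
    consider "a = 1" "c = 2" | "a = 2" "c = 1" | "a = 1" "c \<in> {3..n}" | "a = 2" "c \<in> {3..n}" | "a \<in> {3..n}" "c \<in> {3..n}"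
    proof -
      have "a = 1 \<or> a = 2 \<or> a \<in> {3..n}" "c = 1 \<or> c = 2 \<or> c \<in> {3..n}" "a \<noteq> c" using abc(1,2) by auto
      then show thesis using abc(4) that by auto
    qed
    then show ?thesis
    proof cases
      case 1
      then show ?thesis using rot[OF rot[OF rev[OF 12[OF b]]]] rev[OF rot[OF 12[OF b]]] rev[OF 12[OF b]] rot b by auto
    next
      case 2
      then show ?thesis using rot[OF 12[OF b]] b by auto
    next
      case 3
      then show ?thesis using 1[of b c] rot abc b by auto
    next
      case 4
      then show ?thesis using 2[of c b] abc b by auto
    next
      case 5
      then show ?thesis using 0[of c a b] abc b by auto
    qed
  qed
  have all: "P a b c" if abc: "distinct [a, b, c]" "{a, b, c} \<subseteq> {1..n}" for a b c
  proof -
    have cases: "b \<notin> {1, 2} \<and> (c \<notin> {1, 2} \<or> a \<in> {1, 2}) \<or> c \<notin> {1, 2} \<and> (a \<notin> {1, 2} \<or> b \<in> {1, 2}) \<or>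
        a \<notin> {1, 2} \<and> (b \<notin> {1, 2} \<or> c \<in> {1, 2})" using abc by auto
    have r1: "P a b c" if "P b c a" using rot[OF rot[OF that]] abc by auto
    have r2: "P a b c" if "P c a b" using rot[OF that] abc by auto
    show ?thesis using cases first[of a b c] first[of b c a] first[of c a b] r1 r2 abc by auto
  qed
  have "three_cycles n \<subseteq> S"
  proof
    fix p assume "p \<in> three_cycles n"
    then obtain cs where cs: "p = cycle_of_list cs" "cycle cs" "length cs = 3" "set cs \<subseteq> {1..n}" by auto
    then obtain a b c where abc: "cs = [a, b, c]" using stupid_lemma[OF cs(3)] by auto
    have "p = three_cycle a b c" unfolding cs(1) abc three_cycle_def by simp
    then show "p \<in> S" using all[of a b c] cs abc unfolding P_def by auto
  qed
  moreover have "subgroup S (alt_group n)"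
  proof -
    interpret group "alt_group n" by (rule alt_group_is_group)
    show ?thesis
      by (rule subgroupI) (use S id mult inv alt_group_inv_equality in \<open>auto simp: alt_group_mult\<close>)
  qed
  ultimately have "generate (alt_group n) (three_cycles n) \<subseteq> S"
    using group.generate_subgroup_incl[OF alt_group_is_group] by blast
  then show ?thesis using S alt_group_carrier_as_three_cycles by blast
qed

text \<open>The group is generated by the 3-cycles \<open>(1 2 k)\<close>. Their images \<open>t k\<close> are 3-cycles whose
  pairwise products are involutions, so any two of them agree at one point. The point \<open>a\<close> and
  its image \<open>b\<close> shared by \<open>t 3\<close> and \<open>t 4\<close> are shared by all, because other ways to agree with
  both are incompatible; so \<open>t k = (a b (e k))\<close>, and \<open>s\<close> is the relabelling \<open>1 \<mapsto> a\<close>, \<open>2 \<mapsto> b\<close>,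
  \<open>k \<mapsto> e k\<close>.\<close>

theorem automorphism_preserving_three_cycles:
  assumes n: "n \<ge> 4" and hom: "\<tau> \<in> hom (alt_group n) (alt_group n)" and inj: "inj_on \<tau> (carrier (alt_group n))"
    and three: "\<And>a b c. distinct [a, b, c] \<Longrightarrow> {a, b, c} \<subseteq> {1..n} \<Longrightarrow>
      \<exists>x y z. distinct [x, y, z] \<and> {x, y, z} \<subseteq> {1..n} \<and> \<tau> (three_cycle a b c) = three_cycle x y z"
  obtains s where "s permutes {1..n}" "\<And>g. g \<in> carrier (alt_group n) \<Longrightarrow> \<tau> g = s \<circ> g \<circ> inv' s"
proof -
  let ?A = "carrier (alt_group n)"
  interpret group "alt_group n" by (rule alt_group_is_group)
  have mult: "\<tau> (g \<circ> h) = \<tau> g \<circ> \<tau> h" if "g \<in> ?A" "h \<in> ?A" for g h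
    using hom_mult[OF hom that] by (simp add: alt_group_mult)
  have one: "\<tau> id = id" using hom_one[OF hom is_group] by (simp add: alt_group_one)
  have closed: "g \<circ> h \<in> ?A" if "g \<in> ?A" "h \<in> ?A" for g h using m_closed[OF that] by (simp add: alt_group_mult)
  define t where "t k = \<tau> (three_cycle 1 2 k)" for k
  have cA: "three_cycle 1 2 k \<in> ?A" if "k \<in> {3..n}" for k by (rule three_cycle_alt) (use that in auto)
  have t3: "\<exists>x y z. distinct [x, y, z] \<and> {x, y, z} \<subseteq> {1..n} \<and> t k = three_cycle x y z" if "k \<in> {3..n}" for k
    unfolding t_def by (rule three) (use that in auto)
  have tinj: "k = l" if "k \<in> {3..n}" "l \<in> {3..n}" "t k = t l" for k l
  proof -
    have "three_cycle 1 2 k = three_cycle 1 2 l" using inj_onD[OF inj] that cA unfolding t_def by blast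
    then show ?thesis using three_cycle_eq_iff[of 1 2 k l] that by auto
  qed
  have tinv: "t k (t l (t k (t l i))) = i" and tne: "t k \<circ> t l \<noteq> id"
    if kl: "k \<in> {3..n}" "l \<in> {3..n}" "k \<noteq> l" for k l i
  proof -
    define c where "c = three_cycle 1 2 k \<circ> three_cycle 1 2 l"
    have cc: "c \<in> ?A" unfolding c_def by (rule closed[OF cA[OF kl(1)] cA[OF kl(2)]])
    have tc: "\<tau> c = t k \<circ> t l" unfolding c_def t_def by (rule mult[OF cA[OF kl(1)] cA[OF kl(2)]])
    have "c \<circ> c = id" unfolding c_def using kl by (auto simp: fun_eq_iff three_cycle_apply)
    then have "\<tau> c \<circ> \<tau> c = id" using mult[OF cc cc] one by simp
    then show "t k (t l (t k (t l i))) = i" unfolding tc by (metis comp_apply id_apply)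
    have "c 1 = k" unfolding c_def using kl by (simp add: three_cycle_apply)
    then have "c \<noteq> id" using kl(1) by auto
    then have "\<tau> c \<noteq> id" using inj_onD[OF inj, of c id] one cc one_closed by (auto simp: alt_group_one)
    then show "t k \<circ> t l \<noteq> id" unfolding tc .
  qed
  have pair: "\<exists>e. e \<notin> {a, b, c} \<and> (t l = three_cycle a b e \<or> t l = three_cycle b c e \<or> t l = three_cycle c a e)"
    if kl: "k \<in> {3..n}" "l \<in> {3..n}" "k \<noteq> l" and p: "distinct [a, b, c]" "t k = three_cycle a b c" for k l a b c
  proof -
    obtain x y z where xyz: "distinct [x, y, z]" "t l = three_cycle x y z" using t3[OF kl(2)] by blast
    show ?thesis
      by (rule three_cycle_pair[OF p(1) xyz(1) p(2) xyz(2) tinv[OF kl] tne[OF kl]]) blast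
  qed
  have 34: "3 \<in> {3..n}" "4 \<in> {3..n}" "(3::nat) \<noteq> 4" using n by auto
  obtain a0 b0 c0 where abc0: "distinct [a0, b0, c0]" "t 3 = three_cycle a0 b0 c0" using t3[OF 34(1)] by blast
  have "\<exists>a b c d. distinct [a, b, c, d] \<and> t 3 = three_cycle a b c \<and> t 4 = three_cycle a b d"
  proof -
    obtain e where e: "e \<notin> {a0, b0, c0}"
      "t 4 = three_cycle a0 b0 e \<or> t 4 = three_cycle b0 c0 e \<or> t 4 = three_cycle c0 a0 e"
      using pair[OF 34 abc0] by blast
    have r: "t 3 = three_cycle b0 c0 a0" "t 3 = three_cycle c0 a0 b0"
      using abc0 three_cycle_rotate[of a0 b0 c0] three_cycle_rotate[of b0 c0 a0] by auto
    from e(2) show ?thesis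
    proof (elim disjE)
      assume "t 4 = three_cycle a0 b0 e"
      then show ?thesis using abc0 e(1) by (intro exI[of _ a0] exI[of _ b0] exI[of _ c0] exI[of _ e]) auto
    next
      assume "t 4 = three_cycle b0 c0 e"
      then show ?thesis using abc0 e(1) r by (intro exI[of _ b0] exI[of _ c0] exI[of _ a0] exI[of _ e]) auto
    next
      assume "t 4 = three_cycle c0 a0 e"
      then show ?thesis using abc0 e(1) r by (intro exI[of _ c0] exI[of _ a0] exI[of _ b0] exI[of _ e]) auto
    qed
  qed
  then obtain a b c d where abcd: "distinct [a, b, c, d]" "t 3 = three_cycle a b c" "t 4 = three_cycle a b d" by blast
  have "\<exists>e. e \<notin> {a, b} \<and> t k = three_cycle a b e" if k: "k \<in> {3..n}" for k
  proof -
    consider "k = 3" | "k = 4" | "k \<noteq> 3" "k \<noteq> 4" by auto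
    then show ?thesis
    proof cases
      case 1
      then show ?thesis using abcd by (intro exI[of _ c]) auto
    next
      case 2
      then show ?thesis using abcd by (intro exI[of _ d]) auto
    next
      case 3
      have dc: "distinct [a, b, c]" "distinct [a, b, d]" using abcd(1) by auto
      obtain e where e: "e \<notin> {a, b, c}" "t k = three_cycle a b e \<or> t k = three_cycle b c e \<or> t k = three_cycle c a e"
        using pair[OF 34(1) k _ dc(1) abcd(2)] 3 by metis
      obtain f where f: "f \<notin> {a, b, d}" "t k = three_cycle a b f \<or> t k = three_cycle b d f \<or> t k = three_cycle d a f"
        using pair[OF 34(2) k _ dc(2) abcd(3)] 3 by metis
      have v1: "distinct [u, v, w] \<Longrightarrow> three_cycle u v w u = v" for u v w by (simp add: three_cycle_apply)
      have v2: "distinct [u, v, w] \<Longrightarrow> i \<notin> {u, v, w} \<Longrightarrow> three_cycle u v w i = i" for u v w i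
        by (simp add: three_cycle_apply)
      have v3: "distinct [u, v, w] \<Longrightarrow> three_cycle u v w v = w" for u v w by (simp add: three_cycle_apply)
      have df: "distinct [a, b, f]" "distinct [b, d, f]" "distinct [d, a, f]" using f(1) abcd(1) by auto
      have de: "distinct [b, c, e]" "distinct [c, a, e]" using e(1) abcd(1) by auto
      have "t k \<noteq> three_cycle b c e"
      proof
        assume h: "t k = three_cycle b c e"
        have "t k a = a" unfolding h by (rule v2[OF de(1)]) (use e(1) abcd(1) in auto)
        moreover have "t k b = c" unfolding h by (rule v1[OF de(1)])
        moreover have "three_cycle a b f a = b" by (rule v1[OF df(1)])
        moreover have "three_cycle b d f b = d" by (rule v1[OF df(2)])
        moreover have "three_cycle d a f a = f" by (rule v3[OF df(3)])
        ultimately show False using f abcd(1) by (metis distinct_length_2_or_more insertCI)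
      qed
      moreover have "t k \<noteq> three_cycle c a e"
      proof
        assume h: "t k = three_cycle c a e"
        have 1: "t k b = b" unfolding h by (rule v2[OF de(2)]) (use e(1) abcd(1) in auto)
        have 2: "t k c = a" unfolding h by (rule v1[OF de(2)])
        have "three_cycle a b f b = f" by (rule v3[OF df(1)])
        moreover have "three_cycle b d f b = d" by (rule v1[OF df(2)])
        ultimately have "t k = three_cycle d a f" using f 1 abcd(1) by (metis distinct_length_2_or_more insertCI)
        then have "t k d = a" using v1[OF df(3)] by simp
        moreover have "inj (t k)" using t3[OF k] permutes_inj three_cycle_permutes by metis
        ultimately show False using 2 abcd(1) by (metis distinct_length_2_or_more injD)
      qed
      ultimately show ?thesis using e by auto
    qed
  qed
  then obtain e where e: "\<And>k. k \<in> {3..n} \<Longrightarrow> e k \<notin> {a, b} \<and> t k = three_cycle a b (e k)" by metis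
  have in_n: "{a, b, e k} \<subseteq> {1..n}" if k: "k \<in> {3..n}" for k
  proof -
    obtain x y z where xyz: "distinct [x, y, z]" "{x, y, z} \<subseteq> {1..n}" "t k = three_cycle x y z" using t3[OF k] by blast
    have d: "distinct [a, b, e k]" using e[OF k] abcd(1) by auto
    have "t k a \<noteq> a" "t k b \<noteq> b" "t k (e k) \<noteq> e k"
      using e[OF k] three_cycle_apply[OF d] d by auto
    moreover have "t k permutes {1..n}" unfolding xyz(3) by (rule three_cycle_permutes[OF xyz(2)])
    ultimately show ?thesis using permutes_not_in[of "t k" "{1..n}"] by (simp only: insert_subset) blast
  qed
  \<comment> \<open>The image of k is the third point of t k.\<close>
  define s where "s i = (if i = 1 then a else if i = 2 then b else if i \<in> {3..n} then e i else i)" for i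
  have "inj_on s {1..n}"
  proof (rule inj_onI)
    fix i j assume ij: "i \<in> {1..n}" "j \<in> {1..n}" "s i = s j"
    have c: "i = 1 \<or> i = 2 \<or> i \<in> {3..n}" "j = 1 \<or> j = 2 \<or> j \<in> {3..n}" using ij by auto
    have eij: "e i = e j \<Longrightarrow> i \<in> {3..n} \<Longrightarrow> j \<in> {3..n} \<Longrightarrow> i = j" using e tinj by metis
    have eab: "e k \<noteq> a" "e k \<noteq> b" "a \<noteq> e k" "b \<noteq> e k" if "k \<in> {3..n}" for k using e[OF that] by auto
    have s1: "s (Suc 0) = a" "s 2 = b" and s3: "k \<in> {3..n} \<Longrightarrow> s k = e k" for k unfolding s_def by auto
    have ab: "a \<noteq> b" "b \<noteq> a" using abcd(1) by auto
    show "i = j" using c ij(3) ab eij eab[of i] eab[of j] by (elim disjE) (simp_all add: s1 s3)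
  qed
  moreover have "s ` {1..n} \<subseteq> {1..n}"
  proof
    fix j assume "j \<in> s ` {1..n}"
    then obtain i where i: "i \<in> {1..n}" "j = s i" by blast
    have ab: "a \<in> {1..n}" "b \<in> {1..n}" using in_n[OF 34(1)] by auto
    have "e i \<in> {1..n}" if "i \<in> {3..n}" using in_n[OF that] by auto
    then show "j \<in> {1..n}" using i ab unfolding s_def by presburger
  qed
  ultimately have "bij_betw s {1..n} {1..n}" by (simp add: bij_betw_def endo_inj_surj)
  then have s: "s permutes {1..n}" by (rule bij_imp_permutes) (use n in \<open>auto simp: s_def\<close>)
  define S where "S = {g \<in> ?A. \<tau> g = s \<circ> g \<circ> inv' s}"
  have "S = ?A"
  proof (rule generate_from_star)
    show "n \<ge> 3" using n by simp
    show "S \<subseteq> ?A" unfolding S_def by auto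
    show "id \<in> S" using one one_closed s unfolding S_def by (simp add: alt_group_one permutes_inv_o)
    show "g \<circ> h \<in> S" if "g \<in> S" "h \<in> S" for g h
      using that closed mult conj_comp[OF s, of g h] unfolding S_def by auto
    show "inv' g \<in> S" if g: "g \<in> S" for g
    proof -
      have gA: "g \<in> ?A" and \<tau>g: "\<tau> g = s \<circ> g \<circ> inv' s" using g unfolding S_def by auto
      have gp: "g permutes {1..n}" using gA by (simp add: alt_group_carrier)
      have iA: "inv' g \<in> ?A" using inv_closed[OF gA] alt_group_inv_equality[OF gA] by simp
      have "\<tau> (inv' g) \<circ> \<tau> g = id" using mult[OF iA gA] one permutes_inv_o(2)[OF gp] by simp
      moreover have "(s \<circ> inv' g \<circ> inv' s) \<circ> \<tau> g = id"
        unfolding \<tau>g conj_comp[OF s] permutes_inv_o(2)[OF gp] using permutes_inv_o(1)[OF s] by simp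
      moreover have "X = inv' (\<tau> g)" if "X \<circ> \<tau> g = id" for X
      proof -
        have "\<tau> g permutes {1..n}" unfolding \<tau>g by (rule permutes_conj[OF s gp])
        then have "X = X \<circ> (\<tau> g \<circ> inv' (\<tau> g))" using permutes_inv_o(1) by fastforce
        also have "\<dots> = (X \<circ> \<tau> g) \<circ> inv' (\<tau> g)" by (simp only: o_assoc)
        finally show ?thesis unfolding that by simp
      qed
      ultimately have "\<tau> (inv' g) = s \<circ> inv' g \<circ> inv' s" by metis
      then show ?thesis using iA unfolding S_def by simp
    qed
    show "three_cycle 1 2 k \<in> S" if k: "k \<in> {3..n}" for k
    proof -
      have "s \<circ> three_cycle 1 2 k \<circ> inv' s = three_cycle (s 1) (s 2) (s k)"
        by (rule three_cycle_conj[OF s]) (use k in auto)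
      also have "\<dots> = three_cycle a b (e k)" using k by (simp add: s_def)
      finally show ?thesis using e[OF k] cA[OF k] unfolding S_def t_def by simp
    qed
  qed
  then show ?thesis using that[OF s] unfolding S_def by blast
qed

section \<open>Permutations whose cycles have distinct odd lengths\<close>

lemma even_of_odd_order:
  assumes u: "permutation u" and N: "odd N" and pow: "u ^^ N = id"
  shows "evenperm u"
proof -
  have "permutation (u ^^ k) \<and> sign (u ^^ k) = sign u ^ k" for k
  proof (induction k)
    case (Suc k)
    have "u ^^ Suc k = u \<circ> (u ^^ k)" by simp
    then show ?case using Suc u by (simp only: permutation_compose sign_compose power_Suc)
  qed (simp add: permutation_id)
  then have "sign u ^ N = 1" using pow by (metis sign_id)
  then show ?thesis using N by (cases u rule: sign_cases) (auto simp: sign_def split: if_splits)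
qed

text \<open>Here \<open>L i\<close> is the length of the cycle of \<open>g\<close> through \<open>i\<close>. If different cycles have
  different lengths, a permutation commuting with \<open>g\<close> maps every cycle to itself and acts on it
  as a power of \<open>g\<close>; if the lengths are odd, it has odd order.\<close>

lemma commuting_even:
  fixes n :: nat
  assumes u: "u permutes {1..n}" and comm: "u \<circ> g = g \<circ> u"
    and L: "\<And>i k. i \<in> {1..n} \<Longrightarrow> odd (L i) \<and> ((g ^^ k) i = i \<longleftrightarrow> L i dvd k)"
    and orb: "\<And>i j. i \<in> {1..n} \<Longrightarrow> j \<in> {1..n} \<Longrightarrow> L i = L j \<Longrightarrow> \<exists>k. j = (g ^^ k) i"
  shows "evenperm u"
proof (rule even_of_odd_order)
  have un: "u i \<in> {1..n} \<longleftrightarrow> i \<in> {1..n}" for i using permutes_in_image[OF u] .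
  have ug: "u ((g ^^ k) i) = (g ^^ k) (u i)" for k i
    by (induction k) (use comm in \<open>auto simp: fun_eq_iff\<close>)
  have fixed: "(u ^^ L i) i = i" if i: "i \<in> {1..n}" for i
  proof -
    have ui: "u i \<in> {1..n}" using un i by blast
    have "(g ^^ k) i = i \<longleftrightarrow> (g ^^ k) (u i) = u i" for k
      unfolding ug[symmetric] using permutes_inj[OF u] by (simp add: inj_eq)
    then have "L i dvd k \<longleftrightarrow> L (u i) dvd k" for k using L[OF i] L[OF ui] by simp
    then have "L i = L (u i)" by (meson dvd_antisym dvd_refl)
    then obtain k where k: "u i = (g ^^ k) i" using orb[OF i ui] by blast
    have "(u ^^ m) i = (g ^^ (m * k)) i" for m
      by (induction m) (auto simp: ug k funpow_add[symmetric, THEN fun_cong, simplified] add.commute)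
    then show ?thesis using L[OF i, of "L i * k"] by simp
  qed
  define N where "N = (\<Prod>i\<in>{1..n}. L i)"
  have "odd (L i)" if "i \<in> {1..n}" for i using L[OF that] by blast
  then show "odd N" unfolding N_def by (subst even_prod_iff) auto
  show "u ^^ N = id"
  proof
    fix i
    show "(u ^^ N) i = id i"
    proof (cases "i \<in> {1..n}")
      case True
      then obtain m where "N = L i * m" unfolding N_def using dvd_prodI[of "{1..n}" i L] by (auto simp: dvd_def)
      moreover have "((u ^^ L i) ^^ m) i = i" by (induction m) (use fixed[OF True] in auto)
      ultimately show ?thesis by (simp add: funpow_mult mult.commute)
    next
      case False
      have "(u ^^ m) i = i" for m by (induction m) (use permutes_not_in[OF u False] in auto)
      then show ?thesis by simp
    qed
  qed
  show "permutation u" using u permutation_permutes by blast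
qed

text \<open>The numbers after \<open>a\<close> are cut into consecutive intervals with the lengths in the list; the
  result is the number before the interval of \<open>i\<close>, and the length of that interval.\<close>

fun block :: "nat \<Rightarrow> nat list \<Rightarrow> nat \<Rightarrow> nat \<times> nat" where
  "block a [] i = (0, 0)"
| "block a (l # ls) i = (if i \<le> a + l then (a, l) else block (a + l) ls i)"

lemma block_props:
  assumes "a < i" "i \<le> a + sum_list ls" "block a ls i = (s, l)"
  shows "a \<le> s \<and> s < i \<and> i \<le> s + l \<and> s + l \<le> a + sum_list ls \<and> l \<in> set ls \<and>
    (\<forall>j. s < j \<and> j \<le> s + l \<longrightarrow> block a ls j = (s, l))"
  using assms
proof (induction ls arbitrary: a)
  case (Cons m ls)
  show ?case
  proof (cases "i \<le> a + m")
    case False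
    then have IH: "a + m \<le> s \<and> s < i \<and> i \<le> s + l \<and> s + l \<le> a + m + sum_list ls \<and> l \<in> set ls \<and>
      (\<forall>j. s < j \<and> j \<le> s + l \<longrightarrow> block (a + m) ls j = (s, l))"
      using Cons.prems by (intro Cons.IH) simp_all
    have "block a (m # ls) j = (s, l)" if "s < j" "j \<le> s + l" for j using IH that by simp
    then show ?thesis using IH by simp
  next
    case True
    then have "s = a" "l = m" using Cons.prems(3) by simp_all
    then show ?thesis using True Cons.prems(1) by simp
  qed
qed simp

lemma block_start_unique:
  assumes "distinct ls" "a < i" "i \<le> a + sum_list ls" "a < j" "j \<le> a + sum_list ls"
    "block a ls i = (s, l)" "block a ls j = (s', l)"
  shows "s = s'"
  using assms
proof (induction ls arbitrary: a)
  case (Cons m ls)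
  show ?case
  proof (cases "i \<le> a + m"; cases "j \<le> a + m")
    assume "i \<le> a + m" "\<not> j \<le> a + m"
    then have "l = m" "block (a + m) ls j = (s', l)" using Cons.prems by auto
    then have "l \<in> set ls" using block_props[of "a + m" j ls s' l] Cons.prems \<open>\<not> j \<le> a + m\<close> by auto
    then show ?thesis using \<open>l = m\<close> Cons.prems(1) by simp
  next
    assume "\<not> i \<le> a + m" "j \<le> a + m"
    then have "l = m" "block (a + m) ls i = (s, l)" using Cons.prems by auto
    then have "l \<in> set ls" using block_props[of "a + m" i ls s l] Cons.prems \<open>\<not> i \<le> a + m\<close> by auto
    then show ?thesis using \<open>l = m\<close> Cons.prems(1) by simp
  next
    assume "\<not> i \<le> a + m" "\<not> j \<le> a + m"
    then show ?thesis using Cons.IH[of "a + m"] Cons.prems by auto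
  qed (use Cons.prems in auto)
qed simp

text \<open>The permutation whose cycles are the intervals, each traversed in increasing order.\<close>

definition rotation :: "nat list \<Rightarrow> nat \<Rightarrow> nat" where
  "rotation ls i = (if i \<in> {1..sum_list ls} then let (s, l) = block 0 ls i in s + 1 + (i - s) mod l else i)"

definition reflection :: "nat list \<Rightarrow> nat \<Rightarrow> nat" where
  "reflection ls i = (if i \<in> {1..sum_list ls} then let (s, l) = block 0 ls i in 2 * s + l + 1 - i else i)"

context
  fixes ls :: "nat list" and n :: nat
  assumes n: "sum_list ls = n"
begin

lemma block_mem:
  assumes "i \<in> {1..n}" "block 0 ls i = (s, l)"
  shows "s < i" "i \<le> s + l" "s + l \<le> n" "l \<in> set ls"
    "s < j \<Longrightarrow> j \<le> s + l \<Longrightarrow> j \<in> {1..n} \<and> block 0 ls j = (s, l)"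
  using block_props[of 0 i ls s l] assms n by auto

lemma block_cases:
  assumes "i \<in> {1..n}"
  obtains s l where "block 0 ls i = (s, l)" "s < i" "i \<le> s + l" "s + l \<le> n" "l \<in> set ls"
    "\<And>j. s < j \<Longrightarrow> j \<le> s + l \<Longrightarrow> j \<in> {1..n} \<and> block 0 ls j = (s, l)"
proof -
  obtain s l where sl: "block 0 ls i = (s, l)" by (cases "block 0 ls i")
  show ?thesis by (rule that[OF sl block_mem[OF assms sl]])
qed

lemma rotation_power:
  assumes "i \<in> {1..n}" "block 0 ls i = (s, l)"
  shows "(rotation ls ^^ k) i = s + 1 + (i - s - 1 + k) mod l"
proof -
  have sl: "s < i" "i \<le> s + l" and blk: "\<And>j. s < j \<Longrightarrow> j \<le> s + l \<Longrightarrow> j \<in> {1..n} \<and> block 0 ls j = (s, l)"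
    by (rule block_mem[OF assms])+
  have l: "l > 0" using sl by simp
  show ?thesis
  proof (induction k)
    case 0
    then show ?case using sl by simp
  next
    case (Suc k)
    define j where "j = s + 1 + (i - s - 1 + k) mod l"
    have j: "s < j" "j \<le> s + l" using l mod_less_divisor[OF l, of "i - s - 1 + k"] unfolding j_def by linarith+
    have "rotation ls j = s + 1 + (j - s) mod l" using blk[OF j] n unfolding rotation_def by simp
    also have "(j - s) mod l = (i - s - 1 + Suc k) mod l" unfolding j_def by (simp add: mod_simps)
    finally show ?case using Suc unfolding j_def by simp
  qed
qed

lemma rotation_permutes: "rotation ls permutes {1..n}"
proof (rule bij_imp_permutes)
  have closed: "(rotation ls ^^ k) i \<in> {1..n}" if i: "i \<in> {1..n}" for i k
  proof -
    obtain s l where b: "block 0 ls i = (s, l)" "s < i" "i \<le> s + l"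
      and blk: "\<And>j. s < j \<Longrightarrow> j \<le> s + l \<Longrightarrow> j \<in> {1..n} \<and> block 0 ls j = (s, l)" using block_cases[OF i] by metis
    have "(i - s - 1 + k) mod l < l" using b by (intro mod_less_divisor) simp
    then show ?thesis unfolding rotation_power[OF i b(1)] using blk by auto
  qed
  have "{1..n} \<subseteq> rotation ls ` {1..n}"
  proof
    fix i assume i: "i \<in> {1..n}"
    obtain s l where b: "block 0 ls i = (s, l)" "s < i" "i \<le> s + l" using block_cases[OF i] by metis
    have "(i - s - 1 + l) mod l = i - s - 1" using b(2,3) by (simp only: mod_add_self2) simp
    then have "(rotation ls ^^ l) i = i" unfolding rotation_power[OF i b(1)] using b(2) by simp
    moreover obtain k where "l = Suc k" using b by (cases l) auto
    ultimately have "i = rotation ls ((rotation ls ^^ k) i)" by simp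
    then show "i \<in> rotation ls ` {1..n}" using closed[OF i] by blast
  qed
  moreover have "rotation ls ` {1..n} \<subseteq> {1..n}" using closed[of _ 1] by auto
  ultimately have "rotation ls ` {1..n} = {1..n}" by blast
  then show "bij_betw (rotation ls) {1..n} {1..n}" unfolding bij_betw_def
    by (metis finite_atLeastAtMost finite_surj_inj order_refl)
qed (use n in \<open>auto simp: rotation_def\<close>)

lemma reflection_block:
  assumes "i \<in> {1..n}" "block 0 ls i = (s, l)"
  shows "reflection ls i = 2 * s + l + 1 - i" "s < reflection ls i" "reflection ls i \<le> s + l"
proof -
  have "s < i" "i \<le> s + l" by (rule block_mem[OF assms])+
  moreover show "reflection ls i = 2 * s + l + 1 - i" using assms n unfolding reflection_def by simp
  ultimately show "s < reflection ls i" "reflection ls i \<le> s + l" by auto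
qed

lemma reflection_involution: "reflection ls (reflection ls i) = i"
proof (cases "i \<in> {1..n}")
  case True
  obtain s l where b: "block 0 ls i = (s, l)" "s < i" "i \<le> s + l"
    and blk: "\<And>j. s < j \<Longrightarrow> j \<le> s + l \<Longrightarrow> j \<in> {1..n} \<and> block 0 ls j = (s, l)" using block_cases[OF True] by metis
  note r = reflection_block[OF True b(1)]
  have "block 0 ls (reflection ls i) = (s, l)" "reflection ls i \<in> {1..n}" using blk r by auto
  from reflection_block(1)[OF this(2,1)] show ?thesis using r(1) b by simp
qed (use n in \<open>auto simp: reflection_def\<close>)

lemma reflection_permutes: "reflection ls permutes {1..n}"
proof (rule bij_imp_permutes)
  have "reflection ls i \<in> {1..n}" if i: "i \<in> {1..n}" for i
  proof -
    obtain s l where b: "block 0 ls i = (s, l)"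
      and blk: "\<And>j. s < j \<Longrightarrow> j \<le> s + l \<Longrightarrow> j \<in> {1..n} \<and> block 0 ls j = (s, l)" using block_cases[OF i] by metis
    then show ?thesis using reflection_block[OF i b] by auto
  qed
  then show "bij_betw (reflection ls) {1..n} {1..n}"
    by (intro bij_betw_byWitness[where f'="reflection ls"]) (auto simp: reflection_involution)
qed (use n in \<open>auto simp: reflection_def\<close>)

lemma reflection_inverts: "rotation ls (reflection ls (rotation ls i)) = reflection ls i"
proof (cases "i \<in> {1..n}")
  case True
  obtain s l where b: "block 0 ls i = (s, l)" "s < i" "i \<le> s + l"
    and blk: "\<And>j. s < j \<Longrightarrow> j \<le> s + l \<Longrightarrow> j \<in> {1..n} \<and> block 0 ls j = (s, l)" using block_cases[OF True] by metis
  have rot: "rotation ls j = (if j = s + l then s + 1 else j + 1)" if "s < j" "j \<le> s + l" for j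
    using blk[OF that] that n unfolding rotation_def by auto
  have refl: "reflection ls j = 2 * s + l + 1 - j" if "s < j" "j \<le> s + l" for j
    using reflection_block(1) blk[OF that] by blast
  show ?thesis using b(2,3) by (cases "i = s + l") (auto simp: rot refl)
next
  case False
  then have "rotation ls i = i" "reflection ls i = i" using n unfolding rotation_def reflection_def by auto
  then show ?thesis by simp
qed

lemma rotation_centralizer_even:
  assumes dist: "distinct ls" and odd: "\<And>l. l \<in> set ls \<Longrightarrow> odd l"
    and u: "u permutes {1..n}" "u \<circ> rotation ls = rotation ls \<circ> u"
  shows "evenperm u"
proof (rule commuting_even[OF u, of "\<lambda>i. snd (block 0 ls i)"])
  fix i k assume i: "i \<in> {1..n}"
  obtain s l where b: "block 0 ls i = (s, l)" "s < i" "i \<le> s + l" "l \<in> set ls" using block_cases[OF i] by metis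
  have "(rotation ls ^^ k) i = i \<longleftrightarrow> (i - s - 1 + k) mod l = i - s - 1"
    unfolding rotation_power[OF i b(1)] using b(2) by auto
  also have "\<dots> \<longleftrightarrow> (i - s - 1 + k) mod l = (i - s - 1) mod l" using b(2,3) by simp
  also have "\<dots> \<longleftrightarrow> l dvd k" by (simp add: mod_eq_dvd_iff_nat)
  finally show "odd (snd (block 0 ls i)) \<and> ((rotation ls ^^ k) i = i \<longleftrightarrow> snd (block 0 ls i) dvd k)"
    using odd[OF b(4)] b(1) by simp
next
  fix i j assume i: "i \<in> {1..n}" and j: "j \<in> {1..n}" and eq: "snd (block 0 ls i) = snd (block 0 ls j)"
  obtain s l where b: "block 0 ls i = (s, l)" "s < i" "i \<le> s + l" using block_cases[OF i] by metis
  obtain s' l' where b': "block 0 ls j = (s', l')" "s' < j" "j \<le> s' + l'" using block_cases[OF j] by metis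
  have "l' = l" using eq b b' by simp
  have "s' = s" using block_start_unique[OF dist, of 0 j i s' l s] b b' \<open>l' = l\<close> i j n by auto
  define k where "k = l + j - i"
  have "(i - s - 1 + k) = (j - s - 1) + l" unfolding k_def using b b' \<open>s' = s\<close> \<open>l' = l\<close> by auto
  then have "(i - s - 1 + k) mod l = j - s - 1"
    using b' \<open>s' = s\<close> \<open>l' = l\<close> by (simp only: mod_add_self2) simp
  then have "(rotation ls ^^ k) i = j" unfolding rotation_power[OF i b(1)]
    using b' \<open>s' = s\<close> by simp
  then show "\<exists>k. j = (rotation ls ^^ k) i" by metis
qed

end

text \<open>In an interval of odd length the reflection fixes the midpoint only.\<close>

lemma card_fixed_reflection:
  assumes "\<And>l. l \<in> set ls \<Longrightarrow> odd l"
  shows "card {i. a < i \<and> i \<le> a + sum_list ls \<and> (case block a ls i of (s, l) \<Rightarrow> 2 * s + l + 1 - i = i)} = length ls"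
  using assms
proof (induction ls arbitrary: a)
  case (Cons m ls)
  let ?F = "\<lambda>a ls. {i. a < i \<and> i \<le> a + sum_list ls \<and> (case block a ls i of (s, l) \<Rightarrow> 2 * s + l + 1 - i = i)}"
  obtain k where k: "m = 2 * k + 1" using Cons.prems[of m] by (auto elim: oddE)
  have "?F a (m # ls) = insert (a + k + 1) (?F (a + m) ls)"
    using k by (auto split: if_splits)
  moreover have "a + k + 1 \<notin> ?F (a + m) ls" using k by auto
  moreover have "finite (?F (a + m) ls)" by (rule finite_subset[of _ "{..a + m + sum_list ls}"]) auto
  ultimately show ?case using Cons by simp
qed simp

text \<open>Composition with one of its transpositions removes one 2-cycle from an involution.\<close>

lemma evenperm_involution:
  assumes "z permutes {1..n}" "z \<circ> z = id"
  shows "evenperm z \<longleftrightarrow> even (card (two_cycles z))"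
  using assms
proof (induction "card (two_cycles z)" arbitrary: z rule: less_induct)
  case less
  note z = less.prems
  have zz: "z (z j) = j" for j using z(2) by (metis comp_apply id_apply)
  show ?case
  proof (cases "z = id")
    case True
    then have "two_cycles z = {}" unfolding two_cycles_def by auto
    then show ?thesis using True by simp
  next
    case False
    then obtain i where i: "z i \<noteq> i" by (auto simp: fun_eq_iff)
    define t where "t = Transposition.transpose i (z i)"
    define w where "w = z \<circ> t"
    have w: "w j = (if j = i \<or> j = z i then j else z j)" for j
      unfolding w_def t_def by (auto simp: transpose_def zz)
    have mem: "i \<in> {1..n}" "z i \<in> {1..n}"
      using i permutes_not_in[OF z(1), of i] permutes_in_image[OF z(1), of i] by auto
    have t: "t permutes {1..n}" unfolding t_def by (rule permutes_swap_id[OF mem])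
    have wp: "w permutes {1..n}" unfolding w_def by (rule permutes_compose[OF t z(1)])
    have "w (w j) = j" for j
    proof (cases "j = i \<or> j = z i")
      case False
      then have "z j \<noteq> i" "z j \<noteq> z i" using zz by metis+
      then show ?thesis using False zz by (simp add: w)
    qed (auto simp: w)
    then have ww: "w \<circ> w = id" by (simp add: fun_eq_iff)
    have B: "{i, z i} \<in> two_cycles z" using i unfolding two_cycles_def by auto
    have tc: "two_cycles w = two_cycles z - {{i, z i}}"
    proof (intro equalityI subsetI)
      fix B assume "B \<in> two_cycles w"
      then obtain j where j: "B = {j, w j}" "w j \<noteq> j" unfolding two_cycles_def by blast
      then have "j \<noteq> i" "j \<noteq> z i" "w j = z j" using w[of j] by (auto split: if_splits)
      then show "B \<in> two_cycles z - {{i, z i}}" using j unfolding two_cycles_def by auto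
    next
      fix B assume B: "B \<in> two_cycles z - {{i, z i}}"
      then obtain j where j: "B = {j, z j}" "z j \<noteq> j" unfolding two_cycles_def by blast
      then have "j \<noteq> i" "j \<noteq> z i" using B zz by auto
      then have "w j = z j" using w[of j] by simp
      then show "B \<in> two_cycles w" using j unfolding two_cycles_def by auto
    qed
    have c: "card (two_cycles z) = Suc (card (two_cycles w))"
      unfolding tc using card_Suc_Diff1[OF finite_two_cycles[OF z(1)] B] by simp
    then have IH: "evenperm w \<longleftrightarrow> even (card (two_cycles w))" using less.hyps[OF _ wp ww] by simp
    have "permutation z" using z(1) permutation_permutes by blast
    then have "evenperm w \<longleftrightarrow> \<not> evenperm z"
      unfolding w_def t_def using i by (simp add: evenperm_comp permutation_swap_id evenperm_swap)
    then show ?thesis using IH c by simp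
  qed
qed

lemma evenperm_reflection:
  assumes n: "sum_list ls = n" and odd: "\<And>l. l \<in> set ls \<Longrightarrow> odd l"
  shows "evenperm (reflection ls) \<longleftrightarrow> even ((n - length ls) div 2)"
proof -
  let ?r = "reflection ls"
  have r: "?r permutes {1..n}" "?r \<circ> ?r = id"
    using reflection_permutes[OF n] reflection_involution[OF n] by (auto simp: fun_eq_iff)
  have "{i \<in> {1..n}. ?r i = i} = {i. 0 < i \<and> i \<le> 0 + sum_list ls \<and> (case block 0 ls i of (s, l) \<Rightarrow> 2 * s + l + 1 - i = i)}"
    using n by (auto simp: reflection_def split: prod.splits)
  then have f: "card {i \<in> {1..n}. ?r i = i} = length ls" using card_fixed_reflection[OF odd, of ls 0] by simp
  have "\<Union>(two_cycles ?r) = {i \<in> {1..n}. ?r i \<noteq> i}"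
  proof (intro equalityI subsetI)
    fix i assume "i \<in> \<Union>(two_cycles ?r)"
    then obtain B where "B \<in> two_cycles ?r" "i \<in> B" by blast
    from two_cycles_eq[OF r(2) this] show "i \<in> {i \<in> {1..n}. ?r i \<noteq> i}"
      using permutes_not_in[OF r(1), of i] by blast
  next
    fix i assume "i \<in> {i \<in> {1..n}. ?r i \<noteq> i}"
    then show "i \<in> \<Union>(two_cycles ?r)" unfolding two_cycles_def by blast
  qed
  then have m: "2 * card (two_cycles ?r) = card {i \<in> {1..n}. ?r i \<noteq> i}"
    using card_Union_two_cycles[OF r order_refl] by simp
  have "card {i \<in> {1..n}. ?r i = i} + card {i \<in> {1..n}. ?r i \<noteq> i} = card ({i \<in> {1..n}. ?r i = i} \<union> {i \<in> {1..n}. ?r i \<noteq> i})"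
    by (rule card_Un_disjoint[symmetric]) auto
  also have "{i \<in> {1..n}. ?r i = i} \<union> {i \<in> {1..n}. ?r i \<noteq> i} = {1..n}" by auto
  finally have "n - length ls = 2 * card (two_cycles ?r)" using f m by simp
  then show ?thesis using evenperm_involution[OF r] by simp
qed

text \<open>A permutation that inverts \<open>rotation ls\<close> differs from the reflection by an element of the
  centralizer, which is even.\<close>

theorem inverting_parity:
  assumes inv: "\<And>g. g permutes {1..n} \<Longrightarrow> evenperm g \<Longrightarrow> \<exists>y. y permutes {1..n} \<and> evenperm y = b \<and> y \<circ> g = inv' g \<circ> y"
    and ls: "sum_list ls = n" "distinct ls" "\<And>l. l \<in> set ls \<Longrightarrow> odd l"
  shows "b = even ((n - length ls) div 2)"
proof -
  let ?g = "rotation ls" and ?r = "reflection ls"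
  note g = rotation_permutes[OF ls(1)] and r = reflection_permutes[OF ls(1)]
  have perm: "permutation p" if "p permutes {1..n}" for p using that permutation_permutes by blast
  have "evenperm ?g" by (rule rotation_centralizer_even[OF ls g refl])
  then obtain y where y: "y permutes {1..n}" "evenperm y = b" "y \<circ> ?g = inv' ?g \<circ> y" using inv[OF g] by blast
  have comm: "(?r \<circ> y) \<circ> ?g = ?g \<circ> (?r \<circ> y)"
  proof
    fix i
    have "?g (y (?g i)) = y i" using fun_cong[OF y(3), of i] permutes_inverses[OF g] by simp
    have "?r (y (?g i)) = ?g (?r (?g (y (?g i))))" by (rule reflection_inverts[OF ls(1), symmetric])
    also have "?g (y (?g i)) = y i" by fact
    finally show "((?r \<circ> y) \<circ> ?g) i = (?g \<circ> (?r \<circ> y)) i" by simp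
  qed
  have "evenperm (?r \<circ> y)"
    by (rule rotation_centralizer_even[OF ls(1,2) _ permutes_compose[OF y(1) r] comm]) (rule ls(3))
  then have "evenperm ?r = evenperm y" using evenperm_comp[OF perm[OF r] perm[OF y(1)]] by simp
  then show ?thesis using y(2) evenperm_reflection[OF ls(1,3)] by simp
qed

text \<open>Two partitions into distinct odd parts whose numbers of parts differ by 2 require opposite
  parities: \<open>n\<close> and \<open>1 + 3 + (n - 4)\<close> for odd \<open>n \<ge> 9\<close>, \<open>1 + (n - 1)\<close> and \<open>1 + 3 + 5 + (n - 9)\<close>
  for even \<open>n \<ge> 16\<close>. In smaller degrees the first partition fixes the parity.\<close>

corollary inverting_parity_restricts:
  fixes n :: nat
  assumes inv: "\<And>g. g permutes {1..n} \<Longrightarrow> evenperm g \<Longrightarrow> \<exists>y. y permutes {1..n} \<and> evenperm y = b \<and> y \<circ> g = inv' g \<circ> y"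
    and n: "n > 2"
  shows "if b then n \<in> {5, 6, 10, 14} else n \<in> {3, 4, 7, 8, 12}"
proof (cases "even n")
  case True
  have "b = even ((n - length [1, n - 1]) div 2)"
    by (rule inverting_parity[OF inv]) (use n True in auto)
  moreover have "b = even ((n - length [1, 3, 5, n - 9]) div 2)" if "n \<ge> 16"
    by (rule inverting_parity[OF inv]) (use that True in auto)
  moreover obtain m where "n = 2 * m" using True by (auto elim: evenE)
  ultimately show ?thesis using n by (cases "n \<ge> 16") (auto simp: even_diff_nat, presburger+)
next
  case False
  have "b = even ((n - length [n]) div 2)"
    by (rule inverting_parity[OF inv]) (use n False in auto)
  moreover have "b = even ((n - length [1, 3, n - 4]) div 2)" if "n \<ge> 9"
    by (rule inverting_parity[OF inv]) (use that False in auto)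
  moreover obtain m where "n = 2 * m + 1" using False by (auto elim: oddE)
  ultimately show ?thesis using n by (cases "n \<ge> 9") (auto, presburger+)
qed

section \<open>The degrees 8, 10, 12 and 14\<close>

lemma involution_charactersD:
  assumes "involution_characters n b F" "z \<in> invols n b"
  shows "F z id = 1"
    and "g \<in> carrier (alt_group n) \<Longrightarrow> h \<in> carrier (alt_group n) \<Longrightarrow> g \<circ> z = z \<circ> g \<Longrightarrow> h \<circ> z = z \<circ> h \<Longrightarrow>
      F z (g \<circ> h) = F z g * F z h"
    and "g \<in> carrier (alt_group n) \<Longrightarrow> x \<in> carrier (alt_group n) \<Longrightarrow> g \<circ> z = z \<circ> g \<Longrightarrow>
      F (x \<circ> z \<circ> inv' x) (x \<circ> g \<circ> inv' x) = F z g"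
  using assms unfolding involution_characters_def by blast+

lemma involution_characters_sum:
  assumes "involution_characters n b F" "g \<in> carrier (alt_group n)"
  shows "(\<Sum>z\<in>{z\<in>invols n b. z \<circ> g = g \<circ> z}. F z g) = of_nat (card (square_roots n b g))"
  using assms unfolding involution_characters_def by blast

lemma funpow_alt:
  assumes "g \<in> carrier (alt_group n)"
  shows "g ^^ k \<in> carrier (alt_group n)"
proof (induction k)
  case 0
  show ?case unfolding funpow.simps(1) alt_group_carrier using permutes_id evenperm_id by blast
next
  case (Suc k)
  have "evenperm (g \<circ> g ^^ k)" using altD[OF assms] altD[OF Suc] evenperm_comp by blast
  then show ?case unfolding funpow.simps(2) alt_group_carrier
    using permutes_compose[OF altD(1)[OF Suc] altD(1)[OF assms]] by blast
qed

lemma involution_character_power: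
  assumes F: "involution_characters n b F" "z \<in> invols n b"
    and g: "g \<in> carrier (alt_group n)" "g \<circ> z = z \<circ> g"
  shows "F z (g ^^ k) = F z g ^ k"
proof (induction k)
  case 0
  show ?case unfolding funpow.simps(1) power_0 by (rule involution_charactersD(1)[OF F])
next
  case (Suc k)
  have "(g ^^ k) \<circ> z = z \<circ> (g ^^ k)" by (induction k) (use g(2) in \<open>auto simp: fun_eq_iff\<close>)
  then show ?case unfolding funpow.simps(2) power_Suc Suc[symmetric]
    by (rule involution_charactersD(2)[OF F g(1) funpow_alt[OF g(1)] g(2)])
qed

lemma norm_involution_character:
  assumes F: "involution_characters n b F" "z \<in> invols n b"
    and g: "g \<in> carrier (alt_group n)" "g \<circ> z = z \<circ> g"
  shows "norm (F z g) = 1"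
proof -
  obtain k where k: "g ^^ k = id" "k > 0" using permutation_is_nilpotent[OF altD(3)[OF g(1)]] .
  have "F z g ^ k = 1" using involution_character_power[OF F g, of k] involution_charactersD(1)[OF F] k(1) by simp
  then have "norm (F z g) ^ k = 1" by (metis norm_power norm_one)
  then show ?thesis using power_eq_imp_eq_base[of "norm (F z g)" k 1] k(2) by simp
qed

lemma sum_commuting:
  assumes "g permutes {1..n}"
  shows "(\<Sum>z\<in>{z\<in>invols n b. z \<circ> g = g \<circ> z}. f (images n z)) =
    sum_list (map f (filter (\<lambda>z. even_list z = b) (solutions n (images n g) (images n g) (images n id))))"
proof -
  have "(\<Sum>z\<in>{z\<in>invols n b. z \<circ> g = g \<circ> z}. f (images n z)) =
      (\<Sum>z | z permutes {1..n} \<and> z \<circ> g = g \<circ> z \<and> z \<circ> z = id. if even_list (images n z) = b then f (images n z) else 0)"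
  proof (rule sum.mono_neutral_cong_left)
    show "finite {z. z permutes {1..n} \<and> z \<circ> g = g \<circ> z \<and> z \<circ> z = id}"
      by (rule finite_subset[OF _ finite_permutations[of "{1..n}"]]) auto
  qed (auto simp: invols_def even_list_images)
  also have "\<dots> = sum_list (map (\<lambda>z. if even_list z = b then f z else 0)
      (solutions n (images n g) (images n g) (images n id)))"
    using assms permutes_id by (intro sum_solutions)
  also have "\<dots> = sum_list (map f (filter (\<lambda>z. even_list z = b) (solutions n (images n g) (images n g) (images n id))))"
    by (simp add: sum_list_map_filter')
  finally show ?thesis .
qed

lemma card_square_roots:
  assumes "g permutes {1..n}"
  shows "card (square_roots n b g) =
    length (filter (\<lambda>y. even_list y = b) (solutions n (images n g) (images n g) (images n g)))"
proof -
  let ?S = "{y. y permutes {1..n} \<and> y \<circ> g = g \<circ> y \<and> y \<circ> y = g}"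
  have fin: "finite ?S" by (rule finite_subset[OF _ finite_permutations[of "{1..n}"]]) auto
  have sub: "square_roots n b g = {y \<in> ?S. even_list (images n y) = b}"
    unfolding square_roots_def by (auto simp: even_list_images o_assoc)
  have "card (square_roots n b g) = (\<Sum>y\<in>?S. if even_list (images n y) = b then 1 else 0)"
    unfolding sub using sum.inter_filter[OF fin, of "\<lambda>_. 1::nat" "\<lambda>y. even_list (images n y) = b"] by simp
  also have "\<dots> = sum_list (map (\<lambda>y. if even_list y = b then 1 else 0)
      (solutions n (images n g) (images n g) (images n g)))"
    by (rule sum_solutions) (rule assms)+
  also have "\<dots> = length (filter (\<lambda>y. even_list y = b) (solutions n (images n g) (images n g) (images n g)))"
    by (subst sum_list_map_filter'[symmetric]) (simp only: sum_list_triv of_nat_id mult_1_right)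
  finally show ?thesis .
qed

text \<open>The values of linear characters have absolute value 1, so their sum over the commuting
  involutions is at most the number of these.\<close>

lemma too_many_square_roots:
  assumes F: "involution_characters n b F"
    and g: "g permutes {1..n}" "even_list (images n g)"
    and less: "length (filter (\<lambda>z. even_list z = b) (solutions n (images n g) (images n g) (images n id))) <
      length (filter (\<lambda>y. even_list y = b) (solutions n (images n g) (images n g) (images n g)))"
  shows False
proof -
  let ?C = "{z\<in>invols n b. z \<circ> g = g \<circ> z}"
  have gA: "g \<in> carrier (alt_group n)" using g even_list_images by (auto simp: alt_group_carrier)
  have "real (card (square_roots n b g)) = norm (\<Sum>z\<in>?C. F z g)"
    unfolding involution_characters_sum[OF F gA] by simp
  also have "\<dots> \<le> (\<Sum>z\<in>?C. norm (F z g))" by (rule norm_sum)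
  also have "\<dots> = (\<Sum>z\<in>?C. 1)"
    using norm_involution_character[OF F _ gA] by (intro sum.cong) auto
  also have "\<dots> = sum_list (map (\<lambda>_. 1::real) (filter (\<lambda>z. even_list z = b) (solutions n (images n g) (images n g) (images n id))))"
    by (rule sum_commuting[OF g(1)])
  also have "\<dots> = real (length (filter (\<lambda>z. even_list z = b) (solutions n (images n g) (images n g) (images n id))))"
    by (simp add: sum_list_triv)
  finally show False using less card_square_roots[OF g(1)] by simp
qed

definition roots_exceed :: "nat list \<Rightarrow> bool \<Rightarrow> bool" where
  "roots_exceed ls b \<longleftrightarrow> (let n = sum_list ls; g = images n (rotation ls) in even_list g \<and>
    length (filter (\<lambda>z. even_list z = b) (solutions n g g (images n id))) <
    length (filter (\<lambda>y. even_list y = b) (solutions n g g g)))"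

lemma no_characters_if_roots_exceed:
  assumes "roots_exceed ls b"
  shows "\<not> involution_characters (sum_list ls) b F"
  using assms too_many_square_roots[of "sum_list ls" b F "rotation ls"] rotation_permutes[OF refl, of ls]
  unfolding roots_exceed_def Let_def by blast

text \<open>A product of two disjoint 4-cycles is the square of an 8-cycle. An element of cycle type
  \<open>(4,4)\<close> or \<open>(4,4,3,1)\<close> has four odd square roots and commutes with no odd involution; one of
  cycle type \<open>(4,4,3,3)\<close> has twelve even square roots and commutes with eight even involutions.\<close>

lemma no_characters_8_12_14:
  "\<not> involution_characters 8 False F" "\<not> involution_characters 12 False F" "\<not> involution_characters 14 True F"
proof -
  have "roots_exceed [4, 4] False" by code_simp
  then show "\<not> involution_characters 8 False F" using no_characters_if_roots_exceed[of "[4, 4]"] by simp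
  have "roots_exceed [4, 4, 3, 1] False" by code_simp
  then show "\<not> involution_characters 12 False F" using no_characters_if_roots_exceed[of "[4, 4, 3, 1]"] by simp
  have "roots_exceed [4, 4, 3, 3] True" by code_simp
  then show "\<not> involution_characters 14 True F" using no_characters_if_roots_exceed[of "[4, 4, 3, 3]"] by simp
qed

text \<open>For the identity as involution, the linear character is one of the whole group, which is
  perfect.\<close>

lemma character_of_alt_trivial:
  assumes n: "n \<ge> 5" and F: "involution_characters n True F" and g: "g \<in> carrier (alt_group n)"
  shows "F id g = 1"
proof -
  interpret group "alt_group n" by (rule alt_group_is_group)
  have id: "id \<in> invols n True" by (simp add: invols_def permutes_id)
  have mult: "F id (g \<otimes>\<^bsub>alt_group n\<^esub> h) = F id g * F id h"
    if "g \<in> carrier (alt_group n)" "h \<in> carrier (alt_group n)" for g h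
    using involution_charactersD(2)[OF F id that] by (simp add: alt_group_mult)
  have one: "F id \<one>\<^bsub>alt_group n\<^esub> = 1" using involution_charactersD(1)[OF F id] by (simp add: alt_group_one)
  have inv: "F id g * F id (inv\<^bsub>alt_group n\<^esub> g) = 1" if "g \<in> carrier (alt_group n)" for g
    using mult[OF that inv_closed[OF that]] one that by simp
  let ?K = "{g \<in> carrier (alt_group n). F id g = 1}"
  have "subgroup ?K (alt_group n)"
  proof (rule subgroupI)
    show "?K \<noteq> {}" using one one_closed by blast
    show "\<And>g. g \<in> ?K \<Longrightarrow> inv\<^bsub>alt_group n\<^esub> g \<in> ?K" using inv by force
    show "\<And>g h. g \<in> ?K \<Longrightarrow> h \<in> ?K \<Longrightarrow> g \<otimes>\<^bsub>alt_group n\<^esub> h \<in> ?K" using mult by auto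
  qed auto
  moreover have "derived_set (alt_group n) (carrier (alt_group n)) \<subseteq> ?K"
  proof
    fix c assume "c \<in> derived_set (alt_group n) (carrier (alt_group n))"
    then obtain g h where gh: "g \<in> carrier (alt_group n)" "h \<in> carrier (alt_group n)"
      and c: "c = g \<otimes>\<^bsub>alt_group n\<^esub> h \<otimes>\<^bsub>alt_group n\<^esub> inv\<^bsub>alt_group n\<^esub> g \<otimes>\<^bsub>alt_group n\<^esub> inv\<^bsub>alt_group n\<^esub> h" by auto
    have "F id c = (F id g * F id (inv\<^bsub>alt_group n\<^esub> g)) * (F id h * F id (inv\<^bsub>alt_group n\<^esub> h))"
      unfolding c using gh by (simp add: mult)
    also have "\<dots> = 1" using inv gh by simp
    finally show "c \<in> ?K" unfolding c using gh by simp
  qed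
  ultimately have "derived (alt_group n) (carrier (alt_group n)) \<subseteq> ?K"
    unfolding derived_def by (rule generate_subgroup_incl[rotated])
  then show ?thesis using derived_alt_group_const[OF n] g by blast
qed

text \<open>The product of the transpositions in the list, like \<open>apply_transps\<close>, but in a form that
  evaluates well on points.\<close>

fun transp_list :: "(nat \<times> nat) list \<Rightarrow> nat \<Rightarrow> nat" where
  "transp_list [] i = i"
| "transp_list ((a, b) # xs) i = (let j = transp_list xs i in if j = a then b else if j = b then a else j)"

lemma transp_list_eq: "transp_list xs = apply_transps xs"
proof
  show "transp_list xs i = apply_transps xs i" for i
    by (induction xs) (auto simp: Let_def transpose_def)
qed

definition alt_list :: "nat \<Rightarrow> (nat \<times> nat) list \<Rightarrow> bool" where
  "alt_list n xs \<longleftrightarrow> list_all (\<lambda>(a, b). a \<noteq> b \<and> 1 \<le> a \<and> a \<le> n \<and> 1 \<le> b \<and> b \<le> n) xs \<and> even (length xs)"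

text \<open>For evaluation: both lists consist of an even number of transpositions of points in
  \<open>{1..n}\<close>, and their products agree on \<open>{1..n}\<close>.\<close>

definition same :: "nat \<Rightarrow> (nat \<times> nat) list \<Rightarrow> (nat \<times> nat) list \<Rightarrow> bool" where
  "same n xs ys \<longleftrightarrow> alt_list n xs \<and> alt_list n ys \<and> images n (transp_list xs) = images n (transp_list ys)"

lemma alt_list_alt:
  assumes "alt_list n xs"
  shows "apply_transps xs permutes {1..n}" "apply_transps xs \<in> carrier (alt_group n)"
proof -
  show "apply_transps xs permutes {1..n}"
    using assms unfolding alt_list_def by (intro permutes_apply_transps) (auto simp: list_all_iff)
  moreover have "evenperm (apply_transps xs)"
    using assms unfolding alt_list_def by (subst evenperm_apply_transps_iff) (auto simp: list_all_iff)
  ultimately show "apply_transps xs \<in> carrier (alt_group n)" by (simp add: alt_group_carrier)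
qed

lemma sameD:
  assumes "same n xs ys"
  shows "apply_transps xs = apply_transps ys"
proof
  fix i
  note perm = alt_list_alt(1)[of n xs] alt_list_alt(1)[of n ys]
  show "apply_transps xs i = apply_transps ys i"
  proof (cases "i \<in> {1..n}")
    case True
    then show ?thesis
      using arg_cong[OF conjunct2[OF conjunct2[OF assms[unfolded same_def]]], of "\<lambda>ps. get ps i"]
      by (simp add: get_images transp_list_eq)
  next
    case False
    then show ?thesis using perm assms permutes_not_in[OF perm(1) False] permutes_not_in[OF perm(2) False]
      unfolding same_def by simp
  qed
qed

lemma inv_apply_transps: "inv' (apply_transps (xs :: (nat \<times> nat) list)) = apply_transps (rev xs)"
proof (rule inv_unique_comp)
  have rev: "apply_transps xs \<circ> apply_transps (rev xs) = id" for xs :: "(nat \<times> nat) list"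
    by (induction xs) (auto simp: fun_eq_iff)
  show "apply_transps xs \<circ> apply_transps (rev xs) = id" by (rule rev)
  show "apply_transps (rev xs) \<circ> apply_transps xs = id" using rev[of "rev xs"] by simp
qed

definition commuting_pair :: "nat \<Rightarrow> (nat \<times> nat) list \<Rightarrow> (nat \<times> nat) list \<Rightarrow> bool" where
  "commuting_pair n z g \<longleftrightarrow> alt_list n z \<and> alt_list n g \<and> same n (z @ z) [] \<and> same n (g @ z) (z @ g)"

lemma commuting_pairD:
  assumes "commuting_pair n z g"
  shows "apply_transps z \<in> invols n True" "apply_transps g \<in> carrier (alt_group n)"
    "apply_transps g \<circ> apply_transps z = apply_transps z \<circ> apply_transps g"
proof -
  have *: "alt_list n z" "alt_list n g" "same n (z @ z) []" "same n (g @ z) (z @ g)"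
    using assms unfolding commuting_pair_def by auto
  show "apply_transps g \<in> carrier (alt_group n)" by (rule alt_list_alt[OF *(2)])
  show "apply_transps z \<in> invols n True"
    using alt_list_alt[OF *(1)] altD[OF alt_list_alt(2)[OF *(1)]] sameD[OF *(3)] by (simp add: invols_def)
  show "apply_transps g \<circ> apply_transps z = apply_transps z \<circ> apply_transps g" using sameD[OF *(4)] by simp
qed

locale alt_characters =
  fixes n :: nat and F :: "(nat \<Rightarrow> nat) \<Rightarrow> (nat \<Rightarrow> nat) \<Rightarrow> complex"
  assumes F: "involution_characters n True F" and n: "n \<ge> 5"
begin

definition value_at :: "(nat \<times> nat) list \<Rightarrow> (nat \<times> nat) list \<Rightarrow> complex" where
  "value_at z g = F (apply_transps z) (apply_transps g)"

lemma value_id: "alt_list n g \<Longrightarrow> value_at [] g = 1"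
  unfolding value_at_def using character_of_alt_trivial[OF n F alt_list_alt(2)] by simp

lemma value_mult:
  assumes "commuting_pair n z g" "commuting_pair n z h" "same n (g @ h) k"
  shows "value_at z k = value_at z g * value_at z h"
  unfolding value_at_def sameD[OF assms(3), symmetric] apply_transps_append
  by (rule involution_charactersD(2)[OF F commuting_pairD(1)[OF assms(1)] commuting_pairD(2)[OF assms(1)]
    commuting_pairD(2)[OF assms(2)] commuting_pairD(3)[OF assms(1)] commuting_pairD(3)[OF assms(2)]])

lemma value_power:
  assumes "commuting_pair n z g" "same n (concat (replicate k g)) h"
  shows "value_at z h = value_at z g ^ k"
proof -
  have "apply_transps (concat (replicate k g)) = apply_transps g ^^ k" by (induction k) simp_all
  then show ?thesis
    using involution_character_power[OF F commuting_pairD[OF assms(1)], of k] sameD[OF assms(2)]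
    unfolding value_at_def by simp
qed

lemma value_conj:
  assumes "commuting_pair n z g" "alt_list n h" "same n (h @ z @ rev h) z'" "same n (h @ g @ rev h) g'"
  shows "value_at z' g' = value_at z g"
proof -
  note D = commuting_pairD[OF assms(1)]
  have "F (apply_transps h \<circ> apply_transps z \<circ> inv' (apply_transps h))
      (apply_transps h \<circ> apply_transps g \<circ> inv' (apply_transps h)) = value_at z g"
    unfolding value_at_def by (rule involution_charactersD(3)[OF F D(1,2) alt_list_alt(2)[OF assms(2)] D(3)])
  then show ?thesis using sameD[OF assms(3)] sameD[OF assms(4)]
    unfolding value_at_def inv_apply_transps by (simp add: o_assoc)
qed

text \<open>If an element commuting with \<open>z\<close> inverts \<open>g\<close>, the value at \<open>g\<close> is its own inverse.\<close>

lemma value_real: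
  assumes "commuting_pair n z g" "alt_list n h" "same n (h @ z @ rev h) z" "same n (h @ g @ rev h) (rev g)"
    and "commuting_pair n z (rev g)"
  shows "value_at z g = 1 \<or> value_at z g = -1"
proof -
  have alt: "alt_list n (g @ rev g)" "alt_list n []"
    using assms(1) unfolding commuting_pair_def alt_list_def by (auto simp: list_all_iff)
  have eq: "apply_transps (g @ rev g) = id"
    unfolding apply_transps_append inv_apply_transps[symmetric]
    by (rule permutes_inv_o(1), rule alt_list_alt(1)[of n g]) (use assms(1) in \<open>simp add: commuting_pair_def\<close>)
  have "same n (g @ rev g) []" unfolding same_def transp_list_eq eq using alt by simp
  then have "value_at z [] = value_at z g * value_at z (rev g)" by (rule value_mult[OF assms(1) assms(5)])
  also have "value_at z (rev g) = value_at z g" by (rule value_conj[OF assms(1-4)])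
  also have "value_at z [] = 1"
    unfolding value_at_def using involution_charactersD(1)[OF F commuting_pairD(1)[OF assms(1)]] by simp
  finally show ?thesis using square_eq_1_iff[of "value_at z g"] by simp
qed

text \<open>The equation of the family at an element without even square roots. The list \<open>zs\<close> has to
  enumerate the commuting even involutions in the order in which the search finds them.\<close>

lemma value_sum:
  assumes alt: "alt_list n g" and q: "q = images n (transp_list g)"
    and inv: "filter even_list (solutions n q q (images n id)) = map (\<lambda>z. images n (transp_list z)) zs"
    and zs: "list_all (alt_list n) zs"
    and roots: "filter even_list (solutions n q q q) = []"
  shows "sum_list (map (\<lambda>z. value_at z g) zs) = 0"
proof -
  let ?g = "apply_transps g"
  let ?of = "\<lambda>ps i. if i \<in> {1..n} then get ps i else i"
  note g = alt_list_alt[OF alt]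
  have of_im: "?of (images n p) = p" if "p permutes {1..n}" for p
    using permutes_not_in[OF that] by (auto simp: fun_eq_iff get_images)
  have q: "q = images n ?g" unfolding q transp_list_eq ..
  have "sum_list (map (\<lambda>z. value_at z g) zs) = sum_list (map (\<lambda>z. F (?of z) ?g) (map (\<lambda>z. images n (transp_list z)) zs))"
    using zs of_im alt_list_alt(1) by (auto simp: list_all_iff value_at_def transp_list_eq comp_def intro!: arg_cong[of _ _ sum_list] map_cong)
  also have "\<dots> = (\<Sum>z\<in>{z\<in>invols n True. z \<circ> ?g = ?g \<circ> z}. F (?of (images n z)) ?g)"
    unfolding sum_commuting[OF g(1), of "\<lambda>z. F (?of z) ?g"] q[symmetric] by (simp add: inv)
  also have "\<dots> = (\<Sum>z\<in>{z\<in>invols n True. z \<circ> ?g = ?g \<circ> z}. F z ?g)"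
    using of_im by (intro sum.cong) (auto simp: invols_def)
  also have "\<dots> = 0"
    unfolding involution_characters_sum[OF F g(2)] card_square_roots[OF g(1)] q[symmetric] using roots by simp
  finally show ?thesis .
qed

end

text \<open>Let \<open>z0 = (1 3)(2 4)\<close>. In the equations for the elements \<open>g\<close> of cycle type \<open>(4,3,2,1)\<close> and
  \<open>h\<close> of cycle type \<open>(5,2,2,1)\<close> few involutions occur, and conjugacy makes the values real; they
  determine the values of the character of \<open>z0\<close> at the products of \<open>(1 3)\<close> with a transposition
  of two of the points 5 to 10: all of them are 1. In the equation for an element of cycle type
  \<open>(6,2,1,1)\<close> the involutions are the identity, \<open>z0\<close>, \<open>(1 3)t\<close> and \<open>(2 4)t\<close> with a product \<open>t\<close>
  of three transpositions; the first three values turn out to be 1 and the last one \<open>\<plusminus>1\<close>, so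
  that the sum does not vanish.\<close>

lemma no_characters_10: "\<not> involution_characters 10 True F"
proof
  assume "involution_characters 10 True F"
  then interpret alt_characters 10 F by unfold_locales auto
  \<comment> \<open>A permutation is written as a list of transpositions, of which the last one is applied
    first.\<close>
  let ?z0 = "[(1, 3), (2, 4)] :: (nat \<times> nat) list"
  let ?x = "[(1, 2), (3, 4)] :: (nat \<times> nat) list"
  let ?y = "[(1, 4), (2, 3)] :: (nat \<times> nat) list"
  let ?p6 = "[(1, 3), (5, 6)] :: (nat \<times> nat) list"
  let ?p8 = "[(1, 3), (5, 8)] :: (nat \<times> nat) list"
  let ?p9 = "[(1, 3), (6, 9)] :: (nat \<times> nat) list"
  let ?p10 = "[(1, 3), (7, 10)] :: (nat \<times> nat) list"
  let ?v = "[(1, 3), (5, 8), (6, 9), (7, 10)] :: (nat \<times> nat) list"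
  let ?w = "[(2, 4), (5, 8), (6, 9), (7, 10)] :: (nat \<times> nat) list"
  have p6: "value_at ?z0 ?p6 = 1"
  proof -
    let ?g = "[(1, 2), (2, 3), (3, 4), (5, 6), (7, 8), (8, 9)] :: (nat \<times> nat) list"
    \<comment> \<open>The third power of g.\<close>
    let ?g3 = "[(1, 2), (2, 3), (3, 4), (1, 3), (2, 4), (5, 6)] :: (nat \<times> nat) list"
    let ?h = "[(1, 3), (2, 4), (5, 6), (6, 7), (7, 8), (8, 9)] :: (nat \<times> nat) list"
    let ?r = "[(6, 9), (7, 8)] :: (nat \<times> nat) list"
    have "sum_list (map (\<lambda>z. value_at z ?g) [[], ?z0]) = 0"
      by (rule value_sum[OF _ refl]) code_simp+
    moreover have "value_at [] ?g = 1" by (rule value_id) code_simp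
    ultimately have a: "value_at ?z0 ?g = -1" by (simp add: add_eq_0_iff)
    have "value_at ?z0 ?z0 = value_at ?z0 ?g ^ 6" by (rule value_power) code_simp+
    then have z0: "value_at ?z0 ?z0 = 1" using a by simp
    have "value_at ?z0 ?g3 = value_at ?z0 ?g ^ 3" by (rule value_power) code_simp+
    then have b: "value_at ?z0 ?g3 = -1" using a by simp
    have sum: "sum_list (map (\<lambda>z. value_at z ?h) [[], ?x, ?z0, ?y]) = 0"
      by (rule value_sum[OF _ refl]) code_simp+
    have one: "value_at [] ?h = 1" by (rule value_id) code_simp
    have "value_at ?z0 ?h = 1 \<or> value_at ?z0 ?h = -1" by (rule value_real[of _ _ ?r]) code_simp+
    moreover have "value_at ?z0 ?z0 = value_at ?z0 ?h ^ 5" by (rule value_power) code_simp+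
    ultimately have c: "value_at ?z0 ?h = 1" using z0 by auto
    have x: "value_at ?x ?h = 1 \<or> value_at ?x ?h = -1" by (rule value_real[of _ _ ?r]) code_simp+
    have y: "value_at ?y ?h = 1 \<or> value_at ?y ?h = -1" by (rule value_real[of _ _ ?r]) code_simp+
    have d: "value_at ?x ?h = -1" using sum one c x y by auto
    have "value_at ?x ?z0 = value_at ?x ?h ^ 5" by (rule value_power) code_simp+
    then have e: "value_at ?x ?z0 = -1" using d by simp
    \<comment> \<open>Conjugation by (2 3)(5 6) exchanges z0 and x.\<close>
    have "value_at ?z0 ?x = value_at ?x ?z0" by (rule value_conj[of _ _ "[(2, 3), (5, 6)]"]) code_simp+
    \<comment> \<open>The third power of g is the inverse of a 4-cycle with square z0, times (5 6);
      multiplication by (1 3)(5 6) gives x.\<close>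
    moreover have "value_at ?z0 ?x = value_at ?z0 ?g3 * value_at ?z0 ?p6" by (rule value_mult) code_simp+
    ultimately show ?thesis using b e by simp
  qed
  let ?g = "[(1, 3), (5, 6), (6, 7), (7, 8), (8, 9), (9, 10)] :: (nat \<times> nat) list"
  let ?r = "[(6, 10), (7, 9)] :: (nat \<times> nat) list"
  have real_z0: "value_at ?z0 ?g = 1 \<or> value_at ?z0 ?g = -1" by (rule value_real[of _ _ ?r]) code_simp+
  have real_v: "value_at ?v ?g = 1 \<or> value_at ?v ?g = -1" by (rule value_real[of _ _ ?r]) code_simp+
  have real_w: "value_at ?w ?g = 1 \<or> value_at ?w ?g = -1" by (rule value_real[of _ _ ?r]) code_simp+
  have "value_at ?z0 ?g = 1"
  proof -
    have "value_at ?z0 ?p8 = value_at ?z0 ?p6" by (rule value_conj[of _ _ "[(1, 3), (6, 8)]"]) code_simp+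
    moreover have "value_at ?z0 ?p9 = value_at ?z0 ?p6" by (rule value_conj[of _ _ "[(1, 3), (5, 9)]"]) code_simp+
    moreover have "value_at ?z0 ?p10 = value_at ?z0 ?p6" by (rule value_conj[of _ _ "[(5, 7), (6, 10)]"]) code_simp+
    moreover have "value_at ?z0 (?p8 @ ?p9) = value_at ?z0 ?p8 * value_at ?z0 ?p9" by (rule value_mult) code_simp+
    moreover have "value_at ?z0 ?v = value_at ?z0 (?p8 @ ?p9) * value_at ?z0 ?p10" by (rule value_mult) code_simp+
    ultimately have "value_at ?z0 ?v = 1" using p6 by simp
    moreover have "value_at ?z0 ?v = value_at ?z0 ?g ^ 3" by (rule value_power) code_simp+
    ultimately show ?thesis using real_z0 by auto
  qed
  moreover have "value_at ?v ?g = 1"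
  proof -
    \<comment> \<open>A square root of v that is inverted by an element commuting with v, so the value at v is
      a square of 1 or -1.\<close>
    let ?s = "[(1, 5), (5, 3), (3, 8), (6, 7), (7, 9), (9, 10)] :: (nat \<times> nat) list"
    have "value_at ?v ?s = 1 \<or> value_at ?v ?s = -1" by (rule value_real[of _ _ "[(5, 8), (7, 10)]"]) code_simp+
    moreover have "value_at ?v ?v = value_at ?v ?s ^ 2" by (rule value_power) code_simp+
    moreover have "value_at ?v ?v = value_at ?v ?g ^ 3" by (rule value_power) code_simp+
    ultimately show ?thesis using real_v by auto
  qed
  moreover have "value_at [] ?g = 1" by (rule value_id) code_simp
  moreover have "sum_list (map (\<lambda>z. value_at z ?g) [[], ?w, ?v, ?z0]) = 0"
    by (rule value_sum[OF _ refl]) code_simp+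
  ultimately show False using real_w by auto
qed

section \<open>Automorphisms of alternating groups that invert conjugacy classes\<close>

text \<open>If \<open>y\<close> moves \<open>i\<close>, a 3-cycle that moves \<open>i\<close> and fixes \<open>y i\<close> does not commute with \<open>y\<close>; four
  points leave room for one.\<close>

lemma commutes_with_alt_imp_id:
  assumes n: "n \<ge> 4" and y: "y permutes {1..n}" and comm: "\<And>g. g \<in> carrier (alt_group n) \<Longrightarrow> y \<circ> g = g \<circ> y"
  shows "y = id"
proof
  fix i
  show "y i = id i"
  proof (rule ccontr)
    assume ne: "y i \<noteq> id i"
    then have i: "i \<in> {1..n}" using permutes_not_in[OF y, of i] by auto
    have "card {i, y i} \<le> 2" by (simp add: card_insert_if)
    then have "2 \<le> card ({1..n} - {i, y i})"
      using n diff_card_le_card_Diff[of "{i, y i}" "{1..n}"] by simp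
    then obtain B where "B \<subseteq> {1..n} - {i, y i}" "card B = 2" by (rule obtain_subset_with_card_n)
    then obtain b c where bc: "b \<noteq> c" "{b, c} \<subseteq> {1..n} - {i, y i}" by (auto simp: card_2_iff)
    have d: "distinct [i, b, c]" using bc by auto
    have "three_cycle i b c \<in> carrier (alt_group n)" by (rule three_cycle_alt[OF d]) (use bc i in auto)
    then have "y (three_cycle i b c i) = three_cycle i b c (y i)" using fun_cong[OF comm, of _ i] by simp
    also have "\<dots> = y i" unfolding three_cycle_apply[OF d] using bc ne by auto
    finally have "three_cycle i b c i = i" using permutes_inj[OF y] by (simp add: inj_eq)
    then show False unfolding three_cycle_apply[OF d] using d by simp
  qed
qed

text \<open>The square of \<open>s\<close> commutes with \<open>A\<^sub>n\<close>, whose centralizer in \<open>S\<^sub>n\<close> is trivial.\<close>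

lemma conjugation_involution:
  assumes n: "n \<ge> 4" and s: "s permutes {1..n}" and \<tau>: "\<And>g. g \<in> carrier (alt_group n) \<Longrightarrow> \<tau> g = s \<circ> g \<circ> inv' s"
    and closed: "\<And>g. g \<in> carrier (alt_group n) \<Longrightarrow> \<tau> g \<in> carrier (alt_group n)"
    and \<tau>\<tau>: "\<And>g. g \<in> carrier (alt_group n) \<Longrightarrow> \<tau> (\<tau> g) = g"
  shows "s \<circ> s = id" "inv' s = s"
proof -
  show "s \<circ> s = id"
  proof (rule commutes_with_alt_imp_id[OF n permutes_compose[OF s s]])
    fix g assume g: "g \<in> carrier (alt_group n)"
    have "g = s \<circ> (s \<circ> g \<circ> inv' s) \<circ> inv' s" using \<tau>\<tau>[OF g] \<tau>[OF g] \<tau>[OF closed[OF g]] by simp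
    then have "g (s (s i)) = s (s (g i))" for i using permutes_inverses(2)[OF s] by (metis comp_apply)
    then show "(s \<circ> s) \<circ> g = g \<circ> (s \<circ> s)" by (simp add: fun_eq_iff)
  qed
  then show "inv' s = s" by (rule inv_unique_comp[OF _ ]) (rule \<open>s \<circ> s = id\<close>)
qed

lemma involutive_auto_alt:
  assumes "\<tau> \<in> auto (alt_group n)" "\<And>g. g \<in> carrier (alt_group n) \<Longrightarrow> \<tau> (\<tau> g) = g"
  shows "involutive_auto (alt_group n) \<tau>"
proof -
  interpret finite_grp "alt_group n" by (rule alt_finite_grp)
  show ?thesis by unfold_locales (use assms in \<open>auto simp: auto_def\<close>)
qed

lemma inner_auto_alt:
  assumes "\<tau> \<in> inner_auto (alt_group n)"
  obtains x where "x \<in> carrier (alt_group n)" "\<And>g. g \<in> carrier (alt_group n) \<Longrightarrow> \<tau> g = x \<circ> g \<circ> inv' x"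
proof -
  obtain x where x: "x \<in> carrier (alt_group n)"
    "\<tau> = (\<lambda>g\<in>carrier (alt_group n). x \<otimes>\<^bsub>alt_group n\<^esub> g \<otimes>\<^bsub>alt_group n\<^esub> inv\<^bsub>alt_group n\<^esub> x)"
    using assms unfolding inner_auto_def by blast
  then show ?thesis using that[OF x(1)] alt_group_inv_equality[OF x(1)] by (simp add: alt_group_mult)
qed

text \<open>If \<open>\<tau> g = x g x\<^sup>-\<^sup>1 = h g\<^sup>-\<^sup>1 h\<^sup>-\<^sup>1\<close>, the even permutation \<open>h\<^sup>-\<^sup>1 x\<close> inverts \<open>g\<close>.\<close>

lemma inner_inverting:
  assumes \<tau>: "\<tau> \<in> inner_auto (alt_group n)"
    and conj: "\<And>g. g \<in> carrier (alt_group n) \<Longrightarrow> \<exists>h\<in>carrier (alt_group n). \<tau> g = h \<circ> inv' g \<circ> inv' h"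
  shows "inverting n True"
  unfolding inverting_def
proof (intro allI impI)
  fix g assume "g permutes {1..n}" "evenperm g"
  then have g: "g \<in> carrier (alt_group n)" by (simp add: alt_group_carrier)
  obtain x where x: "x \<in> carrier (alt_group n)" "\<tau> g = x \<circ> g \<circ> inv' x" using inner_auto_alt[OF \<tau>] g by metis
  obtain h where h: "h \<in> carrier (alt_group n)" "\<tau> g = h \<circ> inv' g \<circ> inv' h" using conj[OF g] by blast
  have "inv' h \<circ> x permutes {1..n}"
    by (intro permutes_compose permutes_inv altD(1)) (rule x h)+
  moreover have "evenperm (inv' h \<circ> x)"
    using altD[OF x(1)] altD[OF h(1)] by (simp add: evenperm_comp evenperm_inv permutation_inverse)
  moreover have "(inv' h \<circ> x) \<circ> g = inv' g \<circ> (inv' h \<circ> x)"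
  proof
    fix i
    have "x (g i) = h (inv' g (inv' h (x i)))"
      using fun_cong[OF x(2), of "x i"] fun_cong[OF h(2), of "x i"] permutes_inverses(2)[OF altD(1)[OF x(1)]] by simp
    then show "((inv' h \<circ> x) \<circ> g) i = (inv' g \<circ> (inv' h \<circ> x)) i"
      using permutes_inverses(2)[OF altD(1)[OF h(1)]] by simp
  qed
  ultimately show "\<exists>y. y permutes {1..n} \<and> evenperm y = True \<and> y \<circ> g = inv' g \<circ> y" by blast
qed

text \<open>The inverse of a 3-cycle is a 3-cycle, and so is every conjugate.\<close>

lemma class_inverting_auto_is_conjugation:
  assumes n: "n \<ge> 4" and hom: "\<tau> \<in> hom (alt_group n) (alt_group n)" and inj: "inj_on \<tau> (carrier (alt_group n))"
    and conj: "\<And>g. g \<in> carrier (alt_group n) \<Longrightarrow> \<exists>h\<in>carrier (alt_group n). \<tau> g = h \<circ> inv' g \<circ> inv' h"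
  obtains s where "s permutes {1..n}" "\<And>g. g \<in> carrier (alt_group n) \<Longrightarrow> \<tau> g = s \<circ> g \<circ> inv' s"
proof -
  have three: "\<exists>x y z. distinct [x, y, z] \<and> {x, y, z} \<subseteq> {1..n} \<and> \<tau> (three_cycle a b c) = three_cycle x y z"
    if abc: "distinct [a, b, c]" "{a, b, c} \<subseteq> {1..n}" for a b c
  proof -
  obtain h where h: "h \<in> carrier (alt_group n)" "\<tau> (three_cycle a b c) = h \<circ> inv' (three_cycle a b c) \<circ> inv' h"
    using conj[OF three_cycle_alt[OF abc]] by blast
  note hp = altD(1)[OF h(1)]
  have "distinct [c, b, a]" using abc(1) by auto
  then have "\<tau> (three_cycle a b c) = three_cycle (h c) (h b) (h a)"
    unfolding h(2) three_cycle_inv[OF abc(1)] by (rule three_cycle_conj[OF hp])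
  moreover have "distinct [h c, h b, h a]" using abc(1) permutes_inj[OF hp] by (auto simp: inj_eq)
  moreover have "{h c, h b, h a} \<subseteq> {1..n}" using abc(2) permutes_in_image[OF hp] by blast
  ultimately show ?thesis by blast
  qed
  show thesis using automorphism_preserving_three_cycles[OF n hom inj three] that by metis
qed

lemma inverting_degrees:
  assumes "inverting n b" "n > 2"
  shows "if b then n \<in> {5, 6, 10, 14} else n \<in> {3, 4, 7, 8, 12}"
  by (rule inverting_parity_restricts) (use assms in \<open>auto simp: inverting_def\<close>)

section \<open>Classification\<close>

lemma model_checks: "model_check 3 False" "model_check 4 False" "model_check 5 True" "model_check 6 True" "model_check 7 False"
  by code_simp+

lemma model_conj:
  assumes "\<tau> \<in> auto (alt_group n)" "generalized_involution_model (alt_group n) \<tau> M" "g \<in> carrier (alt_group n)"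
  shows "\<exists>h\<in>carrier (alt_group n). \<tau> g = h \<circ> inv' g \<circ> inv' h"
proof -
  interpret involutive_auto "alt_group n" \<tau>
    by (rule involutive_auto_alt[OF assms(1)]) (use assms(2) in \<open>simp add: generalized_involution_model_def\<close>)
  obtain h where "h \<in> carrier (alt_group n)"
    "\<tau> g = h \<otimes>\<^bsub>alt_group n\<^esub> inv\<^bsub>alt_group n\<^esub> g \<otimes>\<^bsub>alt_group n\<^esub> inv\<^bsub>alt_group n\<^esub> h"
    using generalized_involution_model_imp[OF assms(2)] assms(3) by metis
  then show ?thesis using alt_group_inv_equality assms(3) by (auto simp: alt_group_mult)
qed

lemma conjugation_model_degrees:
  assumes n: "n \<ge> 4" and s: "s permutes {1..n}" and \<tau>: "\<And>g. g \<in> carrier (alt_group n) \<Longrightarrow> \<tau> g = s \<circ> g \<circ> inv' s"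
    and model: "generalized_involution_model (alt_group n) \<tau> M"
  shows "if evenperm s then n \<in> {5, 6} else n \<in> {4, 7}"
proof -
  have auto: "\<tau> \<in> auto (alt_group n)" and \<tau>\<tau>: "\<And>g. g \<in> carrier (alt_group n) \<Longrightarrow> \<tau> (\<tau> g) = g"
    using model unfolding generalized_involution_model_def by auto
  have "\<tau> g \<in> carrier (alt_group n)" if "g \<in> carrier (alt_group n)" for g
    using auto that unfolding auto_def hom_def by auto
  note inv = conjugation_involution[OF n s \<tau> this \<tau>\<tau>]
  interpret twisted_alt n s \<tau>
    by unfold_locales (use s inv \<tau> in simp_all)
  have "inverting n (evenperm s)" by (rule model_imp_involution_characters(1)[OF model])
  then have "if evenperm s then n \<in> {5, 6, 10, 14} else n \<in> {3, 4, 7, 8, 12}"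
    by (rule inverting_degrees) (use n in simp)
  moreover obtain F where "involution_characters n (evenperm s) F" using model_imp_involution_characters(2)[OF model] by blast
  ultimately show ?thesis using n no_characters_8_12_14[of F] no_characters_10[of F] by (auto split: if_splits)
qed

lemma conjugation_model_exists:
  fixes s :: "nat \<Rightarrow> nat"
  defines "\<tau> \<equiv> \<lambda>n. \<lambda>g\<in>carrier (alt_group n). s \<circ> g \<circ> s"
  assumes s: "s permutes {1..n}" "s \<circ> s = id" and n: "n \<le> 7" and check: "model_check n (evenperm s)"
  shows "\<tau> n \<in> auto (alt_group n)" "\<exists>M. generalized_involution_model (alt_group n) (\<tau> n) M"
proof -
  interpret twisted_alt n s "\<tau> n"
    by unfold_locales (use s in \<open>simp_all add: \<tau>_def\<close>)
  have "bij_betw (\<tau> n) (carrier (alt_group n)) (carrier (alt_group n))"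
    by (rule bij_betw_byWitness[where f'="\<tau> n"]) (auto simp: tau_tau)
  then show auto: "\<tau> n \<in> auto (alt_group n)"
    using tau_hom unfolding auto_def Bij_def by (auto simp: \<tau>_def)
  show "\<exists>M. generalized_involution_model (alt_group n) (\<tau> n) M"
    by (rule involution_characters_imp_model[OF auto model_check_imp_characters[OF n check]])
qed

theorem proposition3p1:
  fixes n :: nat
  assumes "n > 2"
  shows "((\<exists>\<tau> M. \<tau> \<in> inner_auto (alt_group n) \<and>
              generalized_involution_model (alt_group n) \<tau> M) \<longleftrightarrow> n \<in> {5, 6}) \<and>
         ((\<exists>\<tau> M. \<tau> \<in> auto (alt_group n) - inner_auto (alt_group n) \<and>
              generalized_involution_model (alt_group n) \<tau> M) \<longleftrightarrow> n \<in> {3, 4, 7})"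
proof (intro conjI iffI)
  assume "\<exists>\<tau> M. \<tau> \<in> inner_auto (alt_group n) \<and> generalized_involution_model (alt_group n) \<tau> M"
  then obtain \<tau> M where \<tau>: "\<tau> \<in> inner_auto (alt_group n)" and model: "generalized_involution_model (alt_group n) \<tau> M"
    by blast
  have "\<tau> \<in> auto (alt_group n)" using model unfolding generalized_involution_model_def by simp
  then have "inverting n True" using inner_inverting[OF \<tau>] model_conj[OF _ model] by blast
  then have "n \<ge> 4" using inverting_degrees[of n True] assms by auto
  obtain x where x: "x \<in> carrier (alt_group n)" "\<And>g. g \<in> carrier (alt_group n) \<Longrightarrow> \<tau> g = x \<circ> g \<circ> inv' x"
    using inner_auto_alt[OF \<tau>] by metis
  show "n \<in> {5, 6}"
    using conjugation_model_degrees[OF \<open>n \<ge> 4\<close> altD(1)[OF x(1)] x(2) model] altD(2)[OF x(1)] by simp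
next
  assume n: "n \<in> {5, 6}"
  let ?\<tau> = "\<lambda>g\<in>carrier (alt_group n). id \<circ> g \<circ> id"
  interpret group "alt_group n" by (rule alt_group_is_group)
  have "model_check n (evenperm id)" using n model_checks by auto
  then have "\<exists>M. generalized_involution_model (alt_group n) ?\<tau> M"
    using n by (intro conjugation_model_exists(2)) (auto simp: permutes_id)
  moreover have "?\<tau> = (\<lambda>g\<in>carrier (alt_group n). \<one>\<^bsub>alt_group n\<^esub> \<otimes>\<^bsub>alt_group n\<^esub> g \<otimes>\<^bsub>alt_group n\<^esub> inv\<^bsub>alt_group n\<^esub> \<one>\<^bsub>alt_group n\<^esub>)"
    by (rule restrict_ext) simp
  then have "?\<tau> \<in> inner_auto (alt_group n)" unfolding inner_auto_def by blast
  ultimately show "\<exists>\<tau> M. \<tau> \<in> inner_auto (alt_group n) \<and> generalized_involution_model (alt_group n) \<tau> M"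
    by blast
next
  assume "\<exists>\<tau> M. \<tau> \<in> auto (alt_group n) - inner_auto (alt_group n) \<and> generalized_involution_model (alt_group n) \<tau> M"
  then obtain \<tau> M where \<tau>: "\<tau> \<in> auto (alt_group n)" "\<tau> \<notin> inner_auto (alt_group n)"
    and model: "generalized_involution_model (alt_group n) \<tau> M" by blast
  show "n \<in> {3, 4, 7}"
  proof (cases "n = 3")
    case False
    then have n: "n \<ge> 4" using assms by simp
    have hom: "\<tau> \<in> hom (alt_group n) (alt_group n)" and inj: "inj_on \<tau> (carrier (alt_group n))"
      and ext: "\<tau> \<in> extensional (carrier (alt_group n))"
      using \<tau>(1) unfolding auto_def Bij_def bij_betw_def by auto
    obtain s where s: "s permutes {1..n}" "\<And>g. g \<in> carrier (alt_group n) \<Longrightarrow> \<tau> g = s \<circ> g \<circ> inv' s"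
      using class_inverting_auto_is_conjugation[OF n hom inj model_conj[OF \<tau>(1) model]] by metis
    have "\<not> evenperm s"
    proof
      assume "evenperm s"
      then have sA: "s \<in> carrier (alt_group n)" using s(1) by (simp add: alt_group_carrier)
      have "\<tau> = (\<lambda>g\<in>carrier (alt_group n). s \<otimes>\<^bsub>alt_group n\<^esub> g \<otimes>\<^bsub>alt_group n\<^esub> inv\<^bsub>alt_group n\<^esub> s)"
        using s(2) ext alt_group_inv_equality[OF sA]
        by (intro extensionalityI[of _ "carrier (alt_group n)"]) (auto simp: alt_group_mult)
      then show False using \<tau>(2) sA unfolding inner_auto_def by blast
    qed
    then show ?thesis using conjugation_model_degrees[OF n s model] by simp
  qed simp
next
  assume n: "n \<in> {3, 4, 7}"
  let ?s = "Transposition.transpose 1 2 :: nat \<Rightarrow> nat"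
  let ?\<tau> = "\<lambda>g\<in>carrier (alt_group n). ?s \<circ> g \<circ> ?s"
  have s: "?s permutes {1..n}" "?s \<circ> ?s = id" using assms by (auto intro: permutes_swap_id)
  have odd: "evenperm ?s = False" by (simp add: evenperm_swap)
  have "model_check n (evenperm ?s)" unfolding odd using n model_checks by auto
  then have ex: "?\<tau> \<in> auto (alt_group n)" "\<exists>M. generalized_involution_model (alt_group n) ?\<tau> M"
    using conjugation_model_exists[OF s] n by auto
  have "?\<tau> \<notin> inner_auto (alt_group n)"
  proof
    assume "?\<tau> \<in> inner_auto (alt_group n)"
    then have "inverting n True" using ex inner_inverting model_conj by metis
    then show False using inverting_degrees[of n True] n assms by auto
  qed
  then show "\<exists>\<tau> M. \<tau> \<in> auto (alt_group n) - inner_auto (alt_group n) \<and> generalized_involution_model (alt_group n) \<tau> M"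
    using ex by blast
qed

end
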